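(* For any $n,m\in\mathbb N$ (positive integers) there exist a map $p:[0,1]^m\to[0,1]^n$ that is of class $C^k$ for all real $k$ with $0\le k<\frac{m}{n}$, and a connected set $E\subseteq[0,1]^m$, such that every partial derivative of $p$ of positive order $<\frac{m}{n}$ vanishes on $E$, and $p(E)=[0,1]^n$.
   Context: Classes $C^k$ for real $k$. Let $M\subseteq\mathbb R^m$, $f:M\to\mathbb R^n$ and $\lambda\in(0,1]$. The $\lambda$-partial derivatives $f^{(\lambda)}_1,\dots,f^{(\lambda)}_m$ are defined by $$f_i^{(\lambda)}(a)=\lim_{t\to 0}\operatorname{sign}(t)\,\frac{f(a_1,\dots,a_{i-1},a_i+t,a_{i+1},\dots,a_m)-f(a)}{|t|^\lambda},\qquad a=(a_1,\dots,a_m),$$ where only those $t\neq 0$ are used for which the shifted point lies in $M$ (so limits are one-sided at boundary points of a cube). For $\lambda\in(0,1]$, $f\in C^\lambda$ on $M$ means that all $\lambda$-partial derivatives of $f$ exist and are continuous on $M$; $C^0$ means continuous. For real $k\ge 0$ with integer part $[k]$, $f\in C^k$ means that $f\in C^{[k]}$ (in the usual sense) and every partial derivative of $f$ of order $[k]$ is of class $C^{k-[k]}$ on $M$. Partial derivatives of integer order are the usual (mixed) ones; a partial derivative of non-integer order $k$ is a $(k-[k])$-partial derivative of a partial derivative of order $[k]$. *)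

theory Defs
  imports "HOL-Analysis.Analysis"
begin

text \<open>
  Only shifts \<open>t\<close> for which the shifted point stays in \<open>M\<close> enter the limit, so it is one-sided at
  boundary points of a cube.  If \<open>M\<close> contains no such \<open>t \<noteq> 0\<close> arbitrarily close to \<open>0\<close>,
  the limit is vacuous; lemma \<open>shift_islimpt_unit_cube\<close> below excludes this for the unit cube.
\<close>

definition shifts :: "(real^'m) set \<Rightarrow> 'm \<Rightarrow> real^'m \<Rightarrow> real set" where
  "shifts M i a = {t. a + t *\<^sub>R axis i 1 \<in> M}"

definition has_lambda_partial ::
    "(real^'m) set \<Rightarrow> real \<Rightarrow> 'm \<Rightarrow> (real^'m \<Rightarrow> 'b::real_normed_vector) \<Rightarrow> real^'m \<Rightarrow> 'b \<Rightarrow> bool" where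
  "has_lambda_partial M \<alpha> i f a l \<longleftrightarrow>
     ((\<lambda>t. sgn t *\<^sub>R ((f (a + t *\<^sub>R axis i 1) - f a) /\<^sub>R (\<bar>t\<bar> powr \<alpha>))) \<longlongrightarrow> l)
       (at 0 within shifts M i a)"

definition lambda_partial ::
    "(real^'m) set \<Rightarrow> real \<Rightarrow> 'm \<Rightarrow> (real^'m \<Rightarrow> 'b::real_normed_vector) \<Rightarrow> real^'m \<Rightarrow> 'b" where
  "lambda_partial M \<alpha> i f a =
     Lim (at 0 within shifts M i a)
       (\<lambda>t. sgn t *\<^sub>R ((f (a + t *\<^sub>R axis i 1) - f a) /\<^sub>R (\<bar>t\<bar> powr \<alpha>)))"

text \<open>For \<open>\<alpha> = 1\<close> this is the usual partial derivative relative to \<open>M\<close>.\<close>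

lemma has_lambda_partial_one_iff:
  "has_lambda_partial M 1 i f a l \<longleftrightarrow>
     ((\<lambda>t. f (a + t *\<^sub>R axis i 1)) has_vector_derivative l) (at 0 within shifts M i a)"
proof -
  have "((\<lambda>t. f (a + t *\<^sub>R axis i 1)) has_vector_derivative l) (at 0 within shifts M i a)
      \<longleftrightarrow> ((\<lambda>t. (f (a + t *\<^sub>R axis i 1) - f a - t *\<^sub>R l) /\<^sub>R \<bar>t\<bar>) \<longlongrightarrow> 0)
        (at 0 within shifts M i a)"
    by (simp add: has_vector_derivative_def has_derivative_within bounded_linear_scaleR_left
        algebra_simps divide_inverse)
  also have "\<dots> \<longleftrightarrow> ((\<lambda>t. sgn t *\<^sub>R ((f (a + t *\<^sub>R axis i 1) - f a) /\<^sub>R (\<bar>t\<bar> powr 1)) - l) \<longlongrightarrow> 0)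
        (at 0 within shifts M i a)"
  proof (subst (1 2) tendsto_norm_zero_iff [symmetric], rule Lim_cong_within)
    fix t :: real
    assume "t \<noteq> 0"
    then have "sgn t *\<^sub>R ((f (a + t *\<^sub>R axis i 1) - f a) /\<^sub>R (\<bar>t\<bar> powr 1)) - l
        = sgn t *\<^sub>R ((f (a + t *\<^sub>R axis i 1) - f a - t *\<^sub>R l) /\<^sub>R \<bar>t\<bar>)"
      by (auto simp: sgn_real_def abs_real_def scaleR_diff_right)
    with \<open>t \<noteq> 0\<close> show "norm ((f (a + t *\<^sub>R axis i 1) - f a - t *\<^sub>R l) /\<^sub>R \<bar>t\<bar>)
        = norm (sgn t *\<^sub>R ((f (a + t *\<^sub>R axis i 1) - f a) /\<^sub>R (\<bar>t\<bar> powr 1)) - l)"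
      by (simp add: abs_mult abs_sgn_eq)
  qed simp_all
  also have "\<dots> \<longleftrightarrow> has_lambda_partial M 1 i f a l"
    unfolding has_lambda_partial_def by (rule Lim_null [symmetric])
  finally show ?thesis by simp
qed

lemma lambda_partial_eqI:
  assumes "has_lambda_partial M \<alpha> i f a l" and "0 islimpt shifts M i a"
  shows "lambda_partial M \<alpha> i f a = l"
  using assms unfolding has_lambda_partial_def lambda_partial_def
  by (intro tendsto_Lim) (auto simp: trivial_limit_within)

lemma shift_islimpt_unit_cube:
  fixes a :: "real^'m"
  assumes "a \<in> cbox 0 1"
  shows "0 islimpt shifts (cbox 0 1) i a"
proof -
  have a: "0 \<le> a $ j" "a $ j \<le> 1" for j
    using assms by (auto simp: mem_box_cart)
  have "shifts (cbox 0 1) i a = {- (a $ i)..1 - a $ i}"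
  proof (rule set_eqI)
    fix t
    have "(\<forall>j. 0 \<le> (a + t *\<^sub>R axis i 1) $ j \<and> (a + t *\<^sub>R axis i 1) $ j \<le> 1) \<longleftrightarrow>
        0 \<le> a $ i + t \<and> a $ i + t \<le> 1"
      using a by (auto simp: axis_def dest: spec [of _ i])
    then show "t \<in> shifts (cbox 0 1) i a \<longleftrightarrow> t \<in> {- (a $ i)..1 - a $ i}"
      by (auto simp: shifts_def mem_box_cart)
  qed
  moreover have "0 islimpt {- (a $ i)..1 - a $ i}"
    using a [of i] by (intro connected_imp_perfect) auto
  ultimately show ?thesis by simp
qed

text \<open>Iterated partial derivatives; the head of the index list is the last variable to be
  differentiated.\<close>

primrec iterated_partial ::
    "(real^'m) set \<Rightarrow> 'm list \<Rightarrow> (real^'m \<Rightarrow> 'b::real_normed_vector) \<Rightarrow> real^'m \<Rightarrow> 'b" where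
  "iterated_partial M [] f = f"
| "iterated_partial M (i # js) f = lambda_partial M 1 i (iterated_partial M js f)"

definition class_C_lambda ::
    "real \<Rightarrow> (real^'m) set \<Rightarrow> (real^'m \<Rightarrow> 'b::real_normed_vector) \<Rightarrow> bool" where
  "class_C_lambda \<alpha> M f \<longleftrightarrow>
     (if \<alpha> = 0 then continuous_on M f
      else \<forall>i. (\<forall>a\<in>M. \<exists>l. has_lambda_partial M \<alpha> i f a l) \<and>
               continuous_on M (lambda_partial M \<alpha> i f))"

definition class_C_nat ::
    "nat \<Rightarrow> (real^'m) set \<Rightarrow> (real^'m \<Rightarrow> 'b::real_normed_vector) \<Rightarrow> bool" where
  "class_C_nat N M f \<longleftrightarrow>
     (\<forall>js. length js < N \<longrightarrow>
        (\<forall>i. \<forall>a\<in>M. \<exists>l. has_lambda_partial M 1 i (iterated_partial M js f) a l)) \<and>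
     (\<forall>js. length js \<le> N \<longrightarrow> continuous_on M (iterated_partial M js f))"

definition class_C ::
    "real \<Rightarrow> (real^'m) set \<Rightarrow> (real^'m \<Rightarrow> 'b::real_normed_vector) \<Rightarrow> bool" where
  "class_C k M f \<longleftrightarrow>
     class_C_nat (nat \<lfloor>k\<rfloor>) M f \<and>
     (\<forall>js. length js = nat \<lfloor>k\<rfloor> \<longrightarrow> class_C_lambda (frac k) M (iterated_partial M js f))"

text \<open>These are limits given by \<open>Lim\<close>, hence meaningful only for \<open>f\<close> of class \<open>C\<^sup>k\<close>.\<close>

definition partials_of_order ::
    "real \<Rightarrow> (real^'m) set \<Rightarrow> (real^'m \<Rightarrow> 'b::real_normed_vector) \<Rightarrow> (real^'m \<Rightarrow> 'b) set" where
  "partials_of_order k M f =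
     (if k \<in> \<int> then {iterated_partial M js f | js. length js = nat \<lfloor>k\<rfloor>}
      else {lambda_partial M (frac k) i (iterated_partial M js f) | i js. length js = nat \<lfloor>k\<rfloor>})"

end

theory Submission
  imports Defs
begin

text \<open>
  Let \<open>m\<close> and \<open>n\<close> be the dimensions of the domain and of the target.  At every stage the domain
  cube is cut into \<open>L\<^sup>m\<close> cells and the target cube into \<open>M\<^sup>n\<close> cells, where
  \<open>L\<^sup>m = M\<^sup>n\<close>, and both families are numbered along a boustrophedon path.  The domain cells are
  shrunk a little, so that neighbours are separated by gaps of comparable size, and the \<open>t\<close>-th
  shrunken cell is mapped into the \<open>t\<close>-th target cell by a copy of the map of the next stage; across
  the gaps the copies are blended by cutoff functions.  For odd \<open>L\<close> and \<open>M\<close> the cells number \<open>t\<close> and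
  \<open>t + 1\<close> of either grid share the vertex all of whose coordinates have the parity of \<open>t + 1\<close>
  (\<open>snake_Suc_endpoint\<close>).  The copies that belong to consecutive domain cells take the common vertex
  of their target cells as value at the two corners that face each other across the gap.
  Hence the map is flat along the segment (the link) that joins these corners.
  
  The points that at every stage lie in a shrunken cell or on a link form the set \<open>core\<close>.  It is an
  intersection of compact connected sets (\<open>nest_connected\<close>), because each cell is connected to the
  next one by a link, and its image is the whole target cube (\<open>approx_nearly_onto\<close>), because every
  point of the target has an address.
  
  Differentiability is a matter of counting.  One stage divides the oscillation by \<open>M\<close> and the length
  scale by \<open>L\<close>, up to constants, and so it multiplies the size of the derivatives of order \<open>k\<close> by at
  most a constant times \<open>L\<^sup>k / M\<close>.  The constants do not depend on the number of cells, since only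
  boundedly many cutoff functions overlap (\<open>jet_bound_locally_finite_sum\<close>).  With
  \<open>L = l\<^sup>n\<close> and \<open>M = l\<^sup>m\<close> this factor is a constant times \<open>l\<close> to the power \<open>n k - m\<close>, which
  tends to \<open>0\<close> for every \<open>k < m / n\<close> when \<open>l\<close> grows from stage to stage; the choice
  \<open>l = 2 j + 3\<close> at stage \<open>j\<close> makes the products of the factors summable
  (\<open>amplitude_rate_summable\<close>).  So the iterates converge together with their derivatives of integer
  order below \<open>m / n\<close>, and interpolating between consecutive orders gives Hoelder estimates for the
  derivatives of the limit.  A fractional derivative of order \<open>\<alpha>\<close> vanishes at every point as soon as
  a Hoelder condition with an exponent above \<open>\<alpha>\<close> holds.  The derivatives of integer order vanish on
  \<open>core\<close>, because there the bounds for the iterates involve only these products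
  (\<open>approx_flat\<close>, which rests on the local formula \<open>refine_near_skeleton\<close>).
  
  Everything is done for one component of the target at a time, so that almost all functions are
  real-valued.
\<close>

section \<open>Functions with bounded partial derivatives\<close>

definition has_partial :: "'a::euclidean_space \<Rightarrow> ('a \<Rightarrow> real) \<Rightarrow> ('a \<Rightarrow> real) \<Rightarrow> bool" where
  "has_partial b f g \<longleftrightarrow> (\<forall>x. ((\<lambda>t. f (x + t *\<^sub>R b)) has_real_derivative g x) (at 0))"

text \<open>
  Partial derivatives of order \<open>q \<le> r\<close> are at most \<open>A * l ^ q\<close> on \<open>X\<close>: \<open>A\<close> measures the
  amplitude and \<open>l\<close> the frequency of the function.  Separating the two makes the estimates for
  products and compositions free of binomial constants.  Regularity is required everywhere and only
  the size is restricted to \<open>X\<close>, so that \<open>X = {a}\<close> expresses flatness at a point.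
\<close>
primrec jet_bound ::
    "'a::euclidean_space set \<Rightarrow> nat \<Rightarrow> real \<Rightarrow> real \<Rightarrow> ('a \<Rightarrow> real) \<Rightarrow> bool" where
  "jet_bound X 0 A l f \<longleftrightarrow> continuous_on UNIV f \<and> (\<forall>x\<in>X. \<bar>f x\<bar> \<le> A)"
| "jet_bound X (Suc r) A l f \<longleftrightarrow> continuous_on UNIV f \<and> (\<forall>x\<in>X. \<bar>f x\<bar> \<le> A) \<and>
     (\<forall>b\<in>Basis. \<exists>g. has_partial b f g \<and> jet_bound X r (A * l) l g)"

lemma has_partial_DERIV:
  assumes "has_partial b f g"
  shows "((\<lambda>t. f (x + t *\<^sub>R b)) has_real_derivative g (x + t *\<^sub>R b)) (at t)"
proof -
  have "((\<lambda>s. f ((x + t *\<^sub>R b) + s *\<^sub>R b)) has_real_derivative g (x + t *\<^sub>R b)) (at 0)"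
    using assms by (auto simp: has_partial_def)
  then have "((\<lambda>s. f (x + (s + t) *\<^sub>R b)) has_real_derivative g (x + t *\<^sub>R b)) (at 0)"
    by (simp add: algebra_simps)
  then show ?thesis
    using DERIV_shift [of "\<lambda>t. f (x + t *\<^sub>R b)" "g (x + t *\<^sub>R b)" 0 t] by simp
qed

lemma has_partial_const: "has_partial b (\<lambda>_. c) (\<lambda>_. 0)"
  by (simp add: has_partial_def)

lemma has_partial_add:
  "has_partial b f f' \<Longrightarrow> has_partial b g g' \<Longrightarrow> has_partial b (\<lambda>x. f x + g x) (\<lambda>x. f' x + g' x)"
  unfolding has_partial_def by (auto intro: DERIV_add)

lemma has_partial_diff:
  "has_partial b f f' \<Longrightarrow> has_partial b g g' \<Longrightarrow> has_partial b (\<lambda>x. f x - g x) (\<lambda>x. f' x - g' x)"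
  unfolding has_partial_def by (auto intro: DERIV_diff)

lemma has_partial_sum:
  "(\<And>t. t \<in> I \<Longrightarrow> has_partial b (f t) (g t)) \<Longrightarrow>
   has_partial b (\<lambda>x. \<Sum>t\<in>I. f t x) (\<lambda>x. \<Sum>t\<in>I. g t x)"
  unfolding has_partial_def by (auto intro: DERIV_sum)

lemma has_partial_mult:
  assumes "has_partial b f f'" "has_partial b g g'"
  shows "has_partial b (\<lambda>x. f x * g x) (\<lambda>x. f' x * g x + f x * g' x)"
proof -
  have "((\<lambda>t. f (x + t *\<^sub>R b) * g (x + t *\<^sub>R b)) has_real_derivative
      f' x * g (x + 0 *\<^sub>R b) + g' x * f (x + 0 *\<^sub>R b)) (at 0)" for x
    using assms unfolding has_partial_def by (intro DERIV_mult) auto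
  then show ?thesis
    unfolding has_partial_def by (simp add: mult.commute)
qed

lemma jet_bound_continuous: "jet_bound X r A l f \<Longrightarrow> continuous_on UNIV f"
  by (cases r) auto

lemma jet_bound_abs: "jet_bound X r A l f \<Longrightarrow> x \<in> X \<Longrightarrow> \<bar>f x\<bar> \<le> A"
  by (cases r) auto

lemma jet_bound_SucI:
  assumes "continuous_on UNIV f" "\<And>x. x \<in> X \<Longrightarrow> \<bar>f x\<bar> \<le> A"
    and "\<And>b. b \<in> Basis \<Longrightarrow> \<exists>g. has_partial b f g \<and> jet_bound X r (A * l) l g"
  shows "jet_bound X (Suc r) A l f"
  using assms by simp

lemma jet_bound_partial:
  "jet_bound X (Suc r) A l f \<Longrightarrow> b \<in> Basis \<Longrightarrow>
   \<exists>g. has_partial b f g \<and> jet_bound X r (A * l) l g"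
  by simp

lemma jet_bound_mono:
  assumes "jet_bound X r A l f" "Y \<subseteq> X" "A \<le> B" "l \<le> m" "0 \<le> A" "0 \<le> l"
  shows "jet_bound Y r B m f"
  using assms
proof (induction r arbitrary: A B f)
  case (Suc r)
  have *: "A * l \<le> B * m" "0 \<le> A * l"
    using Suc.prems by (auto intro!: mult_mono)
  show ?case
  proof (rule jet_bound_SucI)
    show "continuous_on UNIV f"
      using Suc.prems(1) by (rule jet_bound_continuous)
    show "\<bar>f x\<bar> \<le> B" if "x \<in> Y" for x
      using jet_bound_abs [OF Suc.prems(1), of x] Suc.prems(2,3) that by (meson order_trans subsetD)
    show "\<exists>g. has_partial b f g \<and> jet_bound Y r (B * m) m g" if "b \<in> Basis" for b
      using jet_bound_partial [OF Suc.prems(1) that] Suc.IH [OF _ Suc.prems(2) *(1) Suc.prems(4) *(2)]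
        Suc.prems(6) by blast
  qed
qed (simp, meson order_trans subsetD)

lemma jet_bound_lower: "jet_bound X (Suc r) A l f \<Longrightarrow> jet_bound X r A l f"
proof (induction r arbitrary: A f)
  case (Suc r)
  then show ?case
    using jet_bound_continuous [OF Suc.prems] jet_bound_abs [OF Suc.prems]
      jet_bound_partial [OF Suc.prems]
    by (intro jet_bound_SucI) blast+
qed simp

lemma jet_bound_order_mono: "jet_bound X r A l f \<Longrightarrow> q \<le> r \<Longrightarrow> jet_bound X q A l f"
  by (induction r) (auto simp: le_Suc_eq simp del: jet_bound.simps intro: jet_bound_lower)

lemma jet_bound_zero: "0 \<le> A \<Longrightarrow> 0 \<le> l \<Longrightarrow> jet_bound X r A l (\<lambda>_. 0)"
proof (induction r arbitrary: A)
  case (Suc r)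
  then show ?case
    using has_partial_const [of _ 0] by (intro jet_bound_SucI) (auto intro!: exI [of _ "\<lambda>_. 0"])
qed simp

lemma jet_bound_const: "\<bar>c\<bar> \<le> A \<Longrightarrow> 0 \<le> l \<Longrightarrow> jet_bound X r A l (\<lambda>_. c)"
  using has_partial_const [of _ c] jet_bound_zero [of "A * l" l X]
  by (cases r) (auto intro!: exI [of _ "\<lambda>_. 0"])

lemma jet_bound_add:
  assumes "jet_bound X r A l f" "jet_bound X r B l g"
  shows "jet_bound X r (A + B) l (\<lambda>x. f x + g x)"
  using assms
proof (induction r arbitrary: A B f g)
  case 0
  then show ?case
    by (auto intro!: continuous_intros order_trans [OF abs_triangle_ineq] add_mono)
next
  case (Suc r)
  have "\<exists>h. has_partial b (\<lambda>x. f x + g x) h \<and> jet_bound X r ((A + B) * l) l h"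
    if "b \<in> Basis" for b
  proof -
    obtain f' g' where "has_partial b f f'" "jet_bound X r (A * l) l f'"
      "has_partial b g g'" "jet_bound X r (B * l) l g'"
      using jet_bound_partial [OF Suc.prems(1) \<open>b \<in> Basis\<close>]
        jet_bound_partial [OF Suc.prems(2) \<open>b \<in> Basis\<close>] by blast
    then show ?thesis
      using Suc.IH [of "A * l" f' "B * l" g'] has_partial_add [of b f f' g g']
      by (auto simp: distrib_right)
  qed
  then show ?case
    using Suc.prems
    by (auto intro!: continuous_intros order_trans [OF abs_triangle_ineq] add_mono)
qed

text \<open>
  Frequencies add because the Leibniz rule expands \<open>(l + m) ^ q\<close>.
\<close>
lemma jet_bound_mult:
  assumes "jet_bound X r A l f" "jet_bound X r B m g" "0 \<le> A" "0 \<le> B" "0 \<le> l" "0 \<le> m"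
  shows "jet_bound X r (A * B) (l + m) (\<lambda>x. f x * g x)"
  using assms
proof (induction r arbitrary: A B f g)
  case 0
  then show ?case
    by (auto intro!: continuous_intros mult_mono simp: abs_mult)
next
  case (Suc r)
  have "\<exists>h. has_partial b (\<lambda>x. f x * g x) h \<and> jet_bound X r ((A * B) * (l + m)) (l + m) h"
    if "b \<in> Basis" for b
  proof -
    obtain f' g' where *: "has_partial b f f'" "jet_bound X r (A * l) l f'"
      "has_partial b g g'" "jet_bound X r (B * m) m g'"
      using jet_bound_partial [OF Suc.prems(1) \<open>b \<in> Basis\<close>]
        jet_bound_partial [OF Suc.prems(2) \<open>b \<in> Basis\<close>] by blast
    have "jet_bound X r ((A * l) * B) (l + m) (\<lambda>x. f' x * g x)"
      using Suc.prems * by (intro Suc.IH jet_bound_lower [of X r B]) auto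
    moreover have "jet_bound X r (A * (B * m)) (l + m) (\<lambda>x. f x * g' x)"
      using Suc.prems * by (intro Suc.IH jet_bound_lower [of X r A]) auto
    ultimately have "jet_bound X r ((A * l) * B + A * (B * m)) (l + m)
        (\<lambda>x. f' x * g x + f x * g' x)"
      by (rule jet_bound_add)
    then show ?thesis
      using has_partial_mult [OF *(1,3)] by (auto simp: algebra_simps)
  qed
  then show ?case
    using Suc.prems by (auto intro!: continuous_intros mult_mono simp: abs_mult)
qed

lemma jet_bound_cmult:
  assumes "jet_bound X r A l f" "\<bar>c\<bar> * A \<le> B" "0 \<le> A" "0 \<le> l"
  shows "jet_bound X r B l (\<lambda>x. c * f x)"
proof -
  have "jet_bound X r (\<bar>c\<bar> * A) (0 + l) (\<lambda>x. c * f x)"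
    using assms by (intro jet_bound_mult jet_bound_const) auto
  then show ?thesis
    using jet_bound_mono [of X r "\<bar>c\<bar> * A" l _ X B l] assms by simp
qed

lemma jet_bound_diff:
  assumes "jet_bound X r A l f" "jet_bound X r B l g" "0 \<le> B" "0 \<le> l"
  shows "jet_bound X r (A + B) l (\<lambda>x. f x - g x)"
  using jet_bound_add [OF assms(1) jet_bound_cmult [OF assms(2), of "-1" B]] assms by simp

lemma jet_bound_prod:
  assumes "finite I" "\<And>i. i \<in> I \<Longrightarrow> jet_bound X r A l (f i)" "0 \<le> A" "0 \<le> l"
  shows "jet_bound X r (A ^ card I) (real (card I) * l) (\<lambda>x. \<Prod>i\<in>I. f i x)"
  using assms
proof (induction I rule: finite_induct)
  case empty
  then show ?case by (simp add: jet_bound_const)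
next
  case (insert i I)
  have "jet_bound X r (A * A ^ card I) (l + real (card I) * l) (\<lambda>x. f i x * (\<Prod>i\<in>I. f i x))"
    using insert by (intro jet_bound_mult) auto
  then show ?case
    using insert by (simp add: algebra_simps)
qed

text \<open>
  The bound depends on the number \<open>K\<close> of terms that overlap at a point and not on the number of all
  terms; this keeps the constants below independent of the number of cells of a grid.
\<close>
lemma jet_bound_locally_finite_sum:
  fixes f :: "'i \<Rightarrow> 'a::euclidean_space \<Rightarrow> real"
  assumes "finite I"
    and "\<And>t. t \<in> I \<Longrightarrow> jet_bound X r A l (f t)"
    and "\<And>x. x \<in> X \<Longrightarrow> \<exists>N\<subseteq>I. card N \<le> K \<and> (\<forall>t\<in>I - N. \<forall>\<^sub>F z in nhds x. f t z = 0)"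
    and "0 \<le> A" "0 \<le> l"
  shows "jet_bound X r (real K * A) l (\<lambda>x. \<Sum>t\<in>I. f t x)"
  using assms
proof (induction r arbitrary: A f)
  have bound: "\<bar>\<Sum>t\<in>I. f t x\<bar> \<le> real K * A"
    if "x \<in> X" and f: "\<And>t x. t \<in> I \<Longrightarrow> x \<in> X \<Longrightarrow> \<bar>f t x\<bar> \<le> A"
      and loc: "\<And>x. x \<in> X \<Longrightarrow> \<exists>N\<subseteq>I. card N \<le> K \<and> (\<forall>t\<in>I - N. \<forall>\<^sub>F z in nhds x. f t z = 0)"
      and "0 \<le> A"
    for x A and f :: "'i \<Rightarrow> 'a \<Rightarrow> real"
  proof -
    obtain N where N: "N \<subseteq> I" "card N \<le> K"
      and ev: "\<forall>t\<in>I - N. \<forall>\<^sub>F z in nhds x. f t z = 0"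
      using loc [OF \<open>x \<in> X\<close>] by blast
    have zero: "f t x = 0" if "t \<in> I - N" for t
      using eventually_nhds_x_imp_x [OF bspec [OF ev that]] .
    have "(\<Sum>t\<in>I. f t x) = (\<Sum>t\<in>N. f t x)"
      using N(1) \<open>finite I\<close> by (intro sum.mono_neutral_right) (auto simp: zero)
    also have "\<bar>\<dots>\<bar> \<le> (\<Sum>t\<in>N. A)"
      using N f \<open>x \<in> X\<close> by (intro order_trans [OF sum_abs] sum_mono) auto
    also have "\<dots> \<le> real K * A"
      using N \<open>0 \<le> A\<close> by (simp add: mult_right_mono)
    finally show ?thesis .
  qed
  {
    case 0
    then show ?case
      using bound [of _ f A] by (auto intro!: continuous_on_sum)
  next
    case (Suc r)
    have "\<exists>h. has_partial b (\<lambda>x. \<Sum>t\<in>I. f t x) h \<and> jet_bound X r (real K * A * l) l h"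
      if "b \<in> Basis" for b
    proof -
      have "\<forall>t\<in>I. \<exists>g. has_partial b (f t) g \<and> jet_bound X r (A * l) l g"
        using jet_bound_partial [OF Suc.prems(2) \<open>b \<in> Basis\<close>] by blast
      then obtain g where g: "\<And>t. t \<in> I \<Longrightarrow> has_partial b (f t) (g t)"
        "\<And>t. t \<in> I \<Longrightarrow> jet_bound X r (A * l) l (g t)"
        by metis
      have "\<forall>\<^sub>F z in nhds x. g t z = 0"
        if "t \<in> I" and ev: "\<forall>\<^sub>F z in nhds x. f t z = 0" for t x
      proof -
        obtain U where U: "open U" "x \<in> U" "\<And>z. z \<in> U \<Longrightarrow> f t z = 0"
          using ev by (auto simp: eventually_nhds)
        have "g t z = 0" if "z \<in> U" for z
        proof -
          have "((\<lambda>s. z + s *\<^sub>R b) \<longlongrightarrow> z + 0 *\<^sub>R b) (nhds 0)"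
            by (intro tendsto_intros filterlim_ident)
          then have "\<forall>\<^sub>F s in nhds 0. z + s *\<^sub>R b \<in> U"
            using \<open>open U\<close> \<open>z \<in> U\<close> by (auto dest: topological_tendstoD)
          then have "\<forall>\<^sub>F s in nhds 0. f t (z + s *\<^sub>R b) = 0"
            by eventually_elim (rule U)
          moreover have "((\<lambda>s. f t (z + s *\<^sub>R b)) has_real_derivative g t z) (at 0)"
            using g(1) [OF \<open>t \<in> I\<close>] by (auto simp: has_partial_def)
          ultimately have "((\<lambda>s. 0) has_real_derivative g t z) (at 0)"
            using DERIV_cong_ev [of 0 0 "\<lambda>s. f t (z + s *\<^sub>R b)" "\<lambda>s. 0"] by auto
          then show ?thesis
            using DERIV_unique DERIV_const by blast
        qed
        then show ?thesis
          using U by (auto simp: eventually_nhds)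
      qed
      then have "\<exists>N\<subseteq>I. card N \<le> K \<and> (\<forall>t\<in>I - N. \<forall>\<^sub>F z in nhds x. g t z = 0)"
        if "x \<in> X" for x
        using Suc.prems(3) [OF that] by (metis DiffD1)
      then have "jet_bound X r (real K * (A * l)) l (\<lambda>x. \<Sum>t\<in>I. g t x)"
        using Suc.prems g by (intro Suc.IH) auto
      then show ?thesis
        using has_partial_sum [of I b f g] g by (auto simp: mult.assoc)
    qed
    moreover have "continuous_on UNIV (\<lambda>x. \<Sum>t\<in>I. f t x)"
      using Suc.prems(2) by (intro continuous_on_sum) auto
    moreover have "\<forall>x\<in>X. \<bar>\<Sum>t\<in>I. f t x\<bar> \<le> real K * A"
      using bound [of _ f A] Suc.prems by auto
    ultimately show ?case
      by simp
  }
qed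

text \<open>
  The first bound only supplies the regularity of \<open>f\<close>; its size is read off from \<open>g\<close>.
\<close>
lemma jet_bound_local:
  assumes "jet_bound UNIV r B m f" "jet_bound X r A l g" "\<And>x. x \<in> X \<Longrightarrow> \<forall>\<^sub>F z in nhds x. f z = g z"
  shows "jet_bound X r A l f"
  using assms
proof (induction r arbitrary: A B f g)
  case 0
  then show ?case using eventually_nhds_x_imp_x by fastforce
next
  case (Suc r)
  have "\<exists>h. has_partial b f h \<and> jet_bound X r (A * l) l h" if "b \<in> Basis" for b
  proof -
    obtain f' g' where *: "has_partial b f f'" "jet_bound UNIV r (B * m) m f'"
      "has_partial b g g'" "jet_bound X r (A * l) l g'"
      using jet_bound_partial [OF Suc.prems(1) \<open>b \<in> Basis\<close>]
        jet_bound_partial [OF Suc.prems(2) \<open>b \<in> Basis\<close>] by blast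
    have "\<forall>\<^sub>F z in nhds x. f' z = g' z" if x: "x \<in> X" for x
    proof -
      obtain U where U: "open U" "x \<in> U" "\<And>z. z \<in> U \<Longrightarrow> f z = g z"
        using Suc.prems(3) [OF x] by (auto simp: eventually_nhds)
      have "f' z = g' z" if "z \<in> U" for z
      proof -
        have "((\<lambda>s. z + s *\<^sub>R b) \<longlongrightarrow> z + 0 *\<^sub>R b) (nhds 0)"
          by (intro tendsto_intros filterlim_ident)
        then have "\<forall>\<^sub>F s in nhds 0. z + s *\<^sub>R b \<in> U"
          using \<open>open U\<close> \<open>z \<in> U\<close> by (auto dest: topological_tendstoD)
        then have "\<forall>\<^sub>F s in nhds 0. f (z + s *\<^sub>R b) = g (z + s *\<^sub>R b)"
          by eventually_elim (rule U)
        then show ?thesis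
          using * DERIV_cong_ev [of 0 0 "\<lambda>s. f (z + s *\<^sub>R b)" "\<lambda>s. g (z + s *\<^sub>R b)"]
          unfolding has_partial_def by (metis DERIV_unique)
      qed
      then show ?thesis
        using U by (auto simp: eventually_nhds)
    qed
    then show ?thesis
      using Suc.IH * by blast
  qed
  moreover have "\<forall>x\<in>X. f x = g x"
    using Suc.prems(3) eventually_nhds_x_imp_x by fast
  ultimately show ?case
    using Suc.prems by auto
qed

lemma jet_bound_coordinate:
  fixes g :: "real \<Rightarrow> real"
  assumes "jet_bound UNIV r A l g" "0 \<le> A" "0 \<le> l"
  shows "jet_bound UNIV r A l (\<lambda>x::real^'m. g (x $ i))"
  using assms
proof (induction r arbitrary: A g)
  case 0
  then show ?case
    by (auto intro!: continuous_on_compose2 [of UNIV g] continuous_intros)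
next
  case (Suc r)
  obtain g' where g': "has_partial 1 g g'" "jet_bound UNIV r (A * l) l g'"
    using Suc.prems by auto
  have "\<exists>h. has_partial b (\<lambda>x::real^'m. g (x $ i)) h \<and> jet_bound UNIV r (A * l) l h"
    if "b \<in> Basis" for b :: "real^'m"
  proof -
    obtain k where b: "b = axis k 1"
      using \<open>b \<in> Basis\<close> by (auto simp: Basis_vec_def)
    show ?thesis
    proof (cases "k = i")
      case True
      have "has_partial b (\<lambda>x::real^'m. g (x $ i)) (\<lambda>x. g' (x $ i))"
        using g' by (simp add: has_partial_def b True axis_def)
      then show ?thesis
        using Suc.IH [OF g'(2)] Suc.prems by auto
    next
      case False
      have "has_partial b (\<lambda>x::real^'m. g (x $ i)) (\<lambda>x. 0)"
        using False by (simp add: has_partial_def b axis_def)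
      then show ?thesis
        using jet_bound_zero [of "A * l" l] Suc.prems by auto
    qed
  qed
  moreover have "continuous_on UNIV (\<lambda>x::real^'m. g (x $ i))"
    using Suc.prems by (auto intro!: continuous_on_compose2 [of UNIV g] continuous_intros)
  ultimately show ?case
    using Suc.prems by auto
qed

lemma jet_bound_affine:
  fixes g :: "real \<Rightarrow> real"
  assumes "jet_bound UNIV r A l g" "0 \<le> A" "0 \<le> l" "0 \<le> a"
  shows "jet_bound UNIV r A (a * l) (\<lambda>x. g (a * x + c))"
  using assms
proof (induction r arbitrary: A g)
  case 0
  then show ?case
    by (auto intro!: continuous_on_compose2 [of UNIV g] continuous_intros)
next
  case (Suc r)
  obtain g' where g': "has_partial 1 g g'" "jet_bound UNIV r (A * l) l g'"
    using Suc.prems by auto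
  have "((\<lambda>t. g (a * (x + t) + c)) has_real_derivative g' (a * x + c) * a) (at 0)" for x
  proof (rule DERIV_chain2 [of g])
    show "(g has_real_derivative g' (a * x + c)) (at (a * (x + 0) + c))"
      using has_partial_DERIV [OF g'(1), of 0 "a * x + c"] by simp
  qed (auto intro!: derivative_eq_intros)
  then have "has_partial 1 (\<lambda>x. g (a * x + c)) (\<lambda>x. a * g' (a * x + c))"
    by (simp add: has_partial_def mult.commute)
  moreover have "jet_bound UNIV r (A * (a * l)) (a * l) (\<lambda>x. a * g' (a * x + c))"
    using Suc.prems by (intro jet_bound_cmult [OF Suc.IH [OF g'(2)]]) (auto simp: algebra_simps)
  moreover have "continuous_on UNIV (\<lambda>x. g (a * x + c))"
    using Suc.prems by (auto intro!: continuous_on_compose2 [of UNIV g] continuous_intros)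
  ultimately show ?case
    using Suc.prems by auto
qed

text \<open>
  By the chain rule each differentiation produces a factor \<open>h'\<close>, and one more factor to be
  differentiated later; induction on the order therefore replaces the formula of Faa di Bruno.
\<close>
lemma jet_bound_compose:
  fixes f :: "real^'m \<Rightarrow> real" and h h' :: "real \<Rightarrow> real"
  assumes "jet_bound Y r A l f" "has_partial 1 h h'" "jet_bound UNIV r B m h'"
    and "\<And>x. x \<in> X \<Longrightarrow> (\<chi> i. h (x $ i)) \<in> Y"
    and "0 \<le> A" "0 \<le> l" "0 \<le> B" "0 \<le> m"
  shows "jet_bound X r A (l * B + real r * m) (\<lambda>x. f (\<chi> i. h (x $ i)))"
  using assms
proof (induction r arbitrary: A f)
  have "isCont h x" for x
    using has_partial_DERIV [OF assms(2), of 0 x] DERIV_isCont by auto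
  then have h: "continuous_on UNIV h"
    by (simp add: continuous_at_imp_continuous_on)
  have cont: "continuous_on UNIV (\<lambda>x::real^'m. f (\<chi> i. h (x $ i)))"
    if "continuous_on UNIV f" for f :: "real^'m \<Rightarrow> real"
    by (rule continuous_on_compose2 [OF that])
      (auto intro!: continuous_on_vec_lambda continuous_on_compose2 [OF h] continuous_intros)
  {
    case 0
    then show ?case
      using cont by auto
  next
    case (Suc r)
    let ?m = "l * B + real r * m" and ?M = "l * B + real (Suc r) * m"
    have "\<exists>g. has_partial b (\<lambda>x. f (\<chi> i. h (x $ i))) g \<and> jet_bound X r (A * ?M) ?M g"
      if b: "b \<in> Basis" for b :: "real^'m"
    proof -
      obtain k where k: "b = axis k 1"
        using b by (auto simp: Basis_vec_def)
      obtain f' where f': "has_partial b f f'" "jet_bound Y r (A * l) l f'"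
        using Suc.prems b by auto
      have "((\<lambda>t. f (\<chi> i. h ((x + t *\<^sub>R b) $ i))) has_real_derivative
          f' (\<chi> i. h (x $ i)) * h' (x $ k)) (at 0)" for x
      proof -
        have "(\<chi> i. h ((x + t *\<^sub>R b) $ i)) = (\<chi> i. h (x $ i)) + (h (x $ k + t) - h (x $ k)) *\<^sub>R b"
          for t
          by (auto simp: k axis_def vec_eq_iff)
        moreover have "((\<lambda>t. f ((\<chi> i. h (x $ i)) + (h (x $ k + t) - h (x $ k)) *\<^sub>R b))
            has_real_derivative f' (\<chi> i. h (x $ i)) * h' (x $ k)) (at 0)"
        proof (rule DERIV_chain2 [of "\<lambda>t. f ((\<chi> i. h (x $ i)) + t *\<^sub>R b)"])
          show "((\<lambda>t. f ((\<chi> i. h (x $ i)) + t *\<^sub>R b)) has_real_derivative f' (\<chi> i. h (x $ i)))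
              (at (h (x $ k + 0) - h (x $ k)))"
            using f'(1) by (simp add: has_partial_def)
          have "((\<lambda>t. h (x $ k + t)) has_real_derivative h' (x $ k)) (at 0)"
            using Suc.prems(2) by (simp add: has_partial_def)
          from DERIV_diff [OF this DERIV_const [of "h (x $ k)"]]
          show "((\<lambda>t. h (x $ k + t) - h (x $ k)) has_real_derivative h' (x $ k)) (at 0)"
            by simp
        qed
        ultimately show ?thesis
          by simp
      qed
      then have "has_partial b (\<lambda>x. f (\<chi> i. h (x $ i))) (\<lambda>x. f' (\<chi> i. h (x $ i)) * h' (x $ k))"
        by (simp add: has_partial_def)
      moreover have "jet_bound X r (A * l * B) (?m + m) (\<lambda>x. f' (\<chi> i. h (x $ i)) * h' (x $ k))"
      proof (rule jet_bound_mult)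
        show "jet_bound X r (A * l) ?m (\<lambda>x. f' (\<chi> i. h (x $ i)))"
          using Suc.prems f' by (intro Suc.IH) (auto intro: jet_bound_lower simp del: jet_bound.simps)
        have "jet_bound UNIV r B m (\<lambda>x::real^'m. h' (x $ k))"
          using jet_bound_lower [OF Suc.prems(3)] Suc.prems(7,8) by (rule jet_bound_coordinate)
        then show "jet_bound X r B m (\<lambda>x. h' (x $ k))"
          by (rule jet_bound_mono) (use Suc.prems in auto)
      qed (use Suc.prems in auto)
      then have "jet_bound X r (A * ?M) ?M (\<lambda>x. f' (\<chi> i. h (x $ i)) * h' (x $ k))"
        by (rule jet_bound_mono) (use Suc.prems in \<open>auto simp: algebra_simps\<close>)
      ultimately show ?thesis
        by blast
    qed
    then show ?case
      using cont [OF jet_bound_continuous [OF Suc.prems(1)]] jet_bound_abs [OF Suc.prems(1)] Suc.prems(4)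
      by (intro jet_bound_SucI) auto
  }
qed

section \<open>Series with summable derivative bounds\<close>

lemma has_partial_lambda_partial:
  fixes f :: "real^'m \<Rightarrow> real"
  assumes "has_partial (axis i 1) f g"
  shows "lambda_partial UNIV 1 i f = g"
proof
  fix a
  have "has_lambda_partial UNIV 1 i f a (g a)"
    using assms
    by (simp add: has_lambda_partial_one_iff has_partial_def shifts_def
        has_real_derivative_iff_has_vector_derivative)
  then show "lambda_partial UNIV 1 i f a = g a"
    by (rule lambda_partial_eqI) (simp add: shifts_def)
qed

lemma jet_bound_iterated:
  fixes f :: "real^'m \<Rightarrow> real"
  assumes "jet_bound X r A l f" "length js \<le> r"
  shows "jet_bound X (r - length js) (A * l ^ length js) l (iterated_partial UNIV js f)"
  using assms(2)
proof (induction js)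
  case Nil
  then show ?case using assms by simp
next
  case (Cons i js)
  have "r - length js = Suc (r - length (i # js))"
    using Cons.prems by simp
  then have "jet_bound X (Suc (r - length (i # js))) (A * l ^ length js) l (iterated_partial UNIV js f)"
    using Cons by simp
  moreover have "axis i 1 \<in> (Basis :: (real^'m) set)"
    by (auto simp: Basis_vec_def)
  ultimately obtain g where "has_partial (axis i 1) (iterated_partial UNIV js f) g"
    "jet_bound X (r - length (i # js)) (A * l ^ length js * l) l g"
    using jet_bound_partial by blast
  then show ?case
    by (simp add: has_partial_lambda_partial mult_ac)
qed

lemma has_partial_iterated:
  fixes f :: "real^'m \<Rightarrow> real"
  assumes "jet_bound X r A l f" "length js < r"
  shows "has_partial (axis i 1) (iterated_partial UNIV js f) (iterated_partial UNIV (i # js) f)"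
proof -
  obtain q where q: "r - length js = Suc q"
    using assms(2) by (metis Suc_diff_Suc)
  have "axis i 1 \<in> (Basis :: (real^'m) set)"
    by (auto simp: Basis_vec_def)
  then obtain g where "has_partial (axis i 1) (iterated_partial UNIV js f) g"
    using jet_bound_partial [OF jet_bound_iterated [OF assms(1), of js, unfolded q]] assms(2)
    by (meson less_imp_le)
  then show ?thesis
    by (simp add: has_partial_lambda_partial)
qed

lemma iterated_partial_sum:
  fixes f :: "'k \<Rightarrow> real^'m \<Rightarrow> real"
  assumes "\<And>k. k \<in> I \<Longrightarrow> jet_bound X r (A k) (l k) (f k)" "length js \<le> r"
  shows "iterated_partial UNIV js (\<lambda>x. \<Sum>k\<in>I. f k x) = (\<lambda>x. \<Sum>k\<in>I. iterated_partial UNIV js (f k) x)"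
  using assms(2)
proof (induction js)
  case (Cons i js)
  have "has_partial (axis i 1) (\<lambda>x. \<Sum>k\<in>I. iterated_partial UNIV js (f k) x)
      (\<lambda>x. \<Sum>k\<in>I. iterated_partial UNIV (i # js) (f k) x)"
    using Cons.prems by (intro has_partial_sum has_partial_iterated [OF assms(1)]) auto
  from has_partial_lambda_partial [OF this] show ?case
    using Cons by simp
qed simp

lemma iterated_partial_diff_const:
  fixes f :: "real^'m \<Rightarrow> real"
  assumes "jet_bound X r A l f" "length js \<le> r" "js \<noteq> []"
  shows "iterated_partial UNIV js (\<lambda>x. f x - c) = iterated_partial UNIV js f"
  using assms(2,3)
proof (induction js)
  case (Cons i js)
  have "has_partial (axis i 1) (\<lambda>x. f x - c) (iterated_partial UNIV [i] f)" if "js = []"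
    using has_partial_diff [OF has_partial_iterated [OF assms(1), of "[]" i] has_partial_const [of _ c]]
      Cons.prems that by simp
  from has_partial_lambda_partial [OF this] show ?case
    using Cons by (cases js) auto
qed simp

lemma has_partial_suminf:
  fixes f g :: "nat \<Rightarrow> 'a::euclidean_space \<Rightarrow> real"
  assumes "\<And>k. has_partial b (f k) (g k)" "\<And>k x. \<bar>g k x\<bar> \<le> B k" "summable B"
    and "\<And>x. summable (\<lambda>k. f k x)"
  shows "has_partial b (\<lambda>x. \<Sum>k. f k x) (\<lambda>x. \<Sum>k. g k x)"
  unfolding has_partial_def
proof
  fix x
  have "((\<lambda>t. \<Sum>k. f k (x + t *\<^sub>R b)) has_real_derivative (\<Sum>k. g k (x + 0 *\<^sub>R b))) (at 0)"
  proof (rule has_field_derivative_series'(2) [where S = UNIV and ?x0.0 = 0])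
    show "((\<lambda>t. f k (x + t *\<^sub>R b)) has_real_derivative g k (x + t *\<^sub>R b)) (at t within UNIV)" for k t
      using has_partial_DERIV [OF assms(1)] by auto
    show "uniformly_convergent_on UNIV (\<lambda>n t. \<Sum>k<n. g k (x + t *\<^sub>R b))"
      using assms(2,3) by (intro Weierstrass_m_test') auto
  qed (use assms(4) in auto)
  then show "((\<lambda>t. \<Sum>k. f k (x + t *\<^sub>R b)) has_real_derivative (\<Sum>k. g k x)) (at 0)"
    by simp
qed

text \<open>
  The two hypotheses are the trivial bound and the Lipschitz bound for a difference at distance \<open>t\<close>;
  the conclusion is, up to a factor, their geometric mean with weights \<open>1 - \<alpha>\<close> and \<open>\<alpha>\<close>.
\<close>
lemma interpolation_bound:
  fixes d :: real
  assumes "d \<le> 2 * B" "d \<le> B * l * t" "0 \<le> B" "0 \<le> l" "0 \<le> t" "0 \<le> \<alpha>" "\<alpha> \<le> 1"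
  shows "d \<le> 2 * (B * l powr \<alpha>) * t powr \<alpha>"
proof (cases "l * t \<le> 1")
  case True
  show ?thesis
  proof (cases "l * t = 0")
    case True
    then show ?thesis
      using assms mult_nonneg_nonneg [of B "l powr \<alpha>"] mult_nonneg_nonneg [of "2 * (B * l powr \<alpha>)" "t powr \<alpha>"]
      by (auto simp: mult.assoc)
  next
    case False
    then have pos: "0 < l * t"
      using assms by (simp add: less_le)
    then have "(l * t) powr 1 \<le> (l * t) powr \<alpha>"
      using True assms by (intro powr_mono') auto
    then have "B * (l * t) \<le> B * (l * t) powr \<alpha>"
      using assms pos by (intro mult_left_mono) auto
    also have "\<dots> \<le> 2 * (B * (l * t) powr \<alpha>)"
      using assms by simp
    finally show ?thesis
      using assms by (simp add: powr_mult mult_ac)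
  qed
next
  case False
  then have "1 \<le> (l * t) powr \<alpha>"
    using assms by (intro ge_one_powr_ge_zero) auto
  then have "2 * B * 1 \<le> 2 * B * (l * t) powr \<alpha>"
    using assms by (intro mult_left_mono) auto
  then show ?thesis
    using assms by (simp add: powr_mult mult_ac)
qed

lemma jet_bound_Hoelder:
  fixes f :: "'a::euclidean_space \<Rightarrow> real"
  assumes "jet_bound UNIV (Suc 0) B l f" "b \<in> Basis" "0 \<le> l" "0 \<le> \<alpha>" "\<alpha> \<le> 1"
  shows "\<bar>f (x + t *\<^sub>R b) - f x\<bar> \<le> 2 * (B * l powr \<alpha>) * \<bar>t\<bar> powr \<alpha>"
proof (rule interpolation_bound)
  have f: "\<bar>f y\<bar> \<le> B" for y
    using jet_bound_abs [OF assms(1)] by auto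
  show "\<bar>f (x + t *\<^sub>R b) - f x\<bar> \<le> 2 * B"
    using f [of x] f [of "x + t *\<^sub>R b"] by linarith
  show "0 \<le> B"
    using f [of x] by linarith
  obtain g where g: "has_partial b f g" "jet_bound UNIV 0 (B * l) l g"
    using jet_bound_partial [OF assms(1,2)] by blast
  have "norm (f (x + t *\<^sub>R b) - f (x + 0 *\<^sub>R b)) \<le> B * l * norm (t - 0)"
  proof (rule field_differentiable_bound [where S = UNIV])
    show "((\<lambda>t. f (x + t *\<^sub>R b)) has_real_derivative g (x + t *\<^sub>R b)) (at t within UNIV)" for t
      using has_partial_DERIV [OF g(1)] by auto
    show "norm (g (x + t *\<^sub>R b)) \<le> B * l" for t
      using g(2) by auto
  qed auto
  then show "\<bar>f (x + t *\<^sub>R b) - f x\<bar> \<le> B * l * \<bar>t\<bar>"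
    by simp
qed (use assms in auto)

lemma suminf_Hoelder:
  fixes f :: "nat \<Rightarrow> 'a::euclidean_space \<Rightarrow> real"
  assumes "\<And>k. jet_bound UNIV (Suc 0) (B k) (l k) (f k)" "b \<in> Basis" "\<And>k. 0 \<le> l k" "0 \<le> \<alpha>" "\<alpha> \<le> 1"
    and "summable B" "summable (\<lambda>k. B k * l k powr \<alpha>)"
  shows "\<bar>(\<Sum>k. f k (x + t *\<^sub>R b)) - (\<Sum>k. f k x)\<bar> \<le> 2 * (\<Sum>k. B k * l k powr \<alpha>) * \<bar>t\<bar> powr \<alpha>"
proof -
  have s: "summable (\<lambda>k. f k y)" for y
  proof (rule summable_comparison_test' [OF assms(6)])
    show "norm (f k y) \<le> B k" for k
      using jet_bound_abs [OF assms(1), of y k] by simp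
  qed
  have s2: "summable (\<lambda>k. 2 * (B k * l k powr \<alpha>) * \<bar>t\<bar> powr \<alpha>)"
    using assms(7) by (intro summable_mult summable_mult2)
  have le: "\<bar>f k (x + t *\<^sub>R b) - f k x\<bar> \<le> 2 * (B k * l k powr \<alpha>) * \<bar>t\<bar> powr \<alpha>" for k
    by (rule jet_bound_Hoelder [OF assms(1-5)])
  have "(\<Sum>k. f k (x + t *\<^sub>R b)) - (\<Sum>k. f k x) = (\<Sum>k. f k (x + t *\<^sub>R b) - f k x)"
    by (rule suminf_diff [OF s s])
  also have "\<bar>\<dots>\<bar> \<le> (\<Sum>k. 2 * (B k * l k powr \<alpha>) * \<bar>t\<bar> powr \<alpha>)"
    using norm_suminf_le [OF _ s2, of "\<lambda>k. f k (x + t *\<^sub>R b) - f k x"] le by simp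
  also have "\<dots> = 2 * (\<Sum>k. B k * l k powr \<alpha>) * \<bar>t\<bar> powr \<alpha>"
    using assms(7) by (simp add: suminf_mult suminf_mult2 [symmetric] summable_mult)
  finally show ?thesis .
qed

text \<open>
  The sum of \<open>A * l ^ q\<close> bounds the derivatives of order \<open>q\<close> of the series.  Real exponents \<open>\<kappa>\<close>
  are admitted because \<open>A * l powr (q + \<alpha>)\<close> bounds the Hoelder constant with exponent \<open>\<alpha>\<close> of the
  derivatives of order \<open>q\<close>; one order more than \<open>N\<close> is needed for the Lipschitz bound.
\<close>
locale jet_series =
  fixes f :: "nat \<Rightarrow> real^'m \<Rightarrow> real" and A l :: "nat \<Rightarrow> real" and N :: nat and \<delta> :: real
  assumes bound: "jet_bound UNIV (Suc N) (A k) (l k) (f k)"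
    and l_pos: "0 < l k"
    and A_summable: "0 \<le> \<kappa> \<Longrightarrow> \<kappa> < \<delta> \<Longrightarrow> summable (\<lambda>k. A k * l k powr \<kappa>)"
    and N_less: "real N < \<delta>"
begin

lemma summable_power: "q \<le> N \<Longrightarrow> summable (\<lambda>k. A k * l k ^ q)"
  using A_summable [of "real q"] N_less l_pos by (simp add: powr_realpow)

lemma term_bound: "length js \<le> N \<Longrightarrow> \<bar>iterated_partial UNIV js (f k) x\<bar> \<le> A k * l k ^ length js"
  using jet_bound_abs [OF jet_bound_iterated [OF bound]] by simp

lemma summable_term:
  assumes "length js \<le> N"
  shows "summable (\<lambda>k. iterated_partial UNIV js (f k) x)"
proof (rule summable_comparison_test' [OF summable_power [OF assms]])
  show "norm (iterated_partial UNIV js (f k) x) \<le> A k * l k ^ length js" for k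
    using term_bound [OF assms, of k x] by simp
qed

lemma has_partial_series:
  assumes "length js < N"
  shows "has_partial (axis i 1) (\<lambda>x. \<Sum>k. iterated_partial UNIV js (f k) x)
    (\<lambda>x. \<Sum>k. iterated_partial UNIV (i # js) (f k) x)"
proof (rule has_partial_suminf)
  show "has_partial (axis i 1) (iterated_partial UNIV js (f k)) (iterated_partial UNIV (i # js) (f k))" for k
    using assms by (intro has_partial_iterated [OF bound]) simp
  show "\<bar>iterated_partial UNIV (i # js) (f k) x\<bar> \<le> A k * l k ^ length (i # js)" for k x
    using assms by (intro term_bound) simp
  show "summable (\<lambda>k. A k * l k ^ length (i # js))"
    using assms by (intro summable_power) simp
  show "summable (\<lambda>k. iterated_partial UNIV js (f k) x)" for x
    using assms by (intro summable_term) simp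
qed

lemma iterated_partial_series:
  assumes "length js \<le> N"
  shows "iterated_partial UNIV js (\<lambda>x. \<Sum>k. f k x) = (\<lambda>x. \<Sum>k. iterated_partial UNIV js (f k) x)"
  using assms
proof (induction js)
  case (Cons i js)
  then show ?case
    using has_partial_lambda_partial [OF has_partial_series [of js i]] by simp
qed simp

lemma uniform_limit_series:
  assumes "length js \<le> N"
  shows "uniform_limit UNIV (\<lambda>n x. \<Sum>k<n. iterated_partial UNIV js (f k) x)
    (\<lambda>x. \<Sum>k. iterated_partial UNIV js (f k) x) sequentially"
proof (rule Weierstrass_m_test [OF _ summable_power [OF assms]])
  show "norm (iterated_partial UNIV js (f k) x) \<le> A k * l k ^ length js" for k x
    using term_bound [OF assms, of k x] by simp
qed

lemma continuous_series:
  assumes "length js \<le> N"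
  shows "continuous_on UNIV (\<lambda>x. \<Sum>k. iterated_partial UNIV js (f k) x)"
proof (rule uniform_limit_theorem [OF _ uniform_limit_series [OF assms]])
  show "\<forall>\<^sub>F n in sequentially. continuous_on UNIV (\<lambda>x. \<Sum>k<n. iterated_partial UNIV js (f k) x)"
    using assms
    by (intro always_eventually allI continuous_on_sum jet_bound_continuous [OF jet_bound_iterated [OF bound]])
      simp
qed simp

lemma Hoelder_series:
  assumes "length js \<le> N" "0 \<le> \<alpha>" "\<alpha> \<le> 1" "real (length js) + \<alpha> < \<delta>"
  shows "\<exists>C. \<forall>a i t. \<bar>(\<Sum>k. iterated_partial UNIV js (f k) (a + t *\<^sub>R axis i 1))
    - (\<Sum>k. iterated_partial UNIV js (f k) a)\<bar> \<le> C * \<bar>t\<bar> powr \<alpha>"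
proof -
  let ?B = "\<lambda>k. A k * l k ^ length js"
  have 1: "jet_bound UNIV (Suc 0) (?B k) (l k) (iterated_partial UNIV js (f k))" for k
    using assms(1) by (intro jet_bound_order_mono [OF jet_bound_iterated [OF bound]]) auto
  have "?B k * l k powr \<alpha> = A k * l k powr (real (length js) + \<alpha>)" for k
    using l_pos [of k] by (simp add: powr_add powr_realpow)
  then have 2: "summable (\<lambda>k. ?B k * l k powr \<alpha>)"
    using A_summable [of "real (length js) + \<alpha>"] assms by (simp only: of_nat_0_le_iff add_nonneg_nonneg)
  have axis: "axis i 1 \<in> (Basis :: (real^'m) set)" for i
    by (auto simp: Basis_vec_def)
  show ?thesis
    by (intro exI allI)
      (rule suminf_Hoelder [OF 1 axis less_imp_le [OF l_pos] assms(2,3) summable_power [OF assms(1)] 2])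
qed

end

section \<open>Maps into Euclidean space on the unit cube\<close>

lemma has_lambda_partial_cong:
  assumes "\<And>x. x \<in> M \<Longrightarrow> f x = g x" "a \<in> M"
  shows "has_lambda_partial M \<alpha> i f a l \<longleftrightarrow> has_lambda_partial M \<alpha> i g a l"
  unfolding has_lambda_partial_def
  by (rule Lim_cong_within) (auto simp: assms shifts_def)

lemma has_lambda_partial_vec:
  assumes "\<And>\<kappa>. has_lambda_partial M \<alpha> i (\<lambda>x. f x $ \<kappa>) a (l $ \<kappa>)"
  shows "has_lambda_partial M \<alpha> i f a l"
  unfolding has_lambda_partial_def
  by (rule vec_tendstoI) (use assms in \<open>simp add: has_lambda_partial_def\<close>)

lemma has_partial_imp_has_lambda_partial:
  assumes "has_partial (axis i 1) f g"
  shows "has_lambda_partial M 1 i f a (g a)"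
  using assms unfolding has_lambda_partial_one_iff has_partial_def
    has_real_derivative_iff_has_vector_derivative
  by (blast intro: has_vector_derivative_within_subset has_vector_derivative_at_within)

lemma Hoelder_imp_has_lambda_partial:
  fixes f :: "real^'m \<Rightarrow> real"
  assumes "\<And>t. \<bar>f (a + t *\<^sub>R axis i 1) - f a\<bar> \<le> C * \<bar>t\<bar> powr \<beta>" "\<alpha> < \<beta>"
  shows "has_lambda_partial M \<alpha> i f a 0"
  unfolding has_lambda_partial_def
proof (rule Lim_null_comparison)
  show "\<forall>\<^sub>F t in at 0 within shifts M i a.
      norm (sgn t *\<^sub>R ((f (a + t *\<^sub>R axis i 1) - f a) /\<^sub>R \<bar>t\<bar> powr \<alpha>)) \<le> C * \<bar>t\<bar> powr (\<beta> - \<alpha>)"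
    unfolding eventually_at_filter
  proof (intro always_eventually allI impI)
    fix t :: real assume "t \<noteq> 0"
    then have "norm (sgn t *\<^sub>R ((f (a + t *\<^sub>R axis i 1) - f a) /\<^sub>R \<bar>t\<bar> powr \<alpha>))
        = \<bar>f (a + t *\<^sub>R axis i 1) - f a\<bar> / \<bar>t\<bar> powr \<alpha>"
      by (simp add: abs_mult abs_sgn_eq divide_inverse)
    also have "\<dots> \<le> C * \<bar>t\<bar> powr \<beta> / \<bar>t\<bar> powr \<alpha>"
      by (intro divide_right_mono assms) auto
    finally show "norm (sgn t *\<^sub>R ((f (a + t *\<^sub>R axis i 1) - f a) /\<^sub>R \<bar>t\<bar> powr \<alpha>)) \<le> C * \<bar>t\<bar> powr (\<beta> - \<alpha>)"
      by (simp add: powr_diff)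
  qed
  have "((\<lambda>t::real. \<bar>t\<bar> powr (\<beta> - \<alpha>)) \<longlongrightarrow> \<bar>0\<bar> powr (\<beta> - \<alpha>)) (at 0 within shifts M i a)"
    using assms(2) by (intro tendsto_powr' tendsto_intros) auto
  from tendsto_mult_left [OF this, of C]
  show "((\<lambda>t. C * \<bar>t\<bar> powr (\<beta> - \<alpha>)) \<longlongrightarrow> 0) (at 0 within shifts M i a)"
    by simp
qed

text \<open>
  What the limit of the construction provides in each component, where \<open>\<delta>\<close> is the bound \<open>m / n\<close> on
  the orders of differentiation and \<open>N\<close> is the largest integer below it.
\<close>
locale smooth_components =
  fixes F :: "'n::finite \<Rightarrow> real^'m \<Rightarrow> real" and N :: nat and \<delta> :: real
  assumes partial: "length js < N \<Longrightarrow>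
      has_partial (axis i 1) (iterated_partial UNIV js (F \<kappa>)) (iterated_partial UNIV (i # js) (F \<kappa>))"
    and continuous: "length js \<le> N \<Longrightarrow> continuous_on UNIV (iterated_partial UNIV js (F \<kappa>))"
    and Hoelder: "length js \<le> N \<Longrightarrow> 0 \<le> \<alpha> \<Longrightarrow> \<alpha> \<le> 1 \<Longrightarrow> real (length js) + \<alpha> < \<delta> \<Longrightarrow>
      \<exists>C. \<forall>a i t. \<bar>iterated_partial UNIV js (F \<kappa>) (a + t *\<^sub>R axis i 1)
        - iterated_partial UNIV js (F \<kappa>) a\<bar> \<le> C * \<bar>t\<bar> powr \<alpha>"
    and N: "real N < \<delta>" "\<delta> \<le> real N + 1"
begin

definition joined :: "real^'m \<Rightarrow> real^'n" where
  "joined x = (\<chi> \<kappa>. F \<kappa> x)"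

definition joined_partial :: "'m list \<Rightarrow> real^'m \<Rightarrow> real^'n" where
  "joined_partial js x = (\<chi> \<kappa>. iterated_partial UNIV js (F \<kappa>) x)"

lemma has_lambda_partial_joined:
  "length js < N \<Longrightarrow> has_lambda_partial M 1 i (joined_partial js) a (joined_partial (i # js) a)"
  using has_partial_imp_has_lambda_partial [OF partial]
  by (intro has_lambda_partial_vec) (simp add: joined_partial_def del: iterated_partial.simps)

lemma iterated_partial_joined:
  assumes "length js \<le> N" "a \<in> cbox 0 1"
  shows "iterated_partial (cbox 0 1) js joined a = joined_partial js a"
  using assms
proof (induction js arbitrary: a)
  case (Cons i js)
  have "has_lambda_partial (cbox 0 1) 1 i (joined_partial js) a (joined_partial (i # js) a)"
    using Cons.prems by (intro has_lambda_partial_joined) simp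
  then have "has_lambda_partial (cbox 0 1) 1 i (iterated_partial (cbox 0 1) js joined) a (joined_partial (i # js) a)"
    using Cons by (subst has_lambda_partial_cong [of _ _ "joined_partial js"]) auto
  then show ?case
    using lambda_partial_eqI shift_islimpt_unit_cube [OF Cons.prems(2)] by fastforce
qed (simp add: joined_def joined_partial_def)

lemma continuous_joined_partial: "length js \<le> N \<Longrightarrow> continuous_on S (joined_partial js)"
  using continuous_on_subset [OF continuous]
  unfolding joined_partial_def [abs_def] by (intro continuous_on_vec_lambda) auto

text \<open>
  Below the top order, and at it, the Hoelder condition holds with an exponent that exceeds \<open>\<alpha>\<close>, and
  then the difference quotient of order \<open>\<alpha>\<close> tends to \<open>0\<close>.
\<close>
lemma has_lambda_partial_zero:
  assumes "length js \<le> N" "0 < \<alpha>" "\<alpha> < 1" "real (length js) + \<alpha> < \<delta>" "a \<in> cbox 0 1"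
  shows "has_lambda_partial (cbox 0 1) \<alpha> i (iterated_partial (cbox 0 1) js joined) a 0"
proof -
  obtain \<beta> where \<beta>: "\<alpha> < \<beta>" "\<beta> \<le> 1" "real (length js) + \<beta> < \<delta>"
  proof -
    have "\<alpha> < min 1 (\<delta> - real (length js))"
      using assms by auto
    then obtain \<beta> where "\<alpha> < \<beta>" "\<beta> < min 1 (\<delta> - real (length js))"
      using dense by blast
    then show ?thesis
      by (intro that [of \<beta>]) auto
  qed
  have "has_lambda_partial (cbox 0 1) \<alpha> i (iterated_partial UNIV js (F \<kappa>)) a 0" for \<kappa>
  proof -
    obtain C where "\<bar>iterated_partial UNIV js (F \<kappa>) (a + t *\<^sub>R axis i 1)
        - iterated_partial UNIV js (F \<kappa>) a\<bar> \<le> C * \<bar>t\<bar> powr \<beta>" for t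
      using Hoelder [OF assms(1), of \<beta> \<kappa>] \<beta> assms(2) by (auto simp: less_imp_le)
    then show ?thesis
      using \<beta>(1) by (rule Hoelder_imp_has_lambda_partial)
  qed
  then have "has_lambda_partial (cbox 0 1) \<alpha> i (joined_partial js) a 0"
    by (intro has_lambda_partial_vec) (simp add: joined_partial_def)
  then show ?thesis
    using assms(1,5) iterated_partial_joined by (subst has_lambda_partial_cong [of _ _ "joined_partial js"]) auto
qed

lemma lambda_partial_zero:
  assumes "length js \<le> N" "0 < \<alpha>" "\<alpha> < 1" "real (length js) + \<alpha> < \<delta>" "a \<in> cbox 0 1"
  shows "lambda_partial (cbox 0 1) \<alpha> i (iterated_partial (cbox 0 1) js joined) a = 0"
  using has_lambda_partial_zero [OF assms] shift_islimpt_unit_cube [OF assms(5)]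
  by (rule lambda_partial_eqI)

lemma order_floor:
  assumes "0 \<le> k" "k < \<delta>"
  shows "nat \<lfloor>k\<rfloor> \<le> N" "real (nat \<lfloor>k\<rfloor>) + frac k = k"
  using assms N by (auto simp: frac_def nat_le_iff floor_le_iff)

lemma continuous_iterated_partial_joined:
  "length js \<le> N \<Longrightarrow> continuous_on (cbox 0 1) (iterated_partial (cbox 0 1) js joined)"
  by (rule continuous_on_eq [OF continuous_joined_partial]) (simp_all add: iterated_partial_joined)

lemma class_C_joined:
  assumes "0 \<le> k" "k < \<delta>"
  shows "class_C k (cbox 0 1) joined"
  unfolding class_C_def
proof (intro conjI allI impI)
  note order = order_floor [OF assms]
  show "class_C_nat (nat \<lfloor>k\<rfloor>) (cbox 0 1) joined"
    unfolding class_C_nat_def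
  proof (intro conjI allI impI ballI)
    fix js :: "'m list" and i and a :: "real^'m"
    assume js: "length js < nat \<lfloor>k\<rfloor>" and a: "a \<in> cbox 0 1"
    then have "has_lambda_partial (cbox 0 1) 1 i (joined_partial js) a (joined_partial (i # js) a)"
      using order(1) by (intro has_lambda_partial_joined) simp
    then have "has_lambda_partial (cbox 0 1) 1 i (iterated_partial (cbox 0 1) js joined) a (joined_partial (i # js) a)"
      using iterated_partial_joined js a order(1) by (subst has_lambda_partial_cong [of _ _ "joined_partial js"]) auto
    then show "\<exists>l. has_lambda_partial (cbox 0 1) 1 i (iterated_partial (cbox 0 1) js joined) a l" ..
  next
    fix js :: "'m list" assume "length js \<le> nat \<lfloor>k\<rfloor>"
    then show "continuous_on (cbox 0 1) (iterated_partial (cbox 0 1) js joined)"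
      using order(1) by (intro continuous_iterated_partial_joined) simp
  qed
  fix js :: "'m list" assume js: "length js = nat \<lfloor>k\<rfloor>"
  show "class_C_lambda (frac k) (cbox 0 1) (iterated_partial (cbox 0 1) js joined)"
  proof (cases "frac k = 0")
    case True
    then show ?thesis
      using js order(1) continuous_iterated_partial_joined by (simp add: class_C_lambda_def)
  next
    case False
    then have frac: "0 < frac k" "frac k < 1"
      using frac_ge_0 [of k] frac_lt_1 [of k] by linarith+
    have sum: "real (length js) + frac k < \<delta>" "length js \<le> N"
      using order assms(2) js by auto
    have "continuous_on (cbox 0 1) (lambda_partial (cbox 0 1) (frac k) i (iterated_partial (cbox 0 1) js joined))" for i
      by (rule continuous_on_eq [OF continuous_on_const [of _ 0]])
        (simp add: lambda_partial_zero [OF sum(2) frac sum(1)])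
    then show ?thesis
      using has_lambda_partial_zero [OF sum(2) frac sum(1)] False by (auto simp: class_C_lambda_def)
  qed
qed

lemma partials_of_order_zero:
  assumes "0 < k" "k < \<delta>" "a \<in> cbox 0 1" "d \<in> partials_of_order k (cbox 0 1) joined"
    and flat: "\<And>js \<kappa>. 0 < length js \<Longrightarrow> length js \<le> N \<Longrightarrow> iterated_partial UNIV js (F \<kappa>) a = 0"
  shows "d a = 0"
proof -
  have order: "nat \<lfloor>k\<rfloor> \<le> N" "real (nat \<lfloor>k\<rfloor>) + frac k = k"
    using order_floor [of k] assms by auto
  show ?thesis
  proof (cases "k \<in> \<int>")
    case True
    then obtain js where js: "length js = nat \<lfloor>k\<rfloor>" "d = iterated_partial (cbox 0 1) js joined"
      using assms(4) by (auto simp: partials_of_order_def)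
    have "frac k = 0"
      using True by (simp add: frac_eq_0_iff)
    then have "real (length js) = k"
      using order(2) unfolding js(1) by linarith
    then have "0 < length js"
      using assms(1) by linarith
    moreover have "length js \<le> N"
      using js(1) order(1) by simp
    ultimately show ?thesis
      using iterated_partial_joined [OF _ assms(3)] flat [of js] by (simp add: js(2) joined_partial_def vec_eq_iff)
  next
    case False
    then obtain js i where js: "length js = nat \<lfloor>k\<rfloor>"
      "d = lambda_partial (cbox 0 1) (frac k) i (iterated_partial (cbox 0 1) js joined)"
      using assms(4) by (auto simp: partials_of_order_def)
    have frac: "0 < frac k" "frac k < 1"
      using False frac_lt_1 by (auto simp: frac_gt_0_iff)
    show ?thesis
      using js lambda_partial_zero [OF _ frac _ assms(3), of js i] order assms(2) by simp
  qed
qed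

end

section \<open>A smooth step on the line\<close>

text \<open>
  Averaging over a moving window of length \<open>1\<close> gains one derivative and doubles the length of the
  transition from \<open>0\<close> to \<open>1\<close>; the rescaling by \<open>2\<close> puts it back onto the unit interval.
\<close>
primrec step :: "nat \<Rightarrow> real \<Rightarrow> real" where
  "step 0 x = max 0 (min 1 x)"
| "step (Suc r) x = integral {2 * x - 1..2 * x} (step r)"

lemma moving_average_DERIV:
  fixes f :: "real \<Rightarrow> real"
  assumes "continuous_on UNIV f"
  shows "((\<lambda>x. integral {2 * x - 1..2 * x} f) has_real_derivative 2 * f (2 * x) - 2 * f (2 * x - 1)) (at x)"
proof -
  \<comment> \<open>Any base point will do that stays to the left of the window for all points near \<open>x\<close>.\<close>
  define a where "a = 2 * x - 3"
  define F where "F u = integral {a..u} f" for u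
  have F: "(F has_real_derivative f u) (at u)" if "a < u" for u
  proof -
    have "((\<lambda>u. integral {a..u} f) has_real_derivative f u) (at u within {a..u + 1})"
      using that by (intro integral_has_real_derivative continuous_on_subset [OF assms]) auto
    then show ?thesis
      using that unfolding F_def [abs_def] by (simp add: at_within_Icc_at)
  qed
  have "((\<lambda>y. F (2 * y) - F (2 * y - 1)) has_real_derivative f (2 * x) * 2 - f (2 * x - 1) * 2) (at x)"
    by (intro DERIV_diff DERIV_chain2 [OF F]) (auto simp: a_def intro!: derivative_eq_intros)
  moreover have "\<forall>\<^sub>F y in nhds x. F (2 * y) - F (2 * y - 1) = integral {2 * y - 1..2 * y} f"
  proof (rule eventually_mono)
    show "\<forall>\<^sub>F y in nhds x. y \<in> {x - 1<..}"
      by (intro eventually_nhds_in_open) auto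
    fix y assume "y \<in> {x - 1<..}"
    then have "integral {a..2 * y - 1} f + integral {2 * y - 1..2 * y} f = integral {a..2 * y} f"
      by (intro Henstock_Kurzweil_Integration.integral_combine integrable_continuous_real
          continuous_on_subset [OF assms]) (auto simp: a_def)
    then show "F (2 * y) - F (2 * y - 1) = integral {2 * y - 1..2 * y} f"
      by (simp add: F_def)
  qed
  ultimately show ?thesis
    by (subst (asm) DERIV_cong_ev [OF refl _ refl]) (auto simp: mult.commute)
qed

lemma step_continuous: "continuous_on UNIV (step r)"
proof (induction r)
  case 0
  show ?case
    unfolding step.simps(1) [abs_def] by (intro continuous_intros)
next
  case (Suc r)
  show ?case
    unfolding step.simps(2) [abs_def]
    using moving_average_DERIV [OF Suc] DERIV_isCont continuous_at_imp_continuous_on by blast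
qed

lemma has_partial_step:
  "has_partial 1 (step (Suc r)) (\<lambda>x. 2 * step r (2 * x) - 2 * step r (2 * x - 1))"
proof -
  have "(step (Suc r) has_real_derivative 2 * step r (2 * x) - 2 * step r (2 * x - 1)) (at x)" for x
    using moving_average_DERIV [OF step_continuous] unfolding step.simps(2) [abs_def] .
  from DERIV_shift [THEN iffD1, of "step (Suc r)" _ 0, unfolded add_0, OF this]
  have "((\<lambda>t. step (Suc r) (x + t)) has_real_derivative
      2 * step r (2 * x) - 2 * step r (2 * x - 1)) (at 0)" for x
    by (simp only: add.commute [of x])
  then show ?thesis
    by (simp add: has_partial_def)
qed

lemma step_eq_0: "x \<le> 0 \<Longrightarrow> step r x = 0"
proof (induction r arbitrary: x)
  case (Suc r)
  then have "integral {2 * x - 1..2 * x} (step r) = integral {2 * x - 1..2 * x} (\<lambda>_. 0)"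
    by (intro Henstock_Kurzweil_Integration.integral_cong) auto
  then show ?case
    by simp
qed simp

lemma step_eq_1: "1 \<le> x \<Longrightarrow> step r x = 1"
proof (induction r arbitrary: x)
  case (Suc r)
  then have "integral {2 * x - 1..2 * x} (step r) = integral {2 * x - 1..2 * x} (\<lambda>_. 1)"
    by (intro Henstock_Kurzweil_Integration.integral_cong) auto
  then show ?case
    by simp
qed simp

lemma step_mono: "mono (step r)"
proof (induction r)
  case (Suc r)
  have "0 \<le> 2 * step r (2 * x) - 2 * step r (2 * x - 1)" for x
    using monoD [OF Suc, of "2 * x - 1" "2 * x"] by simp
  moreover have "(step (Suc r) has_real_derivative 2 * step r (2 * x) - 2 * step r (2 * x - 1)) (at x)"
    for x
    using moving_average_DERIV [OF step_continuous] unfolding step.simps(2) [abs_def] .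
  ultimately show ?case
    by (meson DERIV_nonneg_imp_nondecreasing monoI)
qed (auto simp: mono_def)

lemma step_jet_bound: "\<exists>l\<ge>1. jet_bound UNIV r 1 l (step r)"
proof (induction r)
  case 0
  show ?case
    using step_continuous [of 0] by (intro exI [of _ 1]) auto
next
  case (Suc r)
  then obtain l where l: "l \<ge> 1" "jet_bound UNIV r 1 l (step r)"
    by blast
  define k where "k = 4 + 2 * l"
  have "jet_bound UNIV r 2 (2 * l) (\<lambda>x. 2 * step r (2 * x + c))" for c
    using l by (intro jet_bound_cmult [OF jet_bound_affine]) auto
  from jet_bound_diff [OF this [of 0] this [of "- 1"]]
  have "jet_bound UNIV r 4 (2 * l) (\<lambda>x. 2 * step r (2 * x) - 2 * step r (2 * x - 1))"
    using l by simp
  then have "jet_bound UNIV r (1 * k) k (\<lambda>x. 2 * step r (2 * x) - 2 * step r (2 * x - 1))"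
    by (rule jet_bound_mono) (use l in \<open>auto simp: k_def\<close>)
  moreover have "\<bar>step (Suc r) x\<bar> \<le> 1" for x
    using monoD [OF step_mono [of "Suc r"], of x "max x 1"]
      monoD [OF step_mono [of "Suc r"], of "min x 0" x]
    by (simp add: step_eq_0 step_eq_1 del: step.simps)
  ultimately have "jet_bound UNIV (Suc r) 1 k (step (Suc r))"
    using has_partial_step [of r] step_continuous [of "Suc r"]
    by (intro jet_bound_SucI) (auto simp del: step.simps)
  then show ?case
    using l by (intro exI [of _ k]) (auto simp: k_def simp del: step.simps jet_bound.simps)
qed

section \<open>Boustrophedon numbering of the cells of a grid\<close>

text \<open>
  With the digits of \<open>u\<close> in base \<open>L\<close>, this is the last digit, reflected when the number formed by the
  other digits is odd: counting up and down between \<open>0\<close> and \<open>L - 1\<close>.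
\<close>
definition zigzag :: "nat \<Rightarrow> nat \<Rightarrow> nat" where
  "zigzag L u = (if even (u div L) then u mod L else L - 1 - u mod L)"

definition index_of :: "'a::finite \<Rightarrow> nat" where
  "index_of = (SOME h. bij_betw h UNIV {..<CARD('a)})"

text \<open>
  The reflected (Gray) code of \<open>t\<close> in base \<open>L\<close>, which visits the cells of a grid in such a way that
  consecutive cells have a common face.
\<close>
definition snake :: "nat \<Rightarrow> nat \<Rightarrow> 'a::finite \<Rightarrow> nat" where
  "snake L t i = zigzag L (t div L ^ index_of i)"

text \<open>
  The endpoint of the interval \<open>[c, c + 1]\<close> that has the parity of \<open>p\<close>.
\<close>
definition endpoint :: "nat \<Rightarrow> nat \<Rightarrow> nat" where
  "endpoint c p = (if even (c + p) then c else Suc c)"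

lemma index_of_bij: "bij_betw (index_of :: 'a::finite \<Rightarrow> nat) UNIV {..<CARD('a)}"
proof -
  have "\<exists>h. bij_betw h (UNIV :: 'a set) {..<CARD('a)}"
    using ex_bij_betw_finite_nat [of "UNIV :: 'a set"] by (auto simp: atLeast0LessThan)
  then show ?thesis
    unfolding index_of_def by (rule someI_ex)
qed

lemma zigzag_less: "0 < L \<Longrightarrow> zigzag L u < L"
  by (auto simp: zigzag_def)

lemma snake_less: "0 < L \<Longrightarrow> snake L t i < L"
  by (simp add: snake_def zigzag_less)

lemma zigzag_inj:
  assumes "u div L = v div L" "zigzag L u = zigzag L v" "0 < L"
  shows "u = v"
proof -
  have less: "u mod L < L" "v mod L < L"
    using assms by auto
  have "u mod L = v mod L \<or> L - 1 - u mod L = L - 1 - v mod L"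
    using assms(1,2) by (auto simp: zigzag_def split: if_splits)
  then have "u mod L = v mod L"
    using less by linarith
  then show ?thesis
    using assms(1) by (metis div_mult_mod_eq)
qed

text \<open>
  The leading digits determine which of the next digits is reflected, so the digits are recovered from
  the top.
\<close>
lemma snake_inj:
  assumes "0 < L"
  shows "inj_on (\<lambda>t. snake L t :: 'a::finite \<Rightarrow> nat) {..<L ^ CARD('a)}"
proof (rule inj_onI)
  fix t u
  assume t: "t \<in> {..<L ^ CARD('a)}" "u \<in> {..<L ^ CARD('a)}"
    and eq: "(snake L t :: 'a \<Rightarrow> nat) = snake L u"
  have "t div L ^ k = u div L ^ k" if "k \<le> CARD('a)" for k
    using that
  proof (induction rule: inc_induct)
    case base
    then show ?case using t by simp
  next
    case (step k)
    obtain i :: 'a where i: "index_of i = k"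
      using bij_betw_imp_surj_on [OF index_of_bij [where 'a = 'a]] step.hyps
      by (metis imageE lessThan_iff)
    have "zigzag L (t div L ^ k) = zigzag L (u div L ^ k)"
      using fun_cong [OF eq, of i] by (simp add: snake_def i)
    moreover have "(t div L ^ k) div L = (u div L ^ k) div L"
      using step.IH by (metis div_mult2_eq power_Suc2)
    ultimately show ?case
      using zigzag_inj assms by blast
  qed
  from this [of 0] show "t = u" by simp
qed

lemma snake_surj:
  fixes e :: "'a::finite \<Rightarrow> nat"
  assumes "\<And>i. e i < L"
  shows "\<exists>t<L ^ CARD('a). snake L t = e"
proof -
  let ?P = "Pi\<^sub>E (UNIV :: 'a set) (\<lambda>_. {..<L})" and ?T = "{..<L ^ CARD('a)}"
  have "0 < L"
    using assms [of undefined] by simp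
  have "card ((\<lambda>t. snake L t :: 'a \<Rightarrow> nat) ` ?T) = card ?P"
    using \<open>0 < L\<close> by (simp add: card_image snake_inj card_PiE)
  moreover have "(\<lambda>t. snake L t :: 'a \<Rightarrow> nat) ` ?T \<subseteq> ?P"
    using snake_less [OF \<open>0 < L\<close>] by auto
  ultimately have "(\<lambda>t. snake L t :: 'a \<Rightarrow> nat) ` ?T = ?P"
    by (intro card_subset_eq finite_PiE) auto
  moreover have "e \<in> ?P"
    using assms by auto
  ultimately show ?thesis
    by (metis (no_types, lifting) image_iff lessThan_iff)
qed

lemma snake_first: "0 < L \<Longrightarrow> snake L 0 i = 0"
  by (simp add: snake_def zigzag_def)

lemma power_pred_div:
  assumes "0 < (L::nat)" "k \<le> m"
  shows "(L ^ m - 1) div L ^ k = L ^ (m - k) - 1"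
proof -
  have "L ^ m = L ^ (m - k) * L ^ k"
    using assms by (simp flip: power_add)
  then have *: "L ^ m - 1 = (L ^ (m - k) - 1) * L ^ k + (L ^ k - 1)"
    using assms by (simp add: diff_mult_distrib)
  show ?thesis
    unfolding * using assms by (subst div_mult_self3) auto
qed

lemma snake_last:
  fixes i :: "'a::finite"
  assumes "odd L"
  shows "snake L (L ^ CARD('a) - 1) i = L - 1"
proof -
  have L: "0 < L"
    using assms by (simp add: odd_pos)
  define k where "k = index_of i"
  have k: "Suc k \<le> CARD('a)"
    using index_of_bij [where 'a = 'a] by (auto simp: bij_betw_def k_def Suc_le_eq)
  let ?u = "(L ^ CARD('a) - 1) div L ^ k"
  have "?u div L = L ^ (CARD('a) - Suc k) - 1"
    using power_pred_div [OF L k] by (metis div_mult2_eq power_Suc2)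
  moreover have "odd (L ^ (CARD('a) - Suc k))"
    using assms by simp
  ultimately have "even (?u div L)"
    by simp
  moreover have "?u mod L = L - 1"
  proof -
    obtain j where j: "CARD('a) - k = Suc j"
      using k by (metis Suc_diff_Suc Suc_le_eq)
    obtain w where w: "L ^ j = Suc w"
      using L by (metis gr0_implies_Suc zero_less_power)
    have "?u = L ^ Suc j - 1"
      using power_pred_div [OF L, of k "CARD('a)"] k j by simp
    also have "\<dots> = (L ^ j - 1) * L + (L - 1)"
      using L by (simp add: w mult.commute [of L])
    finally have u: "?u = (L ^ j - 1) * L + (L - 1)" .
    show ?thesis
      unfolding u using L by (subst mod_mult_self3) auto
  qed
  ultimately show ?thesis
    by (simp add: snake_def zigzag_def k_def)
qed

lemma zigzag_Suc_dvd:
  assumes "L dvd Suc u" "0 < L"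
  shows "zigzag L u = zigzag L (Suc u)"
proof -
  obtain v where v: "Suc u = L * v"
    using assms by (auto elim: dvdE)
  then obtain w where w: "v = Suc w"
    using assms by (cases v) auto
  have u: "u = w * L + (L - 1)"
    using v w assms by (simp add: mult.commute)
  have 1: "u div L = w" "u mod L = L - 1"
    unfolding u using assms by (subst div_mult_self3 mod_mult_self3; auto)+
  have 2: "Suc u div L = Suc w" "Suc u mod L = 0"
    unfolding v w using assms by auto
  show ?thesis
    unfolding zigzag_def 1 2 by auto
qed

text \<open>
  Where the zigzag moves, it crosses the common endpoint of two adjacent intervals, and for odd \<open>L\<close>
  this endpoint has the parity of the step number; where it turns, it stays on its interval.
\<close>
lemma zigzag_Suc_endpoint:
  assumes "odd L"
  shows "endpoint (zigzag L u) (Suc u) = endpoint (zigzag L (Suc u)) (Suc u)"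
proof (cases "L dvd Suc u")
  case True
  then show ?thesis
    using zigzag_Suc_dvd assms by (simp add: odd_pos)
next
  case False
  have L: "0 < L"
    using assms by (simp add: odd_pos)
  have m: "Suc u mod L = Suc (u mod L)" "Suc u div L = u div L"
    using False by (auto simp: mod_Suc div_Suc dvd_eq_mod_eq_0 split: if_splits)
  have lt: "Suc (u mod L) < L"
    using m(1) L by (metis mod_less_divisor)
  have par: "even u \<longleftrightarrow> even (u div L + u mod L)"
    using assms div_mult_mod_eq [of u L] by (metis even_add even_mult_iff)
  have sub: "L - 1 - u mod L = Suc (L - 1 - Suc (u mod L))"
    using lt by simp
  have par': "even (L - 1 - Suc (u mod L)) \<longleftrightarrow> odd (u mod L)"
    using lt assms by (auto simp: even_diff_nat)
  show ?thesis
    unfolding zigzag_def m using par par' sub by (auto simp: endpoint_def)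
qed

text \<open>
  The cells number \<open>t\<close> and \<open>t + 1\<close> have the same vertex of parity \<open>t + 1\<close>.  This is the property of
  the numbering on which the continuity of the construction rests, in the domain as in the target.
\<close>
lemma snake_Suc_endpoint:
  assumes "odd L"
  shows "endpoint (snake L t i) (Suc t) = endpoint (snake L (Suc t) i) (Suc t)"
proof (cases "L ^ index_of i dvd Suc t")
  case True
  define q where "q = L ^ index_of i"
  have "0 < q"
    using assms by (simp add: q_def odd_pos)
  obtain v where v: "Suc t = q * v"
    using True by (auto elim: dvdE simp: q_def)
  then obtain u where u: "v = Suc u"
    by (cases v) auto
  have t: "t = u * q + (q - 1)"
    using v u \<open>0 < q\<close> by (simp add: mult.commute)
  have "t div q = u"
    unfolding t using \<open>0 < q\<close> by (subst div_mult_self3) auto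
  moreover have "Suc t div q = Suc u"
    using v u \<open>0 < q\<close> by simp
  moreover have "even (Suc t) \<longleftrightarrow> even (Suc u)"
    using v u assms by (simp add: q_def)
  ultimately show ?thesis
    using zigzag_Suc_endpoint [OF assms, of u] by (simp add: snake_def q_def endpoint_def)
next
  case False
  then have "Suc t div L ^ index_of i = t div L ^ index_of i"
    by (auto simp: div_Suc dvd_eq_mod_eq_0)
  then show ?thesis
    by (simp add: snake_def)
qed

text \<open>
  The coordinate that moves belongs to the highest power of \<open>L\<close> dividing \<open>t + 1\<close>.
\<close>
lemma snake_Suc_single:
  assumes "0 < L" "snake L t i \<noteq> snake L (Suc t) i" "snake L t j \<noteq> snake L (Suc t) j"
  shows "i = j"
proof -
  have *: "L ^ index_of i dvd Suc t \<and> \<not> L ^ Suc (index_of i) dvd Suc t"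
    if "snake L t i \<noteq> snake L (Suc t) i" for i :: 'a
  proof -
    define q where "q = L ^ index_of i"
    have "0 < q"
      using assms by (simp add: q_def)
    have "q dvd Suc t"
      using that by (auto simp: snake_def div_Suc dvd_eq_mod_eq_0 q_def split: if_splits)
    then have "Suc t div q = Suc (t div q)"
      by (simp add: div_Suc dvd_eq_mod_eq_0)
    then have "\<not> L dvd Suc t div q"
      using that zigzag_Suc_dvd [of L "t div q"] assms(1) by (auto simp: snake_def q_def)
    then show ?thesis
      using \<open>q dvd Suc t\<close> \<open>0 < q\<close> by (auto simp: q_def dvd_div_iff_mult mult.commute)
  qed
  have "index_of i = index_of j"
    using * [OF assms(2)] * [OF assms(3)]
    by (metis le_imp_power_dvd dvd_trans not_less_eq_eq linorder_le_cases le_antisym)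
  then show ?thesis
    using index_of_bij [where 'a = 'a] by (auto simp: bij_betw_def dest: injD)
qed

section \<open>Folding the cube onto itself\<close>

text \<open>
  All the functions below are built from one smooth step \<open>s\<close>, so that a single frequency \<open>\<sigma>\<close> controls
  their derivatives.
\<close>
locale smooth_step =
  fixes s s' :: "real \<Rightarrow> real" and r :: nat and \<sigma> :: real
  assumes s_mono: "mono s"
    and s_eq_0: "x \<le> 0 \<Longrightarrow> s x = 0"
    and s_eq_1: "1 \<le> x \<Longrightarrow> s x = 1"
    and s_bound: "jet_bound UNIV r 1 \<sigma> s"
    and s_partial: "has_partial 1 s s'"
    and s'_bound: "jet_bound UNIV r \<sigma> \<sigma> s'"
    and \<sigma>_ge_1: "1 \<le> \<sigma>"
begin

lemma s_range: "0 \<le> s x" "s x \<le> 1"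
  using monoD [OF s_mono, of x "max x 1"] monoD [OF s_mono, of "min x 0" x]
  by (auto simp: s_eq_0 s_eq_1)

lemma s_continuous: "continuous_on A s"
  using jet_bound_continuous [OF s_bound] continuous_on_subset by blast

text \<open>
  In the coordinate \<open>u = (2 L - 1) x\<close> the cell number \<open>c\<close> is \<open>[2 c, 2 c + 1]\<close> and the gap that
  follows it is \<open>[2 c + 1, 2 c + 2]\<close>; there is no gap after the last cell.  The function goes up on
  the cells of even number, goes down on those of odd number, and is constant on the gaps.
\<close>
definition fold1 :: "nat \<Rightarrow> real \<Rightarrow> real" where
  "fold1 L x = (\<Sum>c<L. (- 1) ^ c * s ((2 * real L - 1) * x - 2 * real c))"

definition fold_map :: "nat \<Rightarrow> real^'m \<Rightarrow> real^'m" where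
  "fold_map L x = (\<chi> i. fold1 L (x $ i))"

text \<open>
  A cutoff function that is \<open>1\<close> on a neighbourhood of the cell number \<open>c\<close>: with \<open>u\<close> as for \<open>fold1\<close>, it
  rises in the middle third of the gap before the cell and falls in the middle third of the gap after
  it.
\<close>
definition bump1 :: "nat \<Rightarrow> nat \<Rightarrow> real \<Rightarrow> real" where
  "bump1 L c x = s (3 * ((2 * real L - 1) * x - 2 * real c) + 2)
               - s (3 * ((2 * real L - 1) * x - 2 * real c) - 4)"

definition bump :: "nat \<Rightarrow> ('m \<Rightarrow> nat) \<Rightarrow> real^'m \<Rightarrow> real" where
  "bump L d x = (\<Prod>i\<in>UNIV. bump1 L (d i) (x $ i))"

lemma alternating_sum: "(\<Sum>c<k. (- 1) ^ c) = (if even k then 0 else 1 :: real)"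
  by (induction k) auto

lemma fold1_eq:
  assumes "c < L" "2 * real c \<le> (2 * real L - 1) * x" "(2 * real L - 1) * x \<le> 2 * real c + 2"
  shows "fold1 L x = (if even c then s ((2 * real L - 1) * x - 2 * real c)
                      else 1 - s ((2 * real L - 1) * x - 2 * real c))"
proof -
  let ?u = "(2 * real L - 1) * x"
  have "fold1 L x = (\<Sum>c'<Suc c. (- 1) ^ c' * s (?u - 2 * real c'))"
    unfolding fold1_def
  proof (rule sum.mono_neutral_right)
    show "\<forall>i\<in>{..<L} - {..<Suc c}. (- 1) ^ i * s (?u - 2 * real i) = 0"
    proof
      fix i assume "i \<in> {..<L} - {..<Suc c}"
      then have "real c + 1 \<le> real i"
        by (simp add: Suc_le_eq)
      then show "(- 1) ^ i * s (?u - 2 * real i) = 0"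
        using assms by (simp add: s_eq_0)
    qed
  qed (use assms in auto)
  also have "\<dots> = (\<Sum>c'<c. (- 1) ^ c') + (- 1) ^ c * s (?u - 2 * real c)"
  proof -
    have "s (?u - 2 * real i) = 1" if "i < c" for i
    proof (rule s_eq_1)
      have "real i + 1 \<le> real c"
        using that by simp
      then show "1 \<le> ?u - 2 * real i"
        using assms by linarith
    qed
    then show ?thesis
      by simp
  qed
  finally show ?thesis
    by (simp add: alternating_sum)
qed

lemma fold1_gap:
  assumes "c < L" "2 * real c + 1 \<le> (2 * real L - 1) * x" "(2 * real L - 1) * x \<le> 2 * real c + 2"
  shows "fold1 L x = (if even c then 1 else 0)"
  using assms by (subst fold1_eq [of c]) (auto simp: s_eq_1)

lemma fold1_left:
  assumes "c < L" "(2 * real L - 1) * x = 2 * real c"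
  shows "fold1 L x = (if even c then 0 else 1)"
  using assms by (subst fold1_eq [of c]) (auto simp: s_eq_0)

lemma cell_index_exists:
  assumes "0 < L" "0 \<le> x" "x \<le> 1"
  obtains c where "c < L" "2 * real c \<le> (2 * real L - 1) * x" "(2 * real L - 1) * x \<le> 2 * real c + 2"
proof -
  let ?u = "(2 * real L - 1) * x"
  have u: "0 \<le> ?u" "?u \<le> 2 * real L - 1"
    using assms mult_left_mono [of x 1 "2 * real L - 1"] by (simp_all add: Suc_le_eq)
  have c1: "real (nat \<lfloor>?u / 2\<rfloor>) \<le> ?u / 2" "?u / 2 < real (nat \<lfloor>?u / 2\<rfloor>) + 1"
    using u by linarith+
  then have "nat \<lfloor>?u / 2\<rfloor> < L"
    using u by linarith
  then show ?thesis
    using c1 by (intro that [of "nat \<lfloor>?u / 2\<rfloor>"]) linarith+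
qed

lemma fold1_range:
  assumes "0 < L" "0 \<le> x" "x \<le> 1"
  shows "0 \<le> fold1 L x" "fold1 L x \<le> 1"
proof -
  obtain c where "c < L" "2 * real c \<le> (2 * real L - 1) * x" "(2 * real L - 1) * x \<le> 2 * real c + 2"
    using cell_index_exists [OF assms] .
  then show "0 \<le> fold1 L x" "fold1 L x \<le> 1"
    by (auto simp: fold1_eq s_range)
qed

lemma fold1_continuous: "continuous_on A (fold1 L)"
  unfolding fold1_def [abs_def]
  by (intro continuous_intros continuous_on_compose2 [OF s_continuous [of UNIV]]) auto

lemma fold_map_continuous: "continuous_on A (fold_map L :: real^'m \<Rightarrow> real^'m)"
  unfolding fold_map_def [abs_def]
  by (intro continuous_on_vec_lambda continuous_on_compose2 [OF fold1_continuous [of UNIV]]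
      continuous_intros) auto

lemma fold_map_cube: "0 < L \<Longrightarrow> x \<in> cbox 0 1 \<Longrightarrow> fold_map L x \<in> cbox 0 1"
  by (auto simp: fold_map_def mem_box_cart fold1_range)

lemma fold1_onto:
  assumes "c < L" "0 \<le> y" "y \<le> 1"
  obtains x where "2 * real c \<le> (2 * real L - 1) * x" "(2 * real L - 1) * x \<le> 2 * real c + 1"
    "fold1 L x = y"
proof -
  let ?y = "if even c then y else 1 - y"
  have "0 \<le> ?y" "?y \<le> 1"
    using assms by auto
  then obtain v where v: "0 \<le> v" "v \<le> 1" "s v = ?y"
    using IVT' [of s 0 ?y 1] assms s_continuous by (auto simp: s_eq_0 s_eq_1)
  define x where "x = (2 * real c + v) / (2 * real L - 1)"
  have u: "(2 * real L - 1) * x = 2 * real c + v"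
    using assms by (simp add: x_def)
  have "fold1 L x = y"
    using assms v by (subst fold1_eq [of c]) (auto simp: u)
  then show ?thesis
    using v u by (intro that [of x]) auto
qed

text \<open>
  These are the numbers of the cells that can influence a function near the point \<open>u\<close>.
\<close>
lemma finite_close: "finite {c::nat. \<bar>u - 2 * real c\<bar> < 3}" (is ?F)
  and card_close: "card {c::nat. \<bar>u - 2 * real c\<bar> < 3} \<le> 3" (is ?C)
proof -
  let ?S = "{c::nat. \<bar>u - 2 * real c\<bar> < 3}"
  have "?F \<and> ?C"
  proof (cases "?S = {}")
    case False
    define k where "k = (LEAST c. c \<in> ?S)"
    have k: "k \<in> ?S" and least: "\<And>c. c \<in> ?S \<Longrightarrow> k \<le> c"
      using False unfolding k_def by (auto intro: LeastI Least_le)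
    have "?S \<subseteq> {k..k + 2}"
    proof
      fix c assume c: "c \<in> ?S"
      then have "real c < real k + 3"
        using k by auto
      then have "c < k + 3"
        by linarith
      then show "c \<in> {k..k + 2}"
        using least [OF c] by auto
    qed
    moreover have "card {k..k + 2} = 3"
      by simp
    ultimately show ?thesis
      by (metis card_mono finite_atLeastAtMost finite_subset)
  qed simp
  then show ?F ?C by auto
qed

lemma s'_eq_0:
  assumes "x < 0 \<or> 1 < x"
  shows "s' x = 0"
proof -
  obtain k where "\<forall>\<^sub>F t in nhds x. s t = k"
  proof (cases "x < 0")
    case True
    have "\<forall>\<^sub>F t in nhds x. t \<in> {..<0}"
      using True by (intro eventually_nhds_in_open) auto
    then show ?thesis
      by (intro that [of 0]) (auto elim!: eventually_mono simp: s_eq_0)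
  next
    case False
    have "\<forall>\<^sub>F t in nhds x. t \<in> {1<..}"
      using False assms by (intro eventually_nhds_in_open) auto
    then show ?thesis
      by (intro that [of 1]) (auto elim!: eventually_mono simp: s_eq_1)
  qed
  moreover have "(s has_real_derivative s' x) (at x)"
    using has_partial_DERIV [OF s_partial, of 0 x] by simp
  ultimately have "((\<lambda>_. k) has_real_derivative s' x) (at x)"
    using DERIV_cong_ev [of x x s "\<lambda>_. k"] by auto
  then show ?thesis
    using DERIV_unique DERIV_const by blast
qed

definition fold1' :: "nat \<Rightarrow> real \<Rightarrow> real" where
  "fold1' L x = (\<Sum>c<L. (- 1) ^ c * ((2 * real L - 1) * s' ((2 * real L - 1) * x - 2 * real c)))"

lemma has_partial_fold1: "has_partial 1 (fold1 L) (fold1' L)"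
proof -
  have "((\<lambda>t. s ((2 * real L - 1) * (x + t) - 2 * real c)) has_real_derivative
      s' ((2 * real L - 1) * x - 2 * real c) * (2 * real L - 1)) (at 0)" for c x
  proof (rule DERIV_chain2 [of s])
    show "(s has_real_derivative s' ((2 * real L - 1) * x - 2 * real c))
        (at ((2 * real L - 1) * (x + 0) - 2 * real c))"
      using has_partial_DERIV [OF s_partial, of 0 "(2 * real L - 1) * x - 2 * real c"] by simp
  qed (auto intro!: derivative_eq_intros)
  then have *: "((\<lambda>t. s ((2 * real L - 1) * (x + t) - 2 * real c)) has_real_derivative
      (2 * real L - 1) * s' ((2 * real L - 1) * x - 2 * real c)) (at 0)" for c x
    by (simp only: mult.commute)
  show ?thesis
    unfolding has_partial_def fold1_def fold1'_def
    by (auto intro!: DERIV_sum DERIV_cmult *)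
qed

lemma affine_neighbourhood:
  fixes a :: real
  assumes "0 < e"
  shows "\<forall>\<^sub>F z in nhds x. \<bar>a * z - a * x\<bar> < e"
proof -
  have "((\<lambda>z. a * z - a * x) \<longlongrightarrow> a * x - a * x) (nhds x)"
    by (intro tendsto_intros filterlim_ident)
  then show ?thesis
    using assms by (auto dest!: tendstoD simp: dist_norm)
qed

lemma fold1'_bound:
  assumes "0 < L"
  shows "jet_bound UNIV r (6 * real L * \<sigma>) (2 * real L * \<sigma>) (fold1' L)"
proof -
  let ?w = "2 * real L - 1"
  have "jet_bound UNIV r (real 3 * (?w * \<sigma>)) (?w * \<sigma>) (fold1' L)"
    unfolding fold1'_def [abs_def]
  proof (rule jet_bound_locally_finite_sum)
    fix c
    have "jet_bound UNIV r \<sigma> (?w * \<sigma>) (\<lambda>x. s' (?w * x + - 2 * real c))"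
      using s'_bound \<sigma>_ge_1 assms by (intro jet_bound_affine) auto
    from jet_bound_cmult [OF this, of "(- 1) ^ c * ?w" "?w * \<sigma>"]
    have "jet_bound UNIV r (?w * \<sigma>) (?w * \<sigma>) (\<lambda>x. ((- 1) ^ c * ?w) * s' (?w * x + - 2 * real c))"
      using \<sigma>_ge_1 assms by (simp add: abs_mult)
    then show "jet_bound UNIV r (?w * \<sigma>) (?w * \<sigma>) (\<lambda>x. (- 1) ^ c * (?w * s' (?w * x - 2 * real c)))"
      by (simp add: mult.assoc)
  next
    fix x
    define N where "N = {c. \<bar>?w * x - 2 * real c\<bar> < 3} \<inter> {..<L}"
    have "card N \<le> 3"
      using card_mono [OF finite_close [of "?w * x"], of N] card_close [of "?w * x"]
      by (auto simp: N_def)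
    moreover have "\<forall>\<^sub>F z in nhds x. (- 1) ^ c * (?w * s' (?w * z - 2 * real c)) = 0"
      if "c \<in> {..<L} - N" for c
      using affine_neighbourhood [OF zero_less_one, of ?w x]
    proof eventually_elim
      fix z assume "\<bar>?w * z - ?w * x\<bar> < 1"
      moreover have "3 \<le> \<bar>?w * x - 2 * real c\<bar>"
        using that by (auto simp: N_def)
      ultimately have "?w * z - 2 * real c < 0 \<or> 1 < ?w * z - 2 * real c"
        by linarith
      then show "(- 1) ^ c * (?w * s' (?w * z - 2 * real c)) = 0"
        by (simp add: s'_eq_0)
    qed
    ultimately show "\<exists>N\<subseteq>{..<L}. card N \<le> 3 \<and>
        (\<forall>c\<in>{..<L} - N. \<forall>\<^sub>F z in nhds x. (- 1) ^ c * (?w * s' (?w * z - 2 * real c)) = 0)"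
      by (intro exI [of _ N]) (auto simp: N_def)
  qed (use \<sigma>_ge_1 assms in auto)
  then show ?thesis
    using \<sigma>_ge_1 assms by (elim jet_bound_mono) (auto intro!: mult_right_mono)
qed

lemma bump1_nonneg: "0 \<le> bump1 L c x"
  unfolding bump1_def using monoD [OF s_mono] by simp

lemma bump1_eq_0:
  assumes "(2 * real L - 1) * x - 2 * real c \<le> - 2 / 3 \<or> 5 / 3 \<le> (2 * real L - 1) * x - 2 * real c"
  shows "bump1 L c x = 0"
  using assms by (auto simp: bump1_def s_eq_0 s_eq_1)

lemma bump1_eq_1:
  assumes "- 1 / 3 \<le> (2 * real L - 1) * x - 2 * real c" "(2 * real L - 1) * x - 2 * real c \<le> 4 / 3"
  shows "bump1 L c x = 1"
  using assms by (auto simp: bump1_def s_eq_0 s_eq_1)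

lemma bump1_add:
  assumes "1 / 3 \<le> (2 * real L - 1) * x - 2 * real c" "(2 * real L - 1) * x - 2 * real c \<le> 8 / 3"
  shows "bump1 L c x + bump1 L (Suc c) x = 1"
proof -
  have "3 * ((2 * real L - 1) * x - 2 * real (Suc c)) + 2 = 3 * ((2 * real L - 1) * x - 2 * real c) - 4"
    by simp
  then show ?thesis
    using assms by (simp add: bump1_def s_eq_0 s_eq_1)
qed

text \<open>
  The descending part of each cutoff function is the ascending part of the next one, so the sum
  telescopes.
\<close>
lemma sum_bump1_le: "(\<Sum>c<L. bump1 L c x) \<le> 1"
proof -
  define g where "g c = s (3 * ((2 * real L - 1) * x - 2 * real c) + 2)" for c
  have "bump1 L c x = g c - g (Suc c)" for c
    unfolding bump1_def g_def by (simp add: algebra_simps)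
  then have "(\<Sum>c<L. bump1 L c x) = g 0 - g L"
    by (simp add: sum_lessThan_telescope')
  also have "\<dots> \<le> 1"
    using s_range [of "3 * ((2 * real L - 1) * x - 2 * real L) + 2"]
      s_range [of "3 * ((2 * real L - 1) * x - 2 * real 0) + 2"] by (simp only: g_def)
  finally show ?thesis .
qed

lemma bump_nonneg: "0 \<le> bump L d x"
  unfolding bump_def by (intro prod_nonneg) (simp add: bump1_nonneg)

lemma bump_eq_0: "bump1 L (d i) (x $ i) = 0 \<Longrightarrow> bump L d x = 0"
  unfolding bump_def by (intro prod_zero) auto

lemma sum_bump_le:
  fixes x :: "real^'m"
  assumes "0 < L"
  shows "(\<Sum>t<L ^ CARD('m). bump L (snake L t) x) \<le> 1"
proof -
  let ?d = "\<lambda>t. snake L t :: 'm \<Rightarrow> nat" and ?T = "{..<L ^ CARD('m)}"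
    and ?P = "Pi\<^sub>E (UNIV :: 'm set) (\<lambda>_. {..<L})"
  have "(\<Sum>t\<in>?T. bump L (?d t) x) = (\<Sum>d\<in>?d ` ?T. bump L d x)"
    using snake_inj [OF assms, where 'a = 'm] by (simp add: sum.reindex)
  also have "\<dots> \<le> (\<Sum>d\<in>?P. bump L d x)"
    using snake_less [OF assms] by (intro sum_mono2 finite_PiE) (auto simp: bump_nonneg)
  also have "\<dots> = (\<Prod>i\<in>UNIV. \<Sum>c<L. bump1 L c (x $ i))"
    unfolding bump_def by (subst prod_sum_PiE) auto
  also have "\<dots> \<le> 1"
    by (intro prod_le_1) (auto simp: sum_bump1_le intro!: sum_nonneg bump1_nonneg)
  finally show ?thesis .
qed

lemma bump_bound:
  assumes "0 < L"
  shows "jet_bound UNIV r (2 ^ CARD('m)) (6 * real CARD('m) * real L * \<sigma>) (bump L d :: real^'m \<Rightarrow> real)"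
proof -
  let ?w = "2 * real L - 1"
  have *: "jet_bound UNIV r 1 (3 * ?w * \<sigma>) (\<lambda>x. s (3 * ?w * x + k))" for k
    using s_bound \<sigma>_ge_1 assms by (intro jet_bound_affine) auto
  have "jet_bound UNIV r (1 + 1) (3 * ?w * \<sigma>) (\<lambda>x. s (3 * ?w * x + (2 - 6 * real c))
      - s (3 * ?w * x + (- 4 - 6 * real c)))" for c
    using \<sigma>_ge_1 assms by (intro jet_bound_diff *) auto
  then have "jet_bound UNIV r 2 (3 * ?w * \<sigma>) (bump1 L c)" for c
    unfolding bump1_def [abs_def] by (simp add: algebra_simps)
  then have "jet_bound UNIV r 2 (3 * ?w * \<sigma>) (\<lambda>x::real^'m. bump1 L (d i) (x $ i))" for i
    using \<sigma>_ge_1 assms by (intro jet_bound_coordinate) auto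
  then have "jet_bound UNIV r (2 ^ CARD('m)) (real CARD('m) * (3 * ?w * \<sigma>)) (bump L d :: real^'m \<Rightarrow> real)"
    unfolding bump_def [abs_def] using \<sigma>_ge_1 assms by (intro jet_bound_prod) auto
  then show ?thesis
    using \<sigma>_ge_1 assms by (elim jet_bound_mono) (auto intro!: mult_right_mono simp: algebra_simps)
qed

text \<open>
  The factor \<open>6 ^ m\<close> collects the \<open>3 ^ m\<close> cells that are active at a point and the amplitude \<open>2 ^ m\<close>
  of a product of \<open>m\<close> cutoff functions.
\<close>
lemma weighted_bump_sum_bound:
  fixes c :: "nat \<Rightarrow> real"
  assumes "0 < L" "\<And>t. t < L ^ CARD('m) \<Longrightarrow> \<bar>c t\<bar> \<le> C" "0 \<le> C"
  shows "jet_bound UNIV r (6 ^ CARD('m) * C) (6 * real CARD('m) * real L * \<sigma>)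
    (\<lambda>x::real^'m. \<Sum>t<L ^ CARD('m). bump L (snake L t) x * c t)"
proof -
  let ?l = "6 * real CARD('m) * real L * \<sigma>" and ?w = "2 * real L - 1"
    and ?d = "\<lambda>t. snake L t :: 'm \<Rightarrow> nat" and ?T = "{..<L ^ CARD('m)}"
  have "jet_bound UNIV r (real (3 ^ CARD('m)) * (2 ^ CARD('m) * C)) ?l
      (\<lambda>x::real^'m. \<Sum>t\<in>?T. bump L (?d t) x * c t)"
  proof (rule jet_bound_locally_finite_sum)
    fix t assume "t \<in> ?T"
    then have "jet_bound UNIV r (2 ^ CARD('m) * C) ?l (\<lambda>x::real^'m. c t * bump L (?d t) x)"
      using \<sigma>_ge_1 assms by (intro jet_bound_cmult [OF bump_bound]) (auto simp: mult.commute)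
    then show "jet_bound UNIV r (2 ^ CARD('m) * C) ?l (\<lambda>x::real^'m. bump L (?d t) x * c t)"
      by (simp add: mult.commute)
  next
    fix x :: "real^'m"
    define Q where "Q i = {c. \<bar>?w * (x $ i) - 2 * real c\<bar> < 3}" for i
    define N where "N = {t \<in> ?T. \<forall>i. ?d t i \<in> Q i}"
    have "card N = card (?d ` N)"
      using snake_inj [OF assms(1), where 'a = 'm]
      by (intro card_image [symmetric]) (auto simp: N_def inj_on_def)
    also have "\<dots> \<le> card (Pi\<^sub>E UNIV Q)"
      by (intro card_mono finite_PiE) (auto simp: N_def Q_def finite_close)
    also have "\<dots> \<le> (\<Prod>i\<in>(UNIV::'m set). 3)"
      unfolding card_PiE [OF finite] by (intro prod_mono) (auto simp: Q_def card_close)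
    finally have "card N \<le> 3 ^ CARD('m)"
      by simp
    moreover have "\<forall>\<^sub>F z in nhds x. bump L (?d t) z * c t = 0" if t: "t \<in> ?T - N" for t
    proof -
      obtain i where i: "3 \<le> \<bar>?w * (x $ i) - 2 * real (?d t i)\<bar>"
        using t by (auto simp: N_def Q_def not_less)
      have "((\<lambda>z. z $ i) \<longlongrightarrow> x $ i) (nhds x)"
        by (intro tendsto_intros filterlim_ident)
      from eventually_compose_filterlim [OF affine_neighbourhood [OF zero_less_one, of ?w "x $ i"] this]
      show ?thesis
      proof eventually_elim
        fix z :: "real^'m" assume "\<bar>?w * z $ i - ?w * x $ i\<bar> < 1"
        then have "bump1 L (?d t i) (z $ i) = 0"
          using i by (intro bump1_eq_0) linarith
        then show "bump L (?d t) z * c t = 0"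
          by (simp add: bump_eq_0)
      qed
    qed
    ultimately show "\<exists>N\<subseteq>?T. card N \<le> 3 ^ CARD('m) \<and>
        (\<forall>t\<in>?T - N. \<forall>\<^sub>F z in nhds x. bump L (?d t) z * c t = 0)"
      by (intro exI [of _ N]) (auto simp: N_def)
  qed (use \<sigma>_ge_1 assms in auto)
  moreover have "6 ^ CARD('m) = (3 * 2 :: real) ^ CARD('m)"
    by simp
  ultimately show ?thesis
    unfolding power_mult_distrib by (simp add: mult.assoc)
qed

section \<open>One stage of the refinement\<close>

text \<open>
  The similarity of the unit interval onto the \<open>e\<close>-th of \<open>M\<close> equal parts, reversed for odd \<open>e\<close>, so
  that the endpoint of parity \<open>p\<close> of \<open>[0, 1]\<close> goes to the endpoint of parity \<open>p\<close> of the part.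
\<close>
definition place :: "nat \<Rightarrow> nat \<Rightarrow> real \<Rightarrow> real" where
  "place M e y = (real e + (if even e then y else 1 - y)) / real M"

text \<open>
  If \<open>f\<close> is the \<open>\<kappa>\<close>-th component of a map between the cubes, so is \<open>refine L M \<kappa> f\<close>: on the \<open>t\<close>-th cell of
  the domain it is a copy of \<open>f\<close> placed into the \<open>t\<close>-th cell of the target.
\<close>
definition refine :: "nat \<Rightarrow> nat \<Rightarrow> 'n::finite \<Rightarrow> (real^'m \<Rightarrow> real) \<Rightarrow> real^'m \<Rightarrow> real" where
  "refine L M \<kappa> f x =
     (\<Sum>t<L ^ CARD('m). bump L (snake L t) x * place M (snake M t \<kappa>) (f (fold_map L x)))"

text \<open>
  The operator \<open>refine\<close> is affine in \<open>f\<close>, and this is the coefficient of its linear part.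
\<close>
definition slope :: "nat \<Rightarrow> nat \<Rightarrow> 'n::finite \<Rightarrow> real^'m \<Rightarrow> real" where
  "slope L M \<kappa> x =
     (\<Sum>t<L ^ CARD('m). bump L (snake L t) x * ((if even (snake M t \<kappa>) then 1 else - 1) / real M))"

definition cell :: "nat \<Rightarrow> ('m \<Rightarrow> nat) \<Rightarrow> (real^'m) set" where
  "cell L d = cbox (\<chi> i. 2 * real (d i) / (2 * real L - 1)) (\<chi> i. (2 * real (d i) + 1) / (2 * real L - 1))"

definition corner :: "nat \<Rightarrow> nat \<Rightarrow> nat \<Rightarrow> real^'m" where
  "corner L t p = (\<chi> i. (real (snake L t i) + real (endpoint (snake L t i) p)) / (2 * real L - 1))"

definition link :: "nat \<Rightarrow> nat \<Rightarrow> (real^'m) set" where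
  "link L t = closed_segment (corner L t (Suc t)) (corner L (Suc t) (Suc t))"

text \<open>
  The cells together with the links, which cross the gaps between consecutive cells.  Near this set the
  blending of the copies in the gaps is not noticed.
\<close>
definition skeleton :: "nat \<Rightarrow> (real^'m) set" where
  "skeleton L = (\<Union>t<L ^ CARD('m). cell L (snake L t)) \<union>
     (\<Union>t\<in>{t. Suc t < L ^ CARD('m)}. link L t)"

lemma place_diff: "place M e y - place M e z = (if even e then 1 else - 1) / real M * (y - z)"
  by (auto simp: place_def add_divide_distrib diff_divide_distrib)

lemma refine_diff:
  "refine L M \<kappa> f x - refine L M \<kappa> g x = slope L M \<kappa> x * (f (fold_map L x) - g (fold_map L x))"
  unfolding refine_def slope_def sum_distrib_right sum_subtractf [symmetric] right_diff_distrib [symmetric]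
    place_diff by (simp add: mult.assoc)

lemma place_range:
  assumes "e < M" "0 \<le> y" "y \<le> 1"
  shows "0 \<le> place M e y" "place M e y \<le> 1"
proof -
  have "real e + 1 \<le> real M"
    using assms by simp
  then show "0 \<le> place M e y" "place M e y \<le> 1"
    using assms by (auto simp: place_def field_simps)
qed

lemma refine_range:
  fixes x :: "real^'m"
  assumes "0 < L" "0 < M" "0 \<le> f (fold_map L x)" "f (fold_map L x) \<le> 1"
  shows "0 \<le> refine L M \<kappa> f x" "refine L M \<kappa> f x \<le> 1"
proof -
  note p = place_range [OF snake_less [OF assms(2)] assms(3,4)]
  show "0 \<le> refine L M \<kappa> f x"
    unfolding refine_def using p by (intro sum_nonneg mult_nonneg_nonneg bump_nonneg) auto
  have "refine L M \<kappa> f x \<le> (\<Sum>t<L ^ CARD('m). bump L (snake L t) x * 1)"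
    unfolding refine_def using p by (intro sum_mono mult_left_mono bump_nonneg) auto
  also have "\<dots> \<le> 1"
    using sum_bump_le [OF assms(1)] by simp
  finally show "refine L M \<kappa> f x \<le> 1" .
qed

text \<open>
  A stage multiplies frequencies by at most \<open>growth m * L\<close>.
\<close>
definition growth :: "nat \<Rightarrow> real" where
  "growth m = (6 * real m + 6 + 2 * real r) * \<sigma>"

lemma growth_ge: "1 \<le> growth m"
proof -
  have "1 * 1 \<le> (6 * real m + 6 + 2 * real r) * \<sigma>"
    using \<sigma>_ge_1 by (intro mult_mono) auto
  then show ?thesis
    by (simp add: growth_def)
qed

lemma slope_bound:
  assumes "0 < L" "0 < M"
  shows "jet_bound UNIV r (6 ^ CARD('m) / M) (6 * real CARD('m) * real L * \<sigma>) (slope L M \<kappa> :: real^'m \<Rightarrow> real)"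
  unfolding slope_def [abs_def]
  using weighted_bump_sum_bound [OF assms(1), of "\<lambda>t. (if even (snake M t \<kappa>) then 1 else - 1) / real M" "1 / M",
      where 'm = 'm] by simp

lemma slope_compose_bound:
  fixes f :: "real^'m \<Rightarrow> real"
  assumes "0 < L" "0 < M" "jet_bound Y r A l f" "fold_map L ` X \<subseteq> Y" "0 \<le> A" "1 \<le> l"
  shows "jet_bound X r (6 ^ CARD('m) / M * A) (growth CARD('m) * L * l)
    (\<lambda>x. slope L M \<kappa> x * f (fold_map L x))"
proof -
  have f: "jet_bound X r A (l * (6 * real L * \<sigma>) + real r * (2 * real L * \<sigma>)) (\<lambda>x. f (fold_map L x))"
    unfolding fold_map_def
    using assms \<sigma>_ge_1
    by (intro jet_bound_compose [OF assms(3) has_partial_fold1 fold1'_bound]) (auto simp: fold_map_def)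
  have s: "jet_bound X r (6 ^ CARD('m) / M) (6 * real CARD('m) * real L * \<sigma>) (slope L M \<kappa> :: real^'m \<Rightarrow> real)"
    using assms \<sigma>_ge_1 by (intro jet_bound_mono [OF slope_bound]) auto
  have "1 * (real L * \<sigma>) \<le> l * (real L * \<sigma>)"
    using assms \<sigma>_ge_1 by (intro mult_right_mono) auto
  then have "(6 * real CARD('m) + 2 * real r) * (real L * \<sigma>) \<le> (6 * real CARD('m) + 2 * real r) * (l * (real L * \<sigma>))"
    by (intro mult_left_mono) auto
  then have "6 * real CARD('m) * real L * \<sigma> + (l * (6 * real L * \<sigma>) + real r * (2 * real L * \<sigma>))
      \<le> growth CARD('m) * L * l"
    by (simp add: growth_def algebra_simps)
  then show ?thesis
    using assms \<sigma>_ge_1 by (intro jet_bound_mono [OF jet_bound_mult [OF s f]]) auto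
qed

lemma refine_bound:
  fixes f :: "real^'m \<Rightarrow> real"
  assumes "0 < L" "0 < M" "jet_bound UNIV r A l f" "0 \<le> A" "1 \<le> l"
  shows "jet_bound UNIV r (6 ^ CARD('m) * (1 + A)) (growth CARD('m) * L * l) (refine L M \<kappa> f)"
proof -
  let ?l = "growth CARD('m) * L * l"
  have "jet_bound UNIV r (6 ^ CARD('m) * 1) (6 * real CARD('m) * real L * \<sigma>)
      (\<lambda>x::real^'m. \<Sum>t<L ^ CARD('m). bump L (snake L t) x * place M (snake M t \<kappa>) 0)"
    using place_range [OF snake_less [OF assms(2), of _ \<kappa>], of 0]
    by (intro weighted_bump_sum_bound [OF assms(1)]) simp_all
  moreover have "6 * real CARD('m) * real L * \<sigma> \<le> ?l"
  proof -
    have "6 * real CARD('m) * real L * \<sigma> \<le> (6 * real CARD('m) + 6 + 2 * real r) * \<sigma> * real L * 1"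
      using \<sigma>_ge_1 by (auto simp: mult_right_mono algebra_simps)
    also have "\<dots> \<le> ?l"
      unfolding growth_def using assms \<sigma>_ge_1 by (intro mult_left_mono) auto
    finally show ?thesis .
  qed
  ultimately have 1: "jet_bound UNIV r (6 ^ CARD('m)) ?l
      (\<lambda>x::real^'m. \<Sum>t<L ^ CARD('m). bump L (snake L t) x * place M (snake M t \<kappa>) 0)"
    using \<sigma>_ge_1 by (elim jet_bound_mono) auto
  have "6 ^ CARD('m) / real M * A \<le> 6 ^ CARD('m) * A"
    using assms by (intro mult_right_mono) (auto simp: field_simps)
  then have 2: "jet_bound UNIV r (6 ^ CARD('m) * A) ?l (\<lambda>x. slope L M \<kappa> x * f (fold_map L x))"
    using assms growth_ge [of "CARD('m)"]
    by (intro jet_bound_mono [OF slope_compose_bound [OF assms(1-3)]]) auto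
  have "refine L M \<kappa> f = (\<lambda>x. (\<Sum>t<L ^ CARD('m). bump L (snake L t) x * place M (snake M t \<kappa>) 0)
      + slope L M \<kappa> x * f (fold_map L x))"
  proof
    fix x
    show "refine L M \<kappa> f x = (\<Sum>t<L ^ CARD('m). bump L (snake L t) x * place M (snake M t \<kappa>) 0)
      + slope L M \<kappa> x * f (fold_map L x)"
      using refine_diff [of L M \<kappa> f x "\<lambda>_. 0"] by (simp add: refine_def)
  qed
  then show ?thesis
    using jet_bound_add [OF 1 2] by (simp add: distrib_left)
qed

section \<open>The refined function near cells and links\<close>

lemma mem_cell:
  "0 < L \<Longrightarrow> x \<in> cell L d \<longleftrightarrow>
    (\<forall>i. 2 * real (d i) \<le> (2 * real L - 1) * x $ i \<and> (2 * real L - 1) * x $ i \<le> 2 * real (d i) + 1)"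
proof -
  assume "0 < L"
  then have "0 < 2 * real L - 1"
    by simp
  then show ?thesis
    by (simp add: cell_def mem_box_cart pos_divide_le_eq pos_le_divide_eq mult.commute)
qed

lemma corner_coord: "0 < L \<Longrightarrow>
  (2 * real L - 1) * corner L t p $ i = real (snake L t i) + real (endpoint (snake L t i) p)"
  by (simp add: corner_def)

lemma fold1_endpoint:
  assumes "c < L" "(2 * real L - 1) * x = real c + real (endpoint c p)"
  shows "fold1 L x = (if even p then 0 else 1)"
proof (cases "even (c + p)")
  case True
  then show ?thesis
    using assms by (subst fold1_left [of c]) (auto simp: endpoint_def)
next
  case False
  then show ?thesis
    using assms by (subst fold1_gap [of c]) (auto simp: endpoint_def)
qed

lemma fold_map_corner:
  assumes "0 < L"
  shows "fold_map L (corner L t p :: real^'m) = (if even p then 0 else 1)"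
proof -
  have "fold1 L (corner L t p $ i) = (if even p then 0 else 1)" for i :: 'm
    by (rule fold1_endpoint [OF snake_less [OF assms] corner_coord [OF assms]])
  then show ?thesis
    by (simp add: fold_map_def vec_eq_iff)
qed

lemma corner_in_cell: "0 < L \<Longrightarrow> corner L t p \<in> cell L (snake L t)"
  by (simp add: mem_cell corner_coord) (simp add: endpoint_def)

lemma link_coord_same:
  assumes "odd L" "x \<in> link L t" "snake L t i = snake L (Suc t) i"
  shows "(2 * real L - 1) * x $ i = real (snake L t i) + real (endpoint (snake L t i) (Suc t))"
proof -
  have L: "0 < L" using assms by (simp add: odd_pos)
  obtain u where x: "x = (1 - u) *\<^sub>R corner L t (Suc t) + u *\<^sub>R corner L (Suc t) (Suc t)"
    using assms(2) by (auto simp: link_def closed_segment_def)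
  have "corner L t (Suc t) $ i = corner L (Suc t) (Suc t) $ i"
    using assms(3) by (simp add: corner_def)
  then have "x $ i = corner L t (Suc t) $ i"
    unfolding x by (simp add: algebra_simps)
  then show ?thesis
    using corner_coord [OF L] by simp
qed

text \<open>
  In the coordinate that changes, a link runs through the gap between two adjacent cells.
\<close>
lemma link_coord_differ:
  assumes "odd L" "x \<in> link L t" "snake L t i \<noteq> snake L (Suc t) i"
  obtains k where "{snake L t i, snake L (Suc t) i} = {k, Suc k}"
    "2 * real k + 1 \<le> (2 * real L - 1) * x $ i" "(2 * real L - 1) * x $ i \<le> 2 * real k + 2"
    "even k \<longleftrightarrow> odd (Suc t)"
proof -
  have L: "0 < L" using assms by (simp add: odd_pos)
  let ?w = "2 * real L - 1"
  define c c' where "c = snake L t i" and "c' = snake L (Suc t) i"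
  obtain u where u: "0 \<le> u" "u \<le> 1"
    and x: "x = (1 - u) *\<^sub>R corner L t (Suc t) + u *\<^sub>R corner L (Suc t) (Suc t)"
    using assms(2) by (auto simp: link_def closed_segment_def)
  have e: "endpoint c (Suc t) = endpoint c' (Suc t)"
    using snake_Suc_endpoint [OF assms(1)] by (simp add: c_def c'_def)
  have "?w * x $ i = (1 - u) * (?w * corner L t (Suc t) $ i) + u * (?w * corner L (Suc t) (Suc t) $ i)"
    by (simp add: x algebra_simps)
  also have "\<dots> = (1 - u) * (real c + real (endpoint c (Suc t))) + u * (real c' + real (endpoint c' (Suc t)))"
    by (simp only: corner_coord [OF L] c_def c'_def)
  finally have w: "?w * x $ i = (1 - u) * (real c + real (endpoint c (Suc t))) + u * (real c' + real (endpoint c (Suc t)))"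
    by (simp only: e)
  have ne: "c \<noteq> c'"
    using assms(3) by (simp add: c_def c'_def)
  show ?thesis
  proof (cases "even (c + Suc t)")
    case True
    then have "c = Suc c'" "endpoint c (Suc t) = c" "even c' \<longleftrightarrow> odd (Suc t)"
      using e ne by (auto simp: endpoint_def split: if_splits)
    then show ?thesis
      using u w by (intro that [of c']) (auto simp: algebra_simps c_def c'_def)
  next
    case False
    then have "c' = Suc c" "endpoint c (Suc t) = Suc c" "even c \<longleftrightarrow> odd (Suc t)"
      using e ne by (auto simp: endpoint_def split: if_splits)
    then show ?thesis
      using u w by (intro that [of c]) (auto simp: algebra_simps c_def c'_def)
  qed
qed

lemma fold_map_link:
  fixes x :: "real^'m"
  assumes "odd L" "x \<in> link L t"
  shows "fold_map L x = (if even (Suc t) then 0 else 1)"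
proof -
  have L: "0 < L" using assms by (simp add: odd_pos)
  have "fold1 L (x $ i) = (if even (Suc t) then 0 else 1)" for i
  proof (cases "snake L t i = snake L (Suc t) i")
    case True
    then show ?thesis
      using fold1_endpoint [OF snake_less [OF L] link_coord_same [OF assms True]] by simp
  next
    case False
    then obtain k where k: "{snake L t i, snake L (Suc t) i} = {k, Suc k}"
      "2 * real k + 1 \<le> (2 * real L - 1) * x $ i" "(2 * real L - 1) * x $ i \<le> 2 * real k + 2"
      "even k \<longleftrightarrow> odd (Suc t)"
      using link_coord_differ [OF assms] by metis
    then have "k < L"
      using snake_less [OF L, of t i] snake_less [OF L, of "Suc t" i] by (metis insertE insertI1 singletonD)
    then show ?thesis
      using fold1_gap [OF _ k(2,3)] k(4) by simp
  qed
  then show ?thesis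
    by (auto simp: fold_map_def vec_eq_iff)
qed

lemma coordinates_near:
  fixes x :: "real^'m"
  assumes "0 < e"
  shows "\<forall>\<^sub>F z in nhds x. \<forall>i. \<bar>a * z $ i - a * x $ i\<bar> < e"
proof (rule eventually_all_finite)
  fix i
  have "((\<lambda>z. z $ i) \<longlongrightarrow> x $ i) (nhds x)"
    by (intro tendsto_intros filterlim_ident)
  from eventually_compose_filterlim [OF affine_neighbourhood [OF assms, of a "x $ i"] this]
  show "\<forall>\<^sub>F z in nhds x. \<bar>a * z $ i - a * x $ i\<bar> < e" .
qed

lemma bump1_other_cell:
  assumes "- 1 / 3 < (2 * real L - 1) * x - 2 * real c" "(2 * real L - 1) * x - 2 * real c < 4 / 3" "c' \<noteq> c"
  shows "bump1 L c' x = 0"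
proof -
  have "real c' + 1 \<le> real c \<or> real c + 1 \<le> real c'"
    using assms(3) by linarith
  then show ?thesis
    using assms by (intro bump1_eq_0) linarith
qed

lemma bump1_other_gap:
  assumes "2 / 3 < (2 * real L - 1) * x - 2 * real c" "(2 * real L - 1) * x - 2 * real c < 7 / 3"
    "c' \<noteq> c" "c' \<noteq> Suc c"
  shows "bump1 L c' x = 0"
proof -
  have "real c' + 1 \<le> real c \<or> real c + 2 \<le> real c'"
    using assms(3,4) by linarith
  then show ?thesis
    using assms by (intro bump1_eq_0) linarith
qed

lemma weighted_sum_near_cell:
  fixes x :: "real^'m"
  assumes "0 < L" "t < L ^ CARD('m)" "x \<in> cell L (snake L t)"
  shows "\<forall>\<^sub>F z in nhds x. (\<Sum>u<L ^ CARD('m). bump L (snake L u) z * g u) = g t"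
proof -
  have "(0::real) < 1 / 3" by simp
  from coordinates_near [OF this, of "2 * real L - 1" x]
  show ?thesis
  proof eventually_elim
    fix z :: "real^'m"
    assume near: "\<forall>i. \<bar>(2 * real L - 1) * z $ i - (2 * real L - 1) * x $ i\<bar> < 1 / 3"
    have c: "- 1 / 3 < (2 * real L - 1) * z $ i - 2 * real (snake L t i)"
      "(2 * real L - 1) * z $ i - 2 * real (snake L t i) < 4 / 3" for i
      using spec [OF near, of i] spec [OF mem_cell [OF assms(1), THEN iffD1, OF assms(3)], of i]
      by linarith+
    have 1: "bump L (snake L t) z = 1"
      unfolding bump_def by (intro prod.neutral ballI bump1_eq_1 less_imp_le c)
    have 0: "bump L (snake L u) z = 0" if u: "u < L ^ CARD('m)" "u \<noteq> t" for u
    proof -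
      obtain i :: 'm where "snake L u i \<noteq> snake L t i"
        using inj_onD [OF snake_inj [OF assms(1), where 'a = 'm], of u t] u assms(2) by auto
      then have "bump1 L (snake L u i) (z $ i) = 0"
        by (rule bump1_other_cell [OF c])
      then show ?thesis
        by (rule bump_eq_0)
    qed
    have "(\<Sum>u<L ^ CARD('m). bump L (snake L u) z * g u) = (\<Sum>u\<in>{t}. bump L (snake L u) z * g u)"
      using assms(2) by (intro sum.mono_neutral_right) (auto simp: 0)
    then show "(\<Sum>u<L ^ CARD('m). bump L (snake L u) z * g u) = g t"
      by (simp add: 1)
  qed
qed

text \<open>
  Near a link only the cutoff functions of the two cells that it joins are different from \<open>0\<close>.  They
  differ in a single coordinate, in which they add up to \<open>1\<close>.
\<close>
lemma weighted_sum_near_link: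
  fixes x :: "real^'m"
  assumes "odd L" "Suc t < L ^ CARD('m)" "x \<in> link L t" "g t = g (Suc t)"
  shows "\<forall>\<^sub>F z in nhds x. (\<Sum>u<L ^ CARD('m). bump L (snake L u) z * g u) = g t"
proof -
  have L: "0 < L" using assms by (simp add: odd_pos)
  let ?w = "2 * real L - 1"
  obtain i :: 'm where i: "snake L t i \<noteq> snake L (Suc t) i"
    using inj_onD [OF snake_inj [OF L, where 'a = 'm], of t "Suc t"] assms(2) by auto
  obtain k where k: "{snake L t i, snake L (Suc t) i} = {k, Suc k}"
      "2 * real k + 1 \<le> ?w * x $ i" "?w * x $ i \<le> 2 * real k + 2"
    using link_coord_differ [OF assms(1,3) i] by metis
  have same: "snake L (Suc t) j = snake L t j" if "j \<noteq> i" for j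
    using snake_Suc_single [OF L i, of j] that by metis
  have "(0::real) < 1 / 3" by simp
  from coordinates_near [OF this, of ?w x]
  show ?thesis
  proof eventually_elim
    fix z :: "real^'m"
    assume near: "\<forall>i. \<bar>?w * z $ i - ?w * x $ i\<bar> < 1 / 3"
    have c: "- 1 / 3 < ?w * z $ j - 2 * real (snake L t j)"
      "?w * z $ j - 2 * real (snake L t j) < 4 / 3" if "j \<noteq> i" for j
    proof -
      have "real (endpoint (snake L t j) (Suc t)) = real (snake L t j)
          \<or> real (endpoint (snake L t j) (Suc t)) = real (snake L t j) + 1"
        by (simp add: endpoint_def)
      then show "- 1 / 3 < ?w * z $ j - 2 * real (snake L t j)"
        "?w * z $ j - 2 * real (snake L t j) < 4 / 3"
        using spec [OF near, of j] link_coord_same [OF assms(1,3) same [OF that, symmetric]]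
        by linarith+
    qed
    have ki: "2 / 3 < ?w * z $ i - 2 * real k" "?w * z $ i - 2 * real k < 7 / 3"
      using spec [OF near, of i] k(2,3) by linarith+
    have 1: "bump L d z = bump1 L (d i) (z $ i)" if "\<And>j. j \<noteq> i \<Longrightarrow> d j = snake L t j" for d
    proof -
      have "bump L d z = (\<Prod>j\<in>{i}. bump1 L (d j) (z $ j))"
        unfolding bump_def
        by (intro prod.mono_neutral_right) (auto simp: that intro!: bump1_eq_1 less_imp_le c)
      then show ?thesis by simp
    qed
    have "bump L (snake L t) z + bump L (snake L (Suc t)) z
        = bump1 L (snake L t i) (z $ i) + bump1 L (snake L (Suc t) i) (z $ i)"
      by (simp add: 1 same)
    also have "\<dots> = bump1 L k (z $ i) + bump1 L (Suc k) (z $ i)"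
      using k(1) by (auto simp: doubleton_eq_iff)
    also have "\<dots> = 1"
      using ki by (intro bump1_add) auto
    finally have one: "bump L (snake L t) z + bump L (snake L (Suc t)) z = 1" .
    have 0: "bump L (snake L u) z = 0" if u: "u < L ^ CARD('m)" "u \<noteq> t" "u \<noteq> Suc t" for u
    proof (cases "\<forall>j. j \<noteq> i \<longrightarrow> snake L u j = snake L t j")
      case True
      have "snake L u i \<noteq> snake L v i" if "v < L ^ CARD('m)" "u \<noteq> v" "v = t \<or> v = Suc t" for v
      proof
        assume "snake L u i = snake L v i"
        then have "snake L u = (snake L v :: 'm \<Rightarrow> nat)"
          using True same that(3) by (metis ext)
        then show False
          using inj_onD [OF snake_inj [OF L, where 'a = 'm], of u v] u that by auto
      qed
      from this [of t] this [of "Suc t"] have "snake L u i \<notin> {k, Suc k}"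
        using k(1) u assms(2) by (metis insert_iff singletonD Suc_lessD)
      then show ?thesis
        using bump1_other_gap [OF ki, of "snake L u i"] by (intro bump_eq_0) auto
    next
      case False
      then obtain j where "j \<noteq> i" "snake L u j \<noteq> snake L t j"
        by auto
      then show ?thesis
        using bump1_other_cell [OF c] by (intro bump_eq_0) auto
    qed
    have "(\<Sum>u<L ^ CARD('m). bump L (snake L u) z * g u) = (\<Sum>u\<in>{t, Suc t}. bump L (snake L u) z * g u)"
      using assms(2) by (intro sum.mono_neutral_right) (auto simp: 0)
    also have "\<dots> = (bump L (snake L t) z + bump L (snake L (Suc t)) z) * g t"
      by (simp add: assms(4) distrib_right)
    finally show "(\<Sum>u<L ^ CARD('m). bump L (snake L u) z * g u) = g t"
      by (simp add: one)
  qed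
qed

lemma place_parity: "place M e (if even p then 0 else 1) = real (endpoint e p) / real M"
  by (auto simp: place_def endpoint_def)

text \<open>
  Near a point of a cell the refined function is an affine function of \<open>f \<circ> fold_map L\<close>.  Near a point
  of a link two such functions are blended, but they agree at the value that \<open>f \<circ> fold_map L\<close> takes
  on the link.  So in both cases the deviation from the value at \<open>x\<close> is proportional to that of \<open>f\<close>.
\<close>
lemma refine_near_skeleton:
  fixes x :: "real^'m" and f :: "real^'m \<Rightarrow> real"
  assumes "odd L" "odd M" "x \<in> skeleton L" "f 0 = 0" "f 1 = 1"
  shows "\<forall>\<^sub>F z in nhds x. refine L M \<kappa> f z - refine L M \<kappa> f x
    = slope L M \<kappa> z * (f (fold_map L z) - f (fold_map L x))"
proof -
  have L: "0 < L" using assms by (simp add: odd_pos)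
  define y where "y = f (fold_map L x)"
  define g where "g t = place M (snake M t \<kappa>) y" for t
  have "\<exists>c. \<forall>\<^sub>F z in nhds x. (\<Sum>u<L ^ CARD('m). bump L (snake L u) z * g u) = c"
  proof -
    consider t where "t < L ^ CARD('m)" "x \<in> cell L (snake L t)"
      | t where "Suc t < L ^ CARD('m)" "x \<in> link L t"
      using assms(3) by (auto simp: skeleton_def)
    then show ?thesis
    proof cases
      case 1
      then show ?thesis
        using weighted_sum_near_cell [OF L] by blast
    next
      case 2
      then have "y = (if even (Suc t) then 0 else 1)"
        using fold_map_link [OF assms(1) 2(2)] assms(4,5) by (auto simp: y_def)
      then have "g t = g (Suc t)"
        unfolding g_def using place_parity [of M _ "Suc t"] snake_Suc_endpoint [OF assms(2), of t \<kappa>]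
        by metis
      then show ?thesis
        using weighted_sum_near_link [OF assms(1) 2] by blast
    qed
  qed
  then obtain c where c: "\<forall>\<^sub>F z in nhds x. (\<Sum>u<L ^ CARD('m). bump L (snake L u) z * g u) = c"
    by blast
  have *: "refine L M \<kappa> f z - (\<Sum>u<L ^ CARD('m). bump L (snake L u) z * g u)
      = slope L M \<kappa> z * (f (fold_map L z) - y)" for z
    using refine_diff [of L M \<kappa> f z "\<lambda>_. y"] by (simp add: refine_def g_def)
  have fx: "refine L M \<kappa> f x = c"
    using * [of x] eventually_nhds_x_imp_x [OF c] by (simp add: y_def)
  from c show ?thesis
  proof eventually_elim
    case (elim z)
    then have "refine L M \<kappa> f z - refine L M \<kappa> f x
        = refine L M \<kappa> f z - (\<Sum>u<L ^ CARD('m). bump L (snake L u) z * g u)"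
      by (simp only: fx)
    also note *
    finally show ?case
      by (simp only: y_def)
  qed
qed

end

section \<open>Iterated refinement and the nested continua\<close>

locale nested_refinement = smooth_step +
  fixes L M :: "nat \<Rightarrow> nat"
  assumes odd_L: "odd (L j)" and odd_M: "odd (M j)" and M_ge_3: "3 \<le> M j"
begin

lemma L_pos: "0 < L j" and M_pos: "0 < M j"
  using odd_L odd_M by (auto simp: odd_pos)

definition start :: "real^'m \<Rightarrow> real" where
  "start x = (\<Prod>i\<in>UNIV. s (x $ i))"

text \<open>
  In \<open>approx \<kappa> k j\<close> the stages \<open>j\<close>, \<open>\<dots>\<close>, \<open>j + k - 1\<close> are carried out.  The innermost function
  takes the values \<open>0\<close> and \<open>1\<close> at the ends of the diagonal, as the gluing along the links requires.
\<close>
primrec approx :: "'n::finite \<Rightarrow> nat \<Rightarrow> nat \<Rightarrow> real^'m \<Rightarrow> real" where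
  "approx \<kappa> 0 j = start"
| "approx \<kappa> (Suc k) j = refine (L j) (M j) \<kappa> (approx \<kappa> k (Suc j))"

text \<open>
  The points that remain in the skeleton during the stages \<open>j\<close>, \<open>\<dots>\<close>, \<open>j + k - 1\<close>.
\<close>
primrec nest :: "nat \<Rightarrow> nat \<Rightarrow> (real^'m) set" where
  "nest 0 j = cbox 0 1"
| "nest (Suc k) j = skeleton (L j) \<inter> fold_map (L j) -` nest k (Suc j)"

lemma approx_range: "0 \<le> approx \<kappa> k j x" "approx \<kappa> k j x \<le> 1"
proof -
  have "0 \<le> approx \<kappa> k j x \<and> approx \<kappa> k j x \<le> 1"
  proof (induction k arbitrary: j x)
    case 0
    then show ?case
      using s_range by (auto simp: start_def intro!: prod_nonneg prod_le_1)
  next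
    case (Suc k)
    then show ?case
      using refine_range [OF L_pos M_pos, of "approx \<kappa> k (Suc j)" j x j \<kappa>] by simp
  qed
  then show "0 \<le> approx \<kappa> k j x" "approx \<kappa> k j x \<le> 1"
    by auto
qed

lemma refine_cell:
  fixes x :: "real^'m"
  assumes "t < L j ^ CARD('m)" "x \<in> cell (L j) (snake (L j) t)"
  shows "refine (L j) (M j) \<kappa> f x = place (M j) (snake (M j) t \<kappa>) (f (fold_map (L j) x))"
  unfolding refine_def by (rule eventually_nhds_x_imp_x [OF weighted_sum_near_cell [OF L_pos assms]])

lemma zero_in_cell: "(0 :: real^'m) \<in> cell (L j) (snake (L j) 0)"
  by (simp add: mem_cell L_pos snake_first)

lemma one_in_cell: "(1 :: real^'m) \<in> cell (L j) (snake (L j) (L j ^ CARD('m) - 1))"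
  using L_pos [of j] odd_L by (simp add: mem_cell snake_last [simplified] of_nat_diff Suc_le_eq)

lemma fold_map_0: "fold_map (L j) 0 = 0"
  using fold1_left [of 0 "L j" 0] L_pos by (simp add: fold_map_def vec_eq_iff)

lemma fold_map_1: "fold_map (L j) 1 = 1"
  using fold1_gap [of "L j - 1" "L j" 1] L_pos [of j] odd_L [of j]
  by (simp add: fold_map_def vec_eq_iff of_nat_diff Suc_le_eq)

lemma approx_0: "approx \<kappa> k j (0 :: real^'m) = 0"
proof (induction k arbitrary: j)
  case 0
  have "\<exists>i. i \<in> (UNIV :: 'm set)"
    by blast
  then show ?case
    by (simp add: start_def s_eq_0)
next
  case (Suc k)
  have "approx \<kappa> (Suc k) j (0 :: real^'m)
      = place (M j) (snake (M j) 0 \<kappa>) (approx \<kappa> k (Suc j) (fold_map (L j) (0 :: real^'m)))"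
    unfolding approx.simps(2) by (rule refine_cell [OF _ zero_in_cell]) (simp add: L_pos)
  then show ?case
    by (simp only: fold_map_0 Suc snake_first M_pos) (simp add: place_def)
qed

lemma approx_1:
  assumes "\<And>j. L j ^ CARD('m) = M j ^ CARD('n)"
  shows "approx (\<kappa> :: 'n::finite) k j (1 :: real^'m) = 1"
proof (induction k arbitrary: j)
  case 0
  then show ?case
    by (simp add: start_def s_eq_1)
next
  case (Suc k)
  have "L j ^ CARD('m) - 1 < L j ^ CARD('m)"
    using L_pos by simp
  from refine_cell [OF this one_in_cell, of \<kappa> "approx \<kappa> k (Suc j)"]
  have "approx \<kappa> (Suc k) j (1 :: real^'m)
      = place (M j) (snake (M j) (M j ^ CARD('n) - 1) \<kappa>) (approx \<kappa> k (Suc j) (1 :: real^'m))"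
    by (simp add: fold_map_1 assms)
  also have "\<dots> = 1"
    using odd_M [of j] M_pos [of j] by (simp add: Suc snake_last [simplified] place_def of_nat_diff Suc_le_eq)
  finally show ?case .
qed

lemma cell_subset:
  assumes "\<And>i. d i < L j"
  shows "cell (L j) d \<subseteq> (cbox 0 1 :: (real^'m) set)"
proof
  fix x :: "real^'m" assume x: "x \<in> cell (L j) d"
  let ?w = "2 * real (L j) - 1"
  have w: "0 < ?w"
    using L_pos [of j] by simp
  have "0 \<le> x $ i \<and> x $ i \<le> 1" for i
  proof -
    have "real (d i) + 1 \<le> real (L j)"
      using assms [of i] by simp
    moreover have "2 * real (d i) \<le> ?w * x $ i" "?w * x $ i \<le> 2 * real (d i) + 1"
      using x by (auto simp: mem_cell L_pos)
    ultimately have "0 \<le> ?w * x $ i" "?w * x $ i \<le> ?w"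
      by linarith+
    then show ?thesis
      using w by (simp add: zero_le_mult_iff)
  qed
  then show "x \<in> cbox 0 1"
    by (simp add: mem_box_cart)
qed

lemma skeleton_subset: "skeleton (L j) \<subseteq> (cbox 0 1 :: (real^'m) set)"
proof -
  have cell: "cell (L j) (snake (L j) t) \<subseteq> (cbox 0 1 :: (real^'m) set)" for t
    by (intro cell_subset snake_less L_pos)
  have "link (L j) t \<subseteq> (cbox 0 1 :: (real^'m) set)" for t
    unfolding link_def
    by (intro closed_segment_subset subsetD [OF cell corner_in_cell [OF L_pos]] convex_box)
  then show ?thesis
    using cell by (auto simp: skeleton_def)
qed

lemma nest_subset: "nest k j \<subseteq> cbox 0 1"
  using skeleton_subset by (cases k) auto

lemma nest_Suc_subset: "nest (Suc k) j \<subseteq> nest k j"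
proof (induction k arbitrary: j)
  case 0
  then show ?case using skeleton_subset by auto
next
  case (Suc k)
  show ?case
    using Suc [of "Suc j"] by (auto simp only: nest.simps(2))
qed

lemma compact_nest: "compact (nest k j :: (real^'m) set)"
proof (induction k arbitrary: j)
  case (Suc k)
  have "compact (skeleton (L j) :: (real^'m) set)"
    unfolding skeleton_def
    by (intro compact_Un compact_UN finite_lessThan finite_subset [of "{t. Suc t < L j ^ CARD('m)}" "{..<L j ^ CARD('m)}"])
      (auto simp: cell_def link_def compact_cbox)
  moreover have "closed (fold_map (L j) -` nest k (Suc j) :: (real^'m) set)"
    using Suc by (intro closed_vimage fold_map_continuous compact_imp_closed)
  ultimately show ?case
    by (simp add: compact_Int_closed)
qed (simp add: compact_cbox)

lemma zero_in_nest: "0 \<in> (nest k j :: (real^'m) set)"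
proof (induction k arbitrary: j)
  case (Suc k)
  have "0 \<in> (skeleton (L j) :: (real^'m) set)"
    using zero_in_cell L_pos [of j] by (force simp: skeleton_def)
  then show ?case
    using Suc by (simp add: fold_map_0)
qed (simp add: mem_box_cart)

lemma one_in_nest: "1 \<in> (nest k j :: (real^'m) set)"
proof (induction k arbitrary: j)
  case (Suc k)
  have "L j ^ CARD('m) - 1 < L j ^ CARD('m)"
    using L_pos by simp
  then have "1 \<in> (skeleton (L j) :: (real^'m) set)"
    unfolding skeleton_def using one_in_cell by blast
  then show ?case
    using Suc by (simp add: fold_map_1)
qed (simp add: mem_box_cart)

lemma fold1_between:
  assumes "c < L j" "2 * real c \<le> (2 * real (L j) - 1) * a" "a \<le> b" "b \<le> d"
    "(2 * real (L j) - 1) * d \<le> 2 * real c + 1" "fold1 (L j) a = fold1 (L j) d"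
  shows "fold1 (L j) b = fold1 (L j) a"
proof -
  let ?w = "2 * real (L j) - 1"
  have w: "0 \<le> ?w" using L_pos [of j] by simp
  have ab: "?w * a \<le> ?w * b" "?w * b \<le> ?w * d"
    using assms w by (auto intro: mult_left_mono)
  have "s (?w * a - 2 * real c) \<le> s (?w * b - 2 * real c)"
    "s (?w * b - 2 * real c) \<le> s (?w * d - 2 * real c)"
    using ab by (auto intro!: monoD [OF s_mono])
  moreover have "fold1 (L j) a = (if even c then s (?w * a - 2 * real c) else 1 - s (?w * a - 2 * real c))"
    using ab assms(2,5) by (intro fold1_eq assms(1)) linarith+
  moreover have "fold1 (L j) b = (if even c then s (?w * b - 2 * real c) else 1 - s (?w * b - 2 * real c))"
    using ab assms(2,5) by (intro fold1_eq assms(1)) linarith+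
  moreover have "fold1 (L j) d = (if even c then s (?w * d - 2 * real c) else 1 - s (?w * d - 2 * real c))"
    using ab assms(2,5) by (intro fold1_eq assms(1)) linarith+
  ultimately show ?thesis
    using assms(6) by (auto split: if_splits)
qed

lemma cell_onto:
  fixes y :: "real^'m"
  assumes "y \<in> cbox 0 1" "\<And>i. d i < L j"
  obtains x where "x \<in> cell (L j) d" "fold_map (L j) x = y"
proof -
  have "\<exists>x. 2 * real (d i) \<le> (2 * real (L j) - 1) * x \<and> (2 * real (L j) - 1) * x \<le> 2 * real (d i) + 1
      \<and> fold1 (L j) x = y $ i" for i
    using fold1_onto [OF assms(2), of "y $ i" i] assms(1) by (metis mem_box_cart(2) zero_index one_index)
  then obtain x where "\<And>i. 2 * real (d i) \<le> (2 * real (L j) - 1) * x i"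
    "\<And>i. (2 * real (L j) - 1) * x i \<le> 2 * real (d i) + 1" "\<And>i. fold1 (L j) (x i) = y $ i"
    by metis
  then show ?thesis
    by (intro that [of "\<chi> i. x i"]) (auto simp: mem_cell L_pos fold_map_def vec_eq_iff)
qed

text \<open>
  On a cell the folding map is coordinatewise monotone, hence its fibres are boxes and preimages of
  connected sets are connected.
\<close>
lemma connected_cell_preimage:
  fixes C :: "(real^'m) set"
  assumes "connected C" "C \<subseteq> cbox 0 1" "\<And>i. d i < L j"
  shows "connected (cell (L j) d \<inter> fold_map (L j) -` C)"
proof (rule connected_closed_monotone_preimage [OF fold_map_continuous _ _ _ assms(1,2)])
  let ?S = "cell (L j) d :: (real^'m) set" and ?w = "2 * real (L j) - 1"
  have w: "0 < ?w" using L_pos [of j] by simp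
  have sub: "?S \<subseteq> cbox 0 1"
    using assms(3) by (rule cell_subset)
  show "fold_map (L j) ` ?S = cbox 0 1"
  proof
    show "fold_map (L j) ` ?S \<subseteq> cbox 0 1"
      using sub fold_map_cube [OF L_pos] by blast
    show "cbox 0 1 \<subseteq> fold_map (L j) ` ?S"
    proof
      fix y :: "real^'m" assume "y \<in> cbox 0 1"
      then obtain x where "x \<in> ?S" "fold_map (L j) x = y"
        using cell_onto [of y d j] assms(3) by blast
      then show "y \<in> fold_map (L j) ` ?S"
        by blast
    qed
  qed
  then show "closedin (top_of_set (cbox 0 1)) (fold_map (L j) ` K)"
    if "closedin (top_of_set ?S) K" for K
  proof -
    have "compact K"
      using that closedin_compact [of ?S K] by (simp add: cell_def compact_cbox)
    then have "closed (fold_map (L j) ` K)"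
      by (intro compact_imp_closed compact_continuous_image fold_map_continuous)
    moreover have "fold_map (L j) ` K \<subseteq> cbox 0 1"
      using \<open>fold_map (L j) ` ?S = cbox 0 1\<close> closedin_imp_subset [OF that] by blast
    ultimately show ?thesis
      by (simp add: closed_subset)
  qed
  show "connected (?S \<inter> fold_map (L j) -` {y})" if "y \<in> cbox 0 1" for y
  proof (rule is_interval_connected)
    have mem: "z \<in> ?S \<inter> fold_map (L j) -` {y} \<longleftrightarrow> (\<forall>i. 2 * real (d i) \<le> ?w * z $ i \<and>
        ?w * z $ i \<le> 2 * real (d i) + 1 \<and> fold1 (L j) (z $ i) = y $ i)" for z :: "real^'m"
      by (auto simp: mem_cell L_pos fold_map_def vec_eq_iff)
    show "is_interval (?S \<inter> fold_map (L j) -` {y})"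
      unfolding is_interval_def
    proof (intro ballI allI impI)
      fix a b x
      assume a: "a \<in> ?S \<inter> fold_map (L j) -` {y}" and b: "b \<in> ?S \<inter> fold_map (L j) -` {y}"
        and x: "\<forall>i\<in>Basis. a \<bullet> i \<le> x \<bullet> i \<and> x \<bullet> i \<le> b \<bullet> i \<or> b \<bullet> i \<le> x \<bullet> i \<and> x \<bullet> i \<le> a \<bullet> i"
      show "x \<in> ?S \<inter> fold_map (L j) -` {y}"
        unfolding mem
      proof
        fix i
        have ai: "2 * real (d i) \<le> ?w * a $ i" "?w * a $ i \<le> 2 * real (d i) + 1" "fold1 (L j) (a $ i) = y $ i"
          and bi: "2 * real (d i) \<le> ?w * b $ i" "?w * b $ i \<le> 2 * real (d i) + 1" "fold1 (L j) (b $ i) = y $ i"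
          using a b unfolding mem by auto
        have "axis i 1 \<in> (Basis :: (real^'m) set)"
          by (auto simp: Basis_vec_def)
        then consider "a $ i \<le> x $ i" "x $ i \<le> b $ i" | "b $ i \<le> x $ i" "x $ i \<le> a $ i"
          using bspec [OF x, of "axis i 1"] by (auto simp: inner_axis)
        then show "2 * real (d i) \<le> ?w * x $ i \<and> ?w * x $ i \<le> 2 * real (d i) + 1 \<and> fold1 (L j) (x $ i) = y $ i"
        proof cases
          case 1
          then have "?w * a $ i \<le> ?w * x $ i" "?w * x $ i \<le> ?w * b $ i"
            using w by (auto intro: mult_left_mono)
          then show ?thesis
            using fold1_between [OF assms(3) ai(1) 1 bi(2)] ai bi by simp
        next
          case 2
          then have "?w * b $ i \<le> ?w * x $ i" "?w * x $ i \<le> ?w * a $ i"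
            using w by (auto intro: mult_left_mono)
          then show ?thesis
            using fold1_between [OF assms(3) bi(1) 2 ai(2)] ai bi by simp
        qed
      qed
    qed
  qed
qed

text \<open>
  The copy of the next set in each cell contains the corners of both parities, so the links join these
  copies to a chain.
\<close>
lemma nest_connected: "connected (nest k j :: (real^'m) set)"
proof (induction k arbitrary: j)
  case 0
  then show ?case by (simp add: convex_connected convex_box)
next
  case (Suc k)
  let ?l = "L j" and ?N = "nest k (Suc j) :: (real^'m) set"
  define A where "A t = cell ?l (snake ?l t) \<inter> fold_map ?l -` ?N" for t
  define B where "B t = (link ?l t :: (real^'m) set)" for t
  have A: "connected (A t)" for t
    unfolding A_def using Suc nest_subset snake_less [OF L_pos] by (intro connected_cell_preimage) auto
  have corner: "corner ?l t p \<in> A t" for t p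
    by (simp add: A_def corner_in_cell fold_map_corner L_pos zero_in_nest one_in_nest)
  have "connected ((\<Union>t<Suc q. A t) \<union> (\<Union>t<q. B t))" for q
  proof (induction q)
    case 0
    then show ?case using A by (simp add: lessThan_Suc)
  next
    case (Suc q)
    have B: "connected (B q)" "corner ?l q (Suc q) \<in> B q" "corner ?l (Suc q) (Suc q) \<in> B q"
      by (auto simp: B_def link_def)
    have "connected (((\<Union>t<Suc q. A t) \<union> (\<Union>t<q. B t)) \<union> B q)"
      using B corner [of q "Suc q"] by (intro connected_Un [OF Suc B(1)]) auto
    from connected_Un [OF this A, of "Suc q"] have "connected ((((\<Union>t<Suc q. A t) \<union> (\<Union>t<q. B t)) \<union> B q) \<union> A (Suc q))"
      using B corner [of "Suc q" "Suc q"] by blast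
    then show ?case
      by (simp add: lessThan_Suc Un_ac)
  qed
  moreover have "nest (Suc k) j = (\<Union>t<Suc (?l ^ CARD('m) - 1). A t) \<union> (\<Union>t<?l ^ CARD('m) - 1. B t)"
  proof -
    have "B t \<subseteq> fold_map ?l -` ?N" for t
      by (auto simp: B_def fold_map_link odd_L zero_in_nest one_in_nest)
    moreover have "Suc (?l ^ CARD('m) - 1) = ?l ^ CARD('m)"
      "{..<?l ^ CARD('m) - 1} = {t. Suc t < ?l ^ CARD('m)}"
      using L_pos [of j] by auto
    ultimately show ?thesis
      by (auto simp: skeleton_def A_def B_def)
  qed
  ultimately show ?case
    by (simp only:)
qed

lemma place_onto:
  assumes "0 < K" "0 \<le> v" "v \<le> 1"
  shows "\<exists>e<K. \<exists>y. 0 \<le> y \<and> y \<le> 1 \<and> place K e y = v"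
proof -
  have v: "0 \<le> real K * v" "real K * v \<le> real K"
    using assms by (auto simp: mult_left_le)
  obtain e where e: "e < K" "real e \<le> real K * v" "real K * v \<le> real e + 1"
  proof (cases "nat \<lfloor>real K * v\<rfloor> < K")
    case True
    have "real (nat \<lfloor>real K * v\<rfloor>) \<le> real K * v" "real K * v \<le> real (nat \<lfloor>real K * v\<rfloor>) + 1"
      using v by linarith+
    then show ?thesis
      using True that by blast
  next
    case False
    then have "real K \<le> real K * v"
      using v by linarith
    then show ?thesis
      using v assms by (intro that [of "K - 1"]) (simp_all add: of_nat_diff Suc_le_eq)
  qed
  define y where "y = (if even e then real K * v - real e else 1 - (real K * v - real e))"
  have "place K e y = v"
    using assms by (auto simp: place_def y_def)
  then show ?thesis
    using e by (intro exI [of _ e] conjI exI [of _ y]) (auto simp: y_def)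
qed

text \<open>
  The point is found by reading off the address of \<open>v\<close> in the grids of the target; each stage divides
  the error by at least \<open>3\<close>.
\<close>
lemma approx_nearly_onto:
  fixes v :: "'n::finite \<Rightarrow> real"
  assumes card: "\<And>j. L j ^ CARD('m) = M j ^ CARD('n)"
    and "\<And>\<kappa>. 0 \<le> v \<kappa>" "\<And>\<kappa>. v \<kappa> \<le> 1"
  shows "\<exists>x\<in>(nest k j :: (real^'m) set). \<forall>\<kappa>. \<bar>approx \<kappa> k j x - v \<kappa>\<bar> \<le> (1 / 3) ^ k"
  using assms(2,3)
proof (induction k arbitrary: j v)
  case 0
  have "\<bar>approx \<kappa> 0 j (0 :: real^'m) - v \<kappa>\<bar> \<le> 1" for \<kappa>
    unfolding approx_0 using 0 [of \<kappa>] by auto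
  then show ?case
    using zero_in_nest [of 0 j, where 'm = 'm] by (intro bexI [of _ 0]) auto
next
  case (Suc k)
  have "\<forall>\<kappa>. \<exists>e y. e < M j \<and> 0 \<le> y \<and> y \<le> 1 \<and> place (M j) e y = v \<kappa>"
    using place_onto [OF M_pos Suc.prems] by blast
  then obtain e y where e: "\<And>\<kappa>. e \<kappa> < M j" and y: "\<And>\<kappa>. 0 \<le> y \<kappa>" "\<And>\<kappa>. y \<kappa> \<le> 1"
    and v: "\<And>\<kappa>. place (M j) (e \<kappa>) (y \<kappa>) = v \<kappa>"
    by metis
  obtain t where t: "t < L j ^ CARD('m)" "snake (M j) t = e"
    using snake_surj [of e "M j", OF e] card [of j] by auto
  obtain x' :: "real^'m" where x': "x' \<in> nest k (Suc j)"
    "\<And>\<kappa>. \<bar>approx \<kappa> k (Suc j) x' - y \<kappa>\<bar> \<le> (1 / 3) ^ k"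
    using Suc.IH [of y "Suc j", OF y] by blast
  obtain x where x: "x \<in> cell (L j) (snake (L j) t)" "fold_map (L j) x = x'"
    using cell_onto [of x' "snake (L j) t" j] nest_subset x'(1) snake_less [OF L_pos] by blast
  have "x \<in> nest (Suc k) j"
    using x x' t by (auto simp: skeleton_def)
  moreover have "\<bar>approx \<kappa> (Suc k) j x - v \<kappa>\<bar> \<le> (1 / 3) ^ Suc k" for \<kappa>
  proof -
    have "approx \<kappa> (Suc k) j x - v \<kappa> = (if even (e \<kappa>) then 1 else - 1) / real (M j) * (approx \<kappa> k (Suc j) x' - y \<kappa>)"
      using refine_cell [OF t(1) x(1), of \<kappa> "approx \<kappa> k (Suc j)"] by (simp add: t(2) x(2) place_diff flip: v)
    then have "\<bar>approx \<kappa> (Suc k) j x - v \<kappa>\<bar> = 1 / real (M j) * \<bar>approx \<kappa> k (Suc j) x' - y \<kappa>\<bar>"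
      by (simp add: abs_mult)
    also have "\<dots> \<le> 1 / 3 * (1 / 3) ^ k"
      using M_ge_3 [of j] x'(2) [of \<kappa>] by (intro mult_mono) (auto simp: field_simps)
    finally show ?thesis
      by simp
  qed
  ultimately show ?case
    by blast
qed

section \<open>Derivative bounds for the iterates\<close>

text \<open>
  Amplitude and frequency acquire these factors in the stages \<open>j\<close>, \<open>\<dots>\<close>, \<open>j + k - 1\<close>.
\<close>
definition decay :: "nat \<Rightarrow> nat \<Rightarrow> nat \<Rightarrow> real" where
  "decay m k j = (\<Prod>i<k. 6 ^ m / real (M (j + i)))"

definition spread :: "nat \<Rightarrow> nat \<Rightarrow> nat \<Rightarrow> real" where
  "spread m k j = (\<Prod>i<k. growth m * real (L (j + i)))"

lemma decay_Suc: "decay m (Suc k) j = 6 ^ m / real (M j) * decay m k (Suc j)"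
  unfolding decay_def by (subst prod.lessThan_Suc_shift) simp

lemma spread_Suc: "spread m (Suc k) j = growth m * real (L j) * spread m k (Suc j)"
  unfolding spread_def by (subst prod.lessThan_Suc_shift) simp

lemma decay_nonneg: "0 \<le> decay m k j"
  unfolding decay_def by (intro prod_nonneg) auto

lemma growth_L_ge: "1 \<le> growth m * real (L j)"
  using mult_mono [OF growth_ge [of m], of 1 "real (L j)"] growth_ge [of m] L_pos [of j] by simp

lemma spread_ge: "1 \<le> spread m k j"
  unfolding spread_def by (intro prod_ge_1) (auto simp: growth_L_ge)

definition start_rate :: "nat \<Rightarrow> real" where "start_rate m = real m * \<sigma>"

lemma start_rate_ge: "1 \<le> start_rate CARD('m::finite)"
  unfolding start_rate_def using mult_mono [of 1 "real CARD('m)" 1 \<sigma>] \<sigma>_ge_1 by simp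

lemma start_bound: "jet_bound UNIV r 1 (start_rate CARD('m)) (start :: real^'m \<Rightarrow> real)"
proof -
  have "jet_bound UNIV r 1 \<sigma> (\<lambda>x::real^'m. s (x $ i))" for i
    using s_bound \<sigma>_ge_1 by (intro jet_bound_coordinate) auto
  then show ?thesis
    using jet_bound_prod [of "UNIV :: 'm set" UNIV r 1 \<sigma> "\<lambda>i x. s (x $ i)"] \<sigma>_ge_1
    by (simp add: start_def [abs_def] start_rate_def)
qed

lemma approx_bounded: "\<exists>A\<ge>0. \<exists>l\<ge>1. jet_bound UNIV r A l (approx \<kappa> k j :: real^'m \<Rightarrow> real)"
proof (induction k arbitrary: j)
  case 0
  then show ?case
    using start_bound [where 'm = 'm] start_rate_ge [where 'm = 'm] by (intro exI [of _ 1]) auto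
next
  case (Suc k)
  obtain A l where A: "0 \<le> A" "1 \<le> l" "jet_bound UNIV r A l (approx \<kappa> k (Suc j) :: real^'m \<Rightarrow> real)"
    using Suc by blast
  have "1 \<le> growth CARD('m) * real (L j) * l"
    using mult_mono [OF growth_L_ge A(2)] growth_L_ge [of "CARD('m)" j] by simp
  then show ?case
    using refine_bound [OF L_pos M_pos A(3,1,2), of j j \<kappa>] A(1)
    by (intro exI [of _ "6 ^ CARD('m) * (1 + A)"] conjI exI [of _ "growth CARD('m) * real (L j) * l"]) auto
qed

text \<open>
  The outer \<open>k\<close> stages act linearly on the difference that the innermost stage makes to \<open>start\<close>.
\<close>
lemma approx_step_bound:
  "jet_bound UNIV r (3 * 6 ^ CARD('m) * decay CARD('m) k j)
     (start_rate CARD('m) * (growth CARD('m) * L (j + k)) * spread CARD('m) k j)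
     (\<lambda>x::real^'m. approx \<kappa> (Suc k) j x - approx \<kappa> k j x)"
proof (induction k arbitrary: j)
  case 0
  let ?l = "growth CARD('m) * real (L j) * start_rate CARD('m)"
  have "jet_bound UNIV r (6 ^ CARD('m) * (1 + 1)) ?l (refine (L j) (M j) \<kappa> (start :: real^'m \<Rightarrow> real))"
    using start_rate_ge [where 'm = 'm] by (intro refine_bound L_pos M_pos start_bound) auto
  moreover have "jet_bound UNIV r 1 ?l (start :: real^'m \<Rightarrow> real)"
    using start_rate_ge [where 'm = 'm] growth_L_ge [of "CARD('m)" j]
    by (intro jet_bound_mono [OF start_bound]) auto
  ultimately have "jet_bound UNIV r (6 ^ CARD('m) * (1 + 1) + 1) ?l
      (\<lambda>x::real^'m. refine (L j) (M j) \<kappa> start x - start x)"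
    using start_rate_ge [where 'm = 'm] growth_L_ge [of "CARD('m)" j] by (intro jet_bound_diff) auto
  moreover have "6 ^ CARD('m) * (1 + 1) + 1 \<le> 3 * (6::real) ^ CARD('m)"
    using one_le_power [of "6::real" "CARD('m)"] by simp
  moreover have "0 \<le> ?l"
    using start_rate_ge [where 'm = 'm] growth_ge [of "CARD('m)"] by (intro mult_nonneg_nonneg) auto
  ultimately have "jet_bound UNIV r (3 * 6 ^ CARD('m)) ?l
      (\<lambda>x::real^'m. refine (L j) (M j) \<kappa> start x - start x)"
    by (elim jet_bound_mono) auto
  then show ?case
    by (simp add: decay_def spread_def mult_ac)
next
  case (Suc k)
  let ?A = "3 * 6 ^ CARD('m) * decay CARD('m) k (Suc j)"
    and ?l = "start_rate CARD('m) * (growth CARD('m) * L (Suc j + k)) * spread CARD('m) k (Suc j)"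
  have "1 * 1 \<le> ?l"
    using mult_mono [OF start_rate_ge [where 'm = 'm] growth_L_ge [of "CARD('m)" "Suc j + k"]]
      growth_L_ge [of "CARD('m)" "Suc j + k"] spread_ge [of "CARD('m)" k "Suc j"] start_rate_ge [where 'm = 'm]
    by (intro mult_mono) auto
  then have "jet_bound UNIV r (6 ^ CARD('m) / M j * ?A) (growth CARD('m) * L j * ?l)
      (\<lambda>x::real^'m. slope (L j) (M j) \<kappa> x * (approx \<kappa> (Suc k) (Suc j) (fold_map (L j) x)
        - approx \<kappa> k (Suc j) (fold_map (L j) x)))"
    using decay_nonneg [of "CARD('m)" k "Suc j"]
    by (intro slope_compose_bound [OF L_pos M_pos Suc]) auto
  then show ?case
    unfolding approx.simps(2) refine_diff decay_Suc spread_Suc by (simp add: mult_ac)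
qed

text \<open>
  On the nested sets every stage acts linearly on the deviation from the value at the point, so that
  the amplitude there is as small as the oscillation of the iterates, although it is not small
  elsewhere.
\<close>
lemma approx_flat:
  fixes x :: "real^'m" and \<kappa> :: "'n::finite"
  assumes card: "\<And>j. L j ^ CARD('m) = M j ^ CARD('n)" and "x \<in> nest k j"
  shows "jet_bound {x} r (2 * decay CARD('m) k j) (start_rate CARD('m) * spread CARD('m) k j)
    (\<lambda>z. approx \<kappa> k j z - approx \<kappa> k j x)"
  using assms(2)
proof (induction k arbitrary: j x)
  case 0
  have "jet_bound {x} r (1 + 1) (start_rate CARD('m)) (\<lambda>z. start z - start x)"
    using start_rate_ge [where 'm = 'm] approx_range [of \<kappa> 0 j x]
    by (intro jet_bound_diff jet_bound_mono [OF start_bound] jet_bound_const) auto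
  then show ?case
    by (simp add: decay_def spread_def)
next
  case (Suc k)
  let ?f = "approx \<kappa> k (Suc j)" and ?F = "refine (L j) (M j) \<kappa> (approx \<kappa> k (Suc j))"
    and ?A = "2 * decay CARD('m) k (Suc j)" and ?l = "start_rate CARD('m) * spread CARD('m) k (Suc j)"
  obtain A l where A: "0 \<le> A" "1 \<le> l" "jet_bound UNIV r A l (?F :: real^'m \<Rightarrow> real)"
    using approx_bounded [of \<kappa> "Suc k" j, where 'm = 'm] by auto
  have 1: "jet_bound UNIV r (A + \<bar>?F x\<bar>) l (\<lambda>z::real^'m. ?F z - ?F x)"
    using A by (intro jet_bound_diff jet_bound_const) auto
  have 2: "jet_bound {x} r (6 ^ CARD('m) / M j * ?A) (growth CARD('m) * L j * ?l)
      (\<lambda>z. slope (L j) (M j) \<kappa> z * (?f (fold_map (L j) z) - ?f (fold_map (L j) x)))"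
  proof (rule slope_compose_bound [OF L_pos M_pos Suc.IH])
    show "fold_map (L j) x \<in> nest k (Suc j)"
      using Suc.prems by auto
    show "1 \<le> ?l"
      using mult_mono [OF start_rate_ge [where 'm = 'm] spread_ge [of "CARD('m)" k "Suc j"]]
        start_rate_ge [where 'm = 'm] by simp
  qed (use decay_nonneg in auto)
  have 3: "\<forall>\<^sub>F z in nhds x. ?F z - ?F x
      = slope (L j) (M j) \<kappa> z * (?f (fold_map (L j) z) - ?f (fold_map (L j) x))"
    using Suc.prems by (intro refine_near_skeleton odd_L odd_M approx_0 approx_1 [OF card]) auto
  have "jet_bound {x} r (6 ^ CARD('m) / M j * ?A) (growth CARD('m) * L j * ?l) (\<lambda>z. ?F z - ?F x)"
  proof (rule jet_bound_local [OF 1 2])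
    fix y assume "y \<in> {x}"
    then have "y = x"
      by simp
    show "\<forall>\<^sub>F z in nhds y. ?F z - ?F x
        = slope (L j) (M j) \<kappa> z * (?f (fold_map (L j) z) - ?f (fold_map (L j) x))"
      unfolding \<open>y = x\<close> by (rule 3)
  qed
  then show ?case
    unfolding approx.simps(2) decay_Suc spread_Suc by (simp add: mult_ac)
qed

definition increment :: "'n::finite \<Rightarrow> nat \<Rightarrow> real^'m \<Rightarrow> real" where
  "increment \<kappa> k = (case k of 0 \<Rightarrow> start | Suc q \<Rightarrow> (\<lambda>x. approx \<kappa> (Suc q) 0 x - approx \<kappa> q 0 x))"

definition amplitude :: "nat \<Rightarrow> nat \<Rightarrow> real" where
  "amplitude m k = (case k of 0 \<Rightarrow> 1 | Suc q \<Rightarrow> 3 * 6 ^ m * decay m q 0)"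

definition rate :: "nat \<Rightarrow> nat \<Rightarrow> real" where
  "rate m k = (case k of 0 \<Rightarrow> start_rate m | Suc q \<Rightarrow> start_rate m * (growth m * L q) * spread m q 0)"

lemma increment_bound:
  "jet_bound UNIV r (amplitude CARD('m) k) (rate CARD('m) k) (increment \<kappa> k :: real^'m \<Rightarrow> real)"
proof (cases k)
  case 0
  then show ?thesis
    using start_bound by (simp add: increment_def amplitude_def rate_def)
next
  case (Suc q)
  then show ?thesis
    using approx_step_bound [of q 0 \<kappa>] by (simp add: increment_def amplitude_def rate_def)
qed

lemma sum_increment: "(\<Sum>i<Suc k. increment \<kappa> i x) = approx \<kappa> k 0 x"
  by (induction k) (auto simp: increment_def)

definition limit :: "'n::finite \<Rightarrow> real^'m \<Rightarrow> real" where
  "limit \<kappa> x = (\<Sum>k. increment \<kappa> k x)"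

definition core :: "(real^'m) set" where
  "core = (\<Inter>k. nest k 0)"

lemma nest_antimono: "k \<le> q \<Longrightarrow> nest q 0 \<subseteq> nest k 0"
  by (induction rule: dec_induct) (use nest_Suc_subset in blast)+

lemma connected_core: "connected (core :: (real^'m) set)"
  unfolding core_def by (rule connected_nest [OF compact_nest nest_connected nest_antimono])

lemma core_subset: "core \<subseteq> cbox 0 1"
  using nest_subset unfolding core_def by blast

lemma rate_pos: "0 < rate CARD('m::finite) k"
proof (cases k)
  case 0
  then show ?thesis
    using start_rate_ge [where 'm = 'm] by (simp add: rate_def)
next
  case (Suc q)
  have "0 < start_rate CARD('m) * (growth CARD('m) * L q) * spread CARD('m) q 0"
    using start_rate_ge [where 'm = 'm] growth_L_ge [of "CARD('m)" q] spread_ge [of "CARD('m)" q 0]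
    by (intro mult_pos_pos [OF mult_pos_pos]) linarith+
  then show ?thesis
    by (simp add: rate_def Suc)
qed

text \<open>
  The ratio of consecutive terms is at most a constant times \<open>2 k + 3\<close> to the negative power
  \<open>n \<kappa> - m\<close>.  That it tends to \<open>0\<close> allows a single construction to serve all \<open>\<kappa>\<close> below \<open>m / n\<close>.
\<close>
lemma amplitude_rate_summable:
  assumes L: "\<And>j. L j = (2 * j + 3) ^ n" and M: "\<And>j. M j = (2 * j + 3) ^ CARD('m::finite)"
    and "0 \<le> \<kappa>" "\<kappa> < real CARD('m) / real n" "0 < n"
  shows "summable (\<lambda>k. amplitude CARD('m) k * rate CARD('m) k powr \<kappa>)"
proof -
  let ?m = "CARD('m)" 
  define a where "a k = amplitude ?m (Suc k) * rate ?m (Suc k) powr \<kappa>" for k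
  define C where "C = 6 ^ ?m * (growth ?m * 2 ^ n) powr \<kappa>"
  define \<epsilon> where "\<epsilon> = real n * \<kappa> - real ?m"
  have \<epsilon>: "\<epsilon> < 0"
    using assms(4,5) by (simp add: \<epsilon>_def field_simps)
  have growth: "0 \<le> growth ?m"
    using growth_ge [of ?m] by linarith
  have step: "a (Suc k) \<le> C * real (2 * k + 3) powr \<epsilon> * a k" for k
  proof -
    let ?l = "real (2 * k + 3)"
    have "real (L (Suc k)) \<le> 2 ^ n * real (L k)"
    proof -
      have "real (2 * Suc k + 3) ^ n \<le> (2 * real (2 * k + 3)) ^ n"
        by (intro power_mono) auto
      then show ?thesis
        by (simp only: L of_nat_power power_mult_distrib)
    qed
    then have "rate ?m (Suc (Suc k)) \<le> start_rate ?m * (growth ?m * (2 ^ n * L k)) * spread ?m (Suc k) 0"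
      unfolding rate_def using growth start_rate_ge [where 'm = 'm] spread_ge [of ?m "Suc k" 0]
      by (auto intro!: mult_right_mono mult_left_mono)
    also have "\<dots> = (growth ?m * 2 ^ n * L k) * rate ?m (Suc k)"
      by (simp add: rate_def spread_def)
    finally have "rate ?m (Suc (Suc k)) powr \<kappa> \<le> ((growth ?m * 2 ^ n * L k) * rate ?m (Suc k)) powr \<kappa>"
      using assms(3) rate_pos [of "Suc (Suc k)", where 'm = 'm] by (intro powr_mono2) auto
    also have "\<dots> = (growth ?m * 2 ^ n) powr \<kappa> * real (L k) powr \<kappa> * rate ?m (Suc k) powr \<kappa>"
      using growth rate_pos [of "Suc k", where 'm = 'm] by (simp add: powr_mult less_imp_le)
    also have "real (L k) powr \<kappa> = ?l powr (real n * \<kappa>)"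
      unfolding L of_nat_power by (subst powr_realpow [symmetric]) (auto simp: powr_powr)
    finally have rate: "rate ?m (Suc (Suc k)) powr \<kappa>
        \<le> (growth ?m * 2 ^ n) powr \<kappa> * ?l powr (real n * \<kappa>) * rate ?m (Suc k) powr \<kappa>" .
    have M': "real (M k) = ?l powr real ?m"
      unfolding M of_nat_power by (subst powr_realpow) auto
    have amp: "amplitude ?m (Suc (Suc k)) = 6 ^ ?m / ?l powr real ?m * amplitude ?m (Suc k)"
      by (simp add: amplitude_def decay_def M')
    have nonneg: "0 \<le> amplitude ?m (Suc k)"
      using decay_nonneg by (simp add: amplitude_def)
    have "a (Suc k) \<le> (6 ^ ?m / ?l powr real ?m * amplitude ?m (Suc k)) *
        ((growth ?m * 2 ^ n) powr \<kappa> * ?l powr (real n * \<kappa>) * rate ?m (Suc k) powr \<kappa>)"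
      unfolding a_def amp using nonneg by (intro mult_left_mono rate) auto
    also have "\<dots> = C * ?l powr \<epsilon> * a k"
      by (simp add: C_def \<epsilon>_def a_def powr_diff)
    finally show ?thesis .
  qed
  have "(\<lambda>k. C * real (2 * k + 3) powr \<epsilon>) \<longlonglongrightarrow> C * 0"
  proof (intro tendsto_mult_left tendsto_neg_powr [OF \<epsilon>])
    show "LIM k sequentially. real (2 * k + 3) :> at_top"
      by (rule filterlim_at_top_mono [OF filterlim_real_sequentially]) (auto intro!: always_eventually)
  qed
  then have "\<forall>\<^sub>F k in sequentially. C * real (2 * k + 3) powr \<epsilon> < 1 / 2"
    by (rule order_tendstoD(2)) simp
  then obtain K where K: "\<And>k. K \<le> k \<Longrightarrow> C * real (2 * k + 3) powr \<epsilon> < 1 / 2"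
    by (auto simp: eventually_sequentially)
  have a: "0 \<le> a k" for k
    using decay_nonneg by (simp add: a_def amplitude_def)
  have "summable a"
  proof (rule summable_ratio_test)
    show "norm (a (Suc k)) \<le> 1 / 2 * norm (a k)" if "K \<le> k" for k
      using step [of k] mult_right_mono [OF less_imp_le [OF K [OF that]] a [of k]] a by simp
  qed simp
  then show ?thesis
    unfolding a_def by (subst (asm) summable_Suc_iff)
qed

end

section \<open>The limit map\<close>

text \<open>
  The type arguments \<open>m\<close> and \<open>n\<close> fix the two dimensions.  The order \<open>r\<close> of the smooth step exceeds \<open>N\<close>
  by one, as \<open>jet_series\<close> requires.
\<close>
locale nested_limit = nested_refinement s s' r \<sigma> L M for s s' r \<sigma> L M +
  fixes m :: "'m::finite itself" and n :: "'n::finite itself" and N :: nat and \<delta> :: real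
  assumes card: "L j ^ CARD('m) = M j ^ CARD('n)"
    and r: "r = Suc N"
    and amplitude_summable: "0 \<le> \<kappa> \<Longrightarrow> \<kappa> < \<delta> \<Longrightarrow>
      summable (\<lambda>k. amplitude CARD('m) k * rate CARD('m) k powr \<kappa>)"
    and N_less: "real N < \<delta>" and less_N: "\<delta> \<le> real N + 1"
begin

sublocale series: jet_series "increment \<kappa> :: nat \<Rightarrow> real^'m \<Rightarrow> real" "amplitude CARD('m)" "rate CARD('m)" N \<delta>
  for \<kappa> :: 'n
proof
  show "jet_bound UNIV (Suc N) (amplitude CARD('m) k) (rate CARD('m) k) (increment \<kappa> k :: real^'m \<Rightarrow> real)" for k
    using increment_bound [of k \<kappa>, where 'm = 'm] by (simp add: r)
qed (use rate_pos amplitude_summable N_less in auto)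

lemma limit_eq: "limit \<kappa> = (\<lambda>x::real^'m. \<Sum>k. increment \<kappa> k x)"
  by (simp add: limit_def [abs_def])

sublocale smooth_components "limit :: 'n \<Rightarrow> real^'m \<Rightarrow> real" N \<delta>
proof
  fix js :: "'m list" and \<kappa> :: 'n
  note eq = series.iterated_partial_series [of _ \<kappa>, folded limit_eq]
  show "has_partial (axis i 1) (iterated_partial UNIV js (limit \<kappa>)) (iterated_partial UNIV (i # js) (limit \<kappa>))"
    if "length js < N" for i
    using series.has_partial_series [OF that] eq [of js] eq [of "i # js"] that
    by (simp del: iterated_partial.simps)
  show "continuous_on UNIV (iterated_partial UNIV js (limit \<kappa>))" if "length js \<le> N"
    using series.continuous_series [OF that] eq [OF that] by simp
  show "\<exists>C. \<forall>a i t. \<bar>iterated_partial UNIV js (limit \<kappa>) (a + t *\<^sub>R axis i 1)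
        - iterated_partial UNIV js (limit \<kappa>) a\<bar> \<le> C * \<bar>t\<bar> powr \<alpha>"
    if "length js \<le> N" "0 \<le> \<alpha>" "\<alpha> \<le> 1" "real (length js) + \<alpha> < \<delta>" for \<alpha>
    using series.Hoelder_series [OF that] eq [OF that(1)] by simp
qed (fact N_less less_N)+

lemma uniform_limit_approx:
  "uniform_limit UNIV (\<lambda>k x. approx \<kappa> k 0 x) (limit (\<kappa> :: 'n) :: real^'m \<Rightarrow> real) sequentially"
proof -
  have "uniform_limit UNIV (\<lambda>k x. \<Sum>i<k. increment \<kappa> i x) (limit (\<kappa> :: 'n) :: real^'m \<Rightarrow> real) sequentially"
    using series.uniform_limit_series [of "[]" \<kappa>] by (simp add: limit_eq)
  then have "uniform_limit UNIV (\<lambda>k x. \<Sum>i<Suc k. increment \<kappa> i x) (limit (\<kappa> :: 'n) :: real^'m \<Rightarrow> real) sequentially"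
    by (rule filterlim_compose [OF _ filterlim_Suc])
  then show ?thesis
    by (simp only: sum_increment)
qed

lemma limit_range: "0 \<le> limit (\<kappa> :: 'n) (x :: real^'m)" "limit \<kappa> x \<le> 1"
proof -
  have lim: "(\<lambda>k. approx \<kappa> k 0 x) \<longlonglongrightarrow> limit \<kappa> x"
    using tendsto_uniform_limitI [OF uniform_limit_approx] by simp
  show "0 \<le> limit \<kappa> x"
    by (rule LIMSEQ_le_const [OF lim]) (simp add: approx_range)
  show "limit \<kappa> x \<le> 1"
    by (rule LIMSEQ_le_const2 [OF lim]) (simp add: approx_range)
qed

lemma joined_range: "joined x \<in> cbox 0 1"
  by (simp add: joined_def mem_box_cart limit_range)

text \<open>
  By \<open>approx_flat\<close> the derivatives of the iterates at a point of \<open>core\<close> are bounded by the terms of a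
  convergent series.
\<close>
lemma limit_flat:
  fixes x :: "real^'m" and \<kappa> :: 'n
  assumes "x \<in> core" "0 < length js" "length js \<le> N"
  shows "iterated_partial UNIV js (limit \<kappa>) x = 0"
proof -
  let ?q = "length js"
  have eq: "(\<Sum>i<Suc k. iterated_partial UNIV js (increment \<kappa> i) x) = iterated_partial UNIV js (approx \<kappa> k 0) x" for k
  proof -
    have "iterated_partial UNIV js (\<lambda>x. \<Sum>i<Suc k. increment \<kappa> i x)
        = (\<lambda>x. \<Sum>i<Suc k. iterated_partial UNIV js (increment \<kappa> i :: real^'m \<Rightarrow> real) x)"
      using assms(3) by (intro iterated_partial_sum [OF increment_bound]) (simp add: r)
    then show ?thesis
      by (simp only: sum_increment)
  qed
  have le: "norm (iterated_partial UNIV js (approx \<kappa> k 0) x) \<le> amplitude CARD('m) (Suc k) * rate CARD('m) (Suc k) ^ ?q" for k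
  proof -
    have "x \<in> nest k 0"
      using assms(1) by (auto simp: core_def)
    from jet_bound_iterated [OF approx_flat [OF card this, of \<kappa>], of js]
    have "\<bar>iterated_partial UNIV js (\<lambda>z. approx \<kappa> k 0 z - approx \<kappa> k 0 x) x\<bar>
        \<le> 2 * decay CARD('m) k 0 * (start_rate CARD('m) * spread CARD('m) k 0) ^ ?q"
      using jet_bound_abs assms(3) by (fastforce simp: r)
    moreover obtain A l where "jet_bound UNIV r A l (approx \<kappa> k 0 :: real^'m \<Rightarrow> real)"
      using approx_bounded by blast
    from iterated_partial_diff_const [OF this, of js] have "iterated_partial UNIV js (\<lambda>z. approx \<kappa> k 0 z - approx \<kappa> k 0 x)
        = iterated_partial UNIV js (approx \<kappa> k 0 :: real^'m \<Rightarrow> real)"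
      using assms(2,3) r by simp
    ultimately have "\<bar>iterated_partial UNIV js (approx \<kappa> k 0) x\<bar>
        \<le> 2 * decay CARD('m) k 0 * (start_rate CARD('m) * spread CARD('m) k 0) ^ ?q"
      by simp
    also have "\<dots> \<le> (3 * 6 ^ CARD('m) * decay CARD('m) k 0) * (rate CARD('m) (Suc k)) ^ ?q"
    proof (rule mult_mono [OF _ power_mono])
      have "1 \<le> (6::real) ^ CARD('m)"
        by simp
      then have "(2::real) \<le> 3 * 6 ^ CARD('m)"
        by linarith
      then show "2 * decay CARD('m) k 0 \<le> 3 * 6 ^ CARD('m) * decay CARD('m) k 0"
        by (rule mult_right_mono [OF _ decay_nonneg])
      have "start_rate CARD('m) * 1 * spread CARD('m) k 0 \<le> start_rate CARD('m) * (growth CARD('m) * L k) * spread CARD('m) k 0"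
        using start_rate_ge [where 'm = 'm] growth_L_ge [of "CARD('m)" k] spread_ge [of "CARD('m)" k 0]
        by (intro mult_right_mono mult_left_mono) auto
      then show "start_rate CARD('m) * spread CARD('m) k 0 \<le> rate CARD('m) (Suc k)"
        by (simp add: rate_def)
    qed (use decay_nonneg start_rate_ge [where 'm = 'm] spread_ge [of "CARD('m)" k 0] in auto)
    finally show ?thesis
      by (simp add: amplitude_def)
  qed
  have "(\<lambda>k. amplitude CARD('m) (Suc k) * rate CARD('m) (Suc k) ^ ?q) \<longlonglongrightarrow> 0"
    using series.summable_power [OF assms(3)] by (intro LIMSEQ_Suc summable_LIMSEQ_zero)
  then have "(\<lambda>k. iterated_partial UNIV js (approx \<kappa> k 0) x) \<longlonglongrightarrow> 0"
    by (rule Lim_null_comparison [OF always_eventually [OF allI [OF le]]])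
  moreover have "(\<lambda>k. \<Sum>i<k. iterated_partial UNIV js (increment \<kappa> i) x) \<longlonglongrightarrow> iterated_partial UNIV js (limit \<kappa>) x"
    using summable_LIMSEQ [OF series.summable_term [OF assms(3), of \<kappa> x]]
      series.iterated_partial_series [OF assms(3), of \<kappa>] by (simp add: limit_eq)
  then have "(\<lambda>k. \<Sum>i<Suc k. iterated_partial UNIV js (increment \<kappa> i) x) \<longlonglongrightarrow> iterated_partial UNIV js (limit \<kappa>) x"
    by (rule LIMSEQ_Suc)
  ultimately show ?thesis
    unfolding eq by (rule LIMSEQ_unique [symmetric])
qed

text \<open>
  An accumulation point of approximate preimages, taken from smaller and smaller sets of the nest, is an
  exact preimage in \<open>core\<close>.
\<close>
lemma core_onto: "joined ` core = cbox 0 1"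
proof
  show "joined ` core \<subseteq> cbox 0 1"
    using joined_range by blast
  show "cbox 0 1 \<subseteq> joined ` core"
  proof
    fix v :: "real^'n" assume "v \<in> cbox 0 1"
    then have "0 \<le> v $ \<kappa>" "v $ \<kappa> \<le> 1" for \<kappa>
      by (auto simp: mem_box_cart)
    then have "\<exists>x\<in>(nest k 0 :: (real^'m) set). \<forall>\<kappa>. \<bar>approx \<kappa> k 0 x - v $ \<kappa>\<bar> \<le> (1 / 3) ^ k" for k
      by (intro approx_nearly_onto [OF card])
    then obtain x :: "nat \<Rightarrow> real^'m" where x: "\<And>k. x k \<in> nest k 0"
      "\<And>k \<kappa>. \<bar>approx \<kappa> k 0 (x k) - v $ \<kappa>\<bar> \<le> (1 / 3) ^ k"
      by metis
    have "seq_compact (cbox 0 1 :: (real^'m) set)"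
      by (simp add: compact_imp_seq_compact compact_cbox)
    moreover have "\<forall>k. x k \<in> cbox 0 1"
      using x(1) nest_subset by blast
    ultimately obtain y h where h: "strict_mono h" "(x \<circ> h) \<longlonglongrightarrow> y"
      using seq_compactE by metis
    have "y \<in> nest k 0" for k
    proof (rule Lim_in_closed_set [OF compact_imp_closed [OF compact_nest] _ _ h(2)])
      show "\<forall>\<^sub>F i in sequentially. (x \<circ> h) i \<in> nest k 0"
        using eventually_ge_at_top [of k]
      proof eventually_elim
        case (elim i)
        then have "k \<le> h i"
          using seq_suble [OF h(1), of i] by simp
        then show ?case
          using x(1) nest_antimono by auto
      qed
    qed simp
    then have y: "y \<in> core"
      by (simp add: core_def)
    have "limit \<kappa> y = v $ \<kappa>" for \<kappa>
    proof -
      have "(\<lambda>k. approx \<kappa> k 0 (x k) - limit \<kappa> (x k)) \<longlonglongrightarrow> 0"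
      proof (rule metric_LIMSEQ_I)
        fix e :: real assume "0 < e"
        then obtain K where "\<forall>k\<ge>K. \<forall>x. dist (approx \<kappa> k 0 x) (limit \<kappa> (x::real^'m)) < e"
          using uniform_limitD [OF uniform_limit_approx [of \<kappa>]] by (auto simp: eventually_sequentially)
        then show "\<exists>K. \<forall>k\<ge>K. dist (approx \<kappa> k 0 (x k) - limit \<kappa> (x k)) 0 < e"
          by (intro exI [of _ K]) (auto simp: dist_norm)
      qed
      moreover have "(\<lambda>k. approx \<kappa> k 0 (x k) - v $ \<kappa>) \<longlonglongrightarrow> 0"
      proof (rule Lim_null_comparison)
        show "\<forall>\<^sub>F k in sequentially. norm (approx \<kappa> k 0 (x k) - v $ \<kappa>) \<le> (1 / 3) ^ k"
          using x(2) by simp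
        show "(\<lambda>k. (1 / 3 :: real) ^ k) \<longlonglongrightarrow> 0"
          by (intro LIMSEQ_realpow_zero) auto
      qed
      ultimately have "(\<lambda>k. v $ \<kappa> + ((approx \<kappa> k 0 (x k) - v $ \<kappa>) - (approx \<kappa> k 0 (x k) - limit \<kappa> (x k))))
          \<longlonglongrightarrow> v $ \<kappa> + (0 - 0)"
        by (intro tendsto_intros)
      then have "(\<lambda>k. limit \<kappa> (x k)) \<longlonglongrightarrow> v $ \<kappa>"
        by simp
      from LIMSEQ_subseq_LIMSEQ [OF this h(1)]
      have "(\<lambda>k. limit \<kappa> ((x \<circ> h) k)) \<longlonglongrightarrow> v $ \<kappa>"
        by (simp add: o_def)
      moreover have "(\<lambda>k. limit \<kappa> ((x \<circ> h) k)) \<longlonglongrightarrow> limit \<kappa> y"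
        by (rule continuous_on_tendsto_compose [OF continuous [of "[]" \<kappa>, simplified] h(2)]) simp_all
      ultimately show ?thesis
        by (rule LIMSEQ_unique [symmetric])
    qed
    then have "joined y = v"
      by (simp add: joined_def vec_eq_iff)
    then show "v \<in> joined ` core"
      using y by blast
  qed
qed

end

lemma smooth_step_exists: "\<exists>s s' \<sigma>. smooth_step s s' r \<sigma>"
proof -
  obtain l where l: "1 \<le> l" "jet_bound UNIV (Suc r) 1 l (step (Suc r))"
    using step_jet_bound [of "Suc r"] by blast
  obtain s' where s': "has_partial 1 (step (Suc r)) s'" "jet_bound UNIV r (1 * l) l s'"
    using jet_bound_partial [OF l(2), of 1] by auto
  have "smooth_step (step (Suc r)) s' r l"
  proof
    show "step (Suc r) x = 0" if "x \<le> 0" for x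
      using that by (rule step_eq_0)
    show "step (Suc r) x = 1" if "1 \<le> x" for x
      using that by (rule step_eq_1)
  qed (use l s' step_mono jet_bound_lower [OF l(2)] in simp_all)
  then show ?thesis by blast
qed

theorem theorem1:
  "\<exists>(p :: real^'m \<Rightarrow> real^'n) (E :: (real^'m) set).
     p ` cbox 0 1 \<subseteq> cbox 0 1 \<and>
     (\<forall>k::real. 0 \<le> k \<and> k < real CARD('m) / real CARD('n) \<longrightarrow> class_C k (cbox 0 1) p) \<and>
     connected E \<and> E \<subseteq> cbox 0 1 \<and>
     (\<forall>k::real. 0 < k \<and> k < real CARD('m) / real CARD('n) \<longrightarrow>
        (\<forall>D\<in>partials_of_order k (cbox 0 1) p. \<forall>a\<in>E. D a = 0)) \<and>
     p ` E = cbox 0 1"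
proof -
  define \<delta> where "\<delta> = real CARD('m) / real CARD('n)"
  \<comment> \<open>The largest integer strictly below \<open>\<delta>\<close>, also when \<open>\<delta>\<close> is an integer.\<close>
  define N where "N = nat (\<lceil>\<delta>\<rceil> - 1)"
  \<comment> \<open>Odd bases make the vertices of the paths alternate in parity, and their growth absorbs the
    constants of the stages.\<close>
  define L where "L j = (2 * j + 3) ^ CARD('n)" for j :: nat
  define M where "M j = (2 * j + 3) ^ CARD('m)" for j :: nat
  have "0 < \<delta>"
    by (simp add: \<delta>_def)
  then have N: "real N < \<delta>" "\<delta> \<le> real N + 1"
    unfolding N_def by linarith+
  obtain s s' \<sigma> where "smooth_step s s' (Suc N) \<sigma>"
    using smooth_step_exists by blast
  then interpret smooth_step s s' "Suc N" \<sigma> .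
  interpret nested_refinement s s' "Suc N" \<sigma> L M
  proof
    show "3 \<le> M j" for j
      using self_le_power [of "2 * j + 3" "CARD('m)"] by (simp add: M_def)
  qed (simp_all add: L_def M_def)
  interpret nested_limit s s' "Suc N" \<sigma> L M "TYPE('m)" "TYPE('n)" N \<delta>
  proof
    show "L j ^ CARD('m) = M j ^ CARD('n)" for j
      by (simp add: L_def M_def mult.commute flip: power_mult)
    show "summable (\<lambda>k. amplitude CARD('m) k * rate CARD('m) k powr \<kappa>)" if "0 \<le> \<kappa>" "\<kappa> < \<delta>" for \<kappa>
      using that by (intro amplitude_rate_summable [of "CARD('n)"]) (auto simp: L_def M_def \<delta>_def)
  qed (use N in auto)
  have "d a = 0" if "0 < k" "k < \<delta>" "d \<in> partials_of_order k (cbox 0 1) joined" "a \<in> core" for k d a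
    using that core_subset limit_flat by (intro partials_of_order_zero [OF that(1,2) _ that(3)]) auto
  then show ?thesis
    using joined_range class_C_joined connected_core core_subset core_onto unfolding \<delta>_def
    by (intro exI [of _ joined] exI [of _ core]) blast
qed

end
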